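(* Let $X\in\mathbb{R}^p$ be a random vector and assume that we have two representations $$A^{(1)}Z^{(1)}+E^{(1)} \;=\; X \;=\; A^{(2)}Z^{(2)}+E^{(2)},$$ with the following properties for $i=1,2$: (i) $A^{(i)}\in\mathbb{R}^{p\times k^{(i)}}$ is a (non-random) matrix whose columns are non-zero and pairwise non-proportional; (ii) $E^{(i)}\in\mathbb{R}^p$ is a (possibly degenerate) $p$-variate Gaussian random vector, $E^{(i)}\sim\mathcal{N}(\mu^{(i)},\Sigma^{(i)})$, with $\mu^{(i)}\in\mathbb{R}^p$ and positive semi-definite covariance matrix $\Sigma^{(i)}$; (iii) $Z^{(i)}\in\mathbb{R}^{k^{(i)}}$ is a random vector whose $k^{(i)}$ components $Z^{(i)}_1,\dots,Z^{(i)}_{k^{(i)}}$ are mutually independent, and each component $Z^{(i)}_j$ is a (non-constant) non-Gaussian random variable; (iv) $E^{(i)}$ is independent of $Z^{(i)}$. Then $k^{(1)}=k^{(2)}=:k$, and there exist a permutation matrix $P\in\mathbb{R}^{k\times k}$, given by $Pe_j=e_{\rho(j)}$ for a permutation $\rho$ of $\{1,\dots,k\}$, and an invertible diagonal matrix $\Lambda=\operatorname{diag}(\lambda_1,\dots,\lambda_k)\in\mathbb{R}^{k\times k}$ such that $$A^{(2)}=A^{(1)}P\Lambda,\qquad \operatorname{rank}(A^{(2)})=\operatorname{rank}(A^{(1)}),$$ and such that for every $j=1,\dots,k$ there exists a complex polynomial $g_j$ with $$\varphi_{Z^{(2)}_j}(\lambda_j t)=\varphi_{Z^{(1)}_{\rho(j)}}(t)\cdot\exp(g_j(t))$$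 for all $t$ in a neighbourhood of the origin in $\mathbb{R}$. Furthermore, and in particular, $A^{(2)}$ has a left inverse ($\operatorname{rank}(A^{(2)})=k$) if and only if $A^{(1)}$ has a left inverse ($\operatorname{rank}(A^{(1)})=k$). If this is the case, then for each $j=1,\dots,k$ separately we have $\deg(g_j)\le 2$ and there exist a constant $\nu_j\in\mathbb{R}$ and a (possibly degenerate) random variable $G_j\sim\mathcal{N}(0,\sigma_j^2)$ such that at least one of the following two cases holds, according to the sign of the (constant, real) second derivative $g_j''$: $$\lambda_jZ^{(2)}_j+\nu_j\stackrel{d}{=}Z^{(1)}_{\rho(j)}+G_j,\quad G_j \text{ independent of } Z^{(1)}_{\rho(j)},\qquad\text{if } g_j''\le 0,$$ $$Z^{(1)}_{\rho(j)}\stackrel{d}{=}\bigl(\lambda_jZ^{(2)}_j+\nu_j\bigr)+G_j,\quad G_j \text{ independent of } Z^{(2)}_j,\qquad\text{if } g_j''\ge 0.$$ If $g_j''\neq0$, exactly one of the two cases applies; if $g_j''=0$, then $G_j=0$ and both hold and coincide. The polynomial $g_j$ is determined near the origin only up to an additive constant in $2\pi i\,\mathbb{Z}$; in particular $\deg(g_j)$ and $g_j''$ are well defined.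
   Context: All random objects live on one probability space. $\varphi_Y(t)=\mathbb{E}[\exp(it^{\mathsf T}Y)]$ is the characteristic function of a random vector $Y$; $\stackrel{d}{=}$ means equality in law; $e_j$ is the $j$-th standard basis vector. A random vector $E$ in $\mathbb{R}^p$ is (possibly degenerate) Gaussian, $E\sim\mathcal{N}(\mu,\Sigma)$ with $\Sigma$ positive semi-definite (possibly singular), if $\varphi_E(t)=\exp(it^{\mathsf T}\mu-\tfrac12t^{\mathsf T}\Sigma t)$ for all $t$; in particular constants count as Gaussian, with $\mathcal{N}(\mu,0)=\delta_\mu$. Non-Gaussian means not of this form. Two vectors $a,b$ are proportional if $a=\lambda b$ for some $\lambda\in\mathbb{R}\setminus\{0\}$. Non-constant means the law is not a Dirac measure. *)

theory Defs
  imports "HOL-Probability.Probability" "Jordan_Normal_Form.DL_Rank"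
    "HOL-Computational_Algebra.Polynomial"
begin

(* Both HOL-Analysis and Jordan_Normal_Form use the infix symbols for component access and
   inner product; from here on they refer to Jordan_Normal_Form vectors only. *)
no_notation vec_nth (infixl \<open>$\<close> 90)
no_notation inner (infix \<open>\<bullet>\<close> 70)

section \<open>Random vectors\<close>

text \<open>The Borel sigma-algebra of \<open>\<real>\<^sup>n\<close>, with \<open>\<real>\<^sup>n\<close> rendered as \<^term>\<open>carrier_vec n\<close>: it is generated by
  the coordinate maps, i.e. transported from the product sigma-algebra on extensional functions.
  A random vector in \<open>\<real>\<^sup>n\<close> is a measurable map into this measurable space, see
  \<open>measurable_borel_vec_iff\<close> below.\<close>

definition borel_vec :: "nat \<Rightarrow> real Matrix.vec measure" where
  "borel_vec n = vimage_algebra (carrier_vec n) (\<lambda>v. \<lambda>i\<in>{..<n}. v $ i) (\<Pi>\<^sub>M i\<in>{..<n}. borel)"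

lemma measurable_borel_vec_iff:
  "X \<in> M \<rightarrow>\<^sub>M borel_vec n \<longleftrightarrow>
    (\<forall>\<omega>\<in>space M. X \<omega> \<in> carrier_vec n) \<and> (\<forall>i<n. (\<lambda>\<omega>. X \<omega> $ i) \<in> borel_measurable M)"
proof
  have "(\<lambda>v. \<lambda>i\<in>{..<n}. v $ i) \<in> borel_vec n \<rightarrow>\<^sub>M (\<Pi>\<^sub>M i\<in>{..<n}. (borel :: real measure))"
    unfolding borel_vec_def
    by (rule measurable_vimage_algebra1) (auto simp: space_PiM)
  then have coord: "(\<lambda>v. v $ i) \<in> borel_measurable (borel_vec n)" if "i < n" for i
  proof -
    have "(\<lambda>v. (\<lambda>i\<in>{..<n}. v $ i) i) \<in> borel_measurable (borel_vec n)"
      by (rule measurable_compose[OF \<open>(\<lambda>v. \<lambda>i\<in>{..<n}. v $ i) \<in> _\<close> measurable_component_singleton])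
        (use that in simp)
    with that show ?thesis by simp
  qed
  assume X: "X \<in> M \<rightarrow>\<^sub>M borel_vec n"
  then show "(\<forall>\<omega>\<in>space M. X \<omega> \<in> carrier_vec n) \<and> (\<forall>i<n. (\<lambda>\<omega>. X \<omega> $ i) \<in> borel_measurable M)"
    using measurable_compose[OF X coord] measurable_space[OF X] by (auto simp: borel_vec_def)
next
  assume "(\<forall>\<omega>\<in>space M. X \<omega> \<in> carrier_vec n) \<and> (\<forall>i<n. (\<lambda>\<omega>. X \<omega> $ i) \<in> borel_measurable M)"
  then show "X \<in> M \<rightarrow>\<^sub>M borel_vec n"
    unfolding borel_vec_def
    by (intro measurable_vimage_algebra2 measurable_restrict) auto
qed

definition char_vec :: "'a measure \<Rightarrow> ('a \<Rightarrow> real Matrix.vec) \<Rightarrow> real Matrix.vec \<Rightarrow> complex" where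
  "char_vec M Y t = (CLINT \<omega>|M. iexp (t \<bullet> Y \<omega>))"

definition char_rv :: "'a measure \<Rightarrow> ('a \<Rightarrow> real) \<Rightarrow> real \<Rightarrow> complex" where
  "char_rv M Y = char (distr M borel Y)"

definition pos_semidef :: "nat \<Rightarrow> real mat \<Rightarrow> bool" where
  "pos_semidef n S \<longleftrightarrow> S \<in> carrier_mat n n \<and> transpose_mat S = S \<and>
     (\<forall>v\<in>carrier_vec n. v \<bullet> (S *\<^sub>v v) \<ge> 0)"

definition gaussian_vec ::
  "'a measure \<Rightarrow> nat \<Rightarrow> ('a \<Rightarrow> real Matrix.vec) \<Rightarrow> real Matrix.vec \<Rightarrow> real mat \<Rightarrow> bool" where
  "gaussian_vec M n E m S \<longleftrightarrow>
     E \<in> M \<rightarrow>\<^sub>M borel_vec n \<and> m \<in> carrier_vec n \<and> pos_semidef n S \<and>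
     (\<forall>t\<in>carrier_vec n. char_vec M E t =
        exp (\<i> * of_real (t \<bullet> m) - of_real (t \<bullet> (S *\<^sub>v t)) / 2))"

text \<open>The one-dimensional case; the parameter \<open>s\<close> is the variance, and \<open>s = 0\<close> is allowed.\<close>

definition gaussian_rv :: "'a measure \<Rightarrow> ('a \<Rightarrow> real) \<Rightarrow> real \<Rightarrow> real \<Rightarrow> bool" where
  "gaussian_rv M G m s \<longleftrightarrow> G \<in> borel_measurable M \<and> s \<ge> 0 \<and>
     (\<forall>t. char_rv M G t = exp (\<i> * of_real (t * m) - of_real (s * t\<^sup>2) / 2))"

definition non_gaussian :: "'a measure \<Rightarrow> ('a \<Rightarrow> real) \<Rightarrow> bool" where
  "non_gaussian M Y \<longleftrightarrow> \<not> (\<exists>m s. gaussian_rv M Y m s)"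

definition non_constant :: "'a measure \<Rightarrow> ('a \<Rightarrow> real) \<Rightarrow> bool" where
  "non_constant M Y \<longleftrightarrow> \<not> (\<exists>c. distr M borel Y = return borel c)"

section \<open>Matrices\<close>

definition proportional :: "real Matrix.vec \<Rightarrow> real Matrix.vec \<Rightarrow> bool" where
  "proportional a b \<longleftrightarrow> (\<exists>c. c \<noteq> 0 \<and> a = c \<cdot>\<^sub>v b)"

definition has_left_inverse :: "real mat \<Rightarrow> bool" where
  "has_left_inverse A \<longleftrightarrow> (\<exists>B. B \<in> carrier_mat (dim_col A) (dim_row A) \<and> B * A = 1\<^sub>m (dim_col A))"

section \<open>Representations\<close>

text \<open>The representation \<open>X = A Z + E\<close> (almost surely) with \<open>Z\<close> in \<open>\<real>\<^sup>k\<close>.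
  Coordinates and columns are numbered from 0.\<close>

definition linear_gaussian_representation ::
  "'a measure \<Rightarrow> nat \<Rightarrow> ('a \<Rightarrow> real Matrix.vec) \<Rightarrow> nat \<Rightarrow> real mat \<Rightarrow> ('a \<Rightarrow> real Matrix.vec) \<Rightarrow>
     ('a \<Rightarrow> real Matrix.vec) \<Rightarrow> real Matrix.vec \<Rightarrow> real mat \<Rightarrow> bool" where
  "linear_gaussian_representation M p X k A Z E m S \<longleftrightarrow>
     (AE \<omega> in M. A *\<^sub>v Z \<omega> + E \<omega> = X \<omega>) \<and>
     A \<in> carrier_mat p k \<and>
     (\<forall>j<k. col A j \<noteq> 0\<^sub>v p) \<and>
     (\<forall>i<k. \<forall>j<k. i \<noteq> j \<longrightarrow> \<not> proportional (col A i) (col A j)) \<and>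
     gaussian_vec M p E m S \<and>
     Z \<in> M \<rightarrow>\<^sub>M borel_vec k \<and>
     prob_space.indep_vars M (\<lambda>_. borel) (\<lambda>j \<omega>. Z \<omega> $ j) {..<k} \<and>
     (\<forall>j<k. non_constant M (\<lambda>\<omega>. Z \<omega> $ j) \<and> non_gaussian M (\<lambda>\<omega>. Z \<omega> $ j)) \<and>
     prob_space.indep_var M (borel_vec p) E (borel_vec k) Z"

text \<open>\<open>g\<close> is an admissible choice of the polynomial relating \<open>\<phi>\<^bsub>U\<^esub>(l t)\<close> and \<open>\<phi>\<^bsub>V\<^esub>(t)\<close> near \<open>t = 0\<close>.\<close>

definition char_related ::
  "'a measure \<Rightarrow> ('a \<Rightarrow> real) \<Rightarrow> real \<Rightarrow> ('a \<Rightarrow> real) \<Rightarrow> complex poly \<Rightarrow> bool" where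
  "char_related M U l V g \<longleftrightarrow>
     (\<forall>\<^sub>F t in nhds 0. char_rv M U (l * t) = char_rv M V t * exp (poly g (of_real t)))"

text \<open>The two alternatives, to be used with \<open>U\<close> a component of the second and \<open>V\<close> a component of the
  first vector of sources: in law, \<open>l U + \<nu>\<close> equals \<open>V\<close> plus independent Gaussian noise, or conversely.
  The noise \<open>G\<close> lives on the given space \<open>M\<close>.\<close>

definition noise_on_first ::
  "'a measure \<Rightarrow> ('a \<Rightarrow> real) \<Rightarrow> real \<Rightarrow> ('a \<Rightarrow> real) \<Rightarrow> real \<Rightarrow> real \<Rightarrow> ('a \<Rightarrow> real) \<Rightarrow> bool" where
  "noise_on_first M U l V \<nu> \<sigma> G \<longleftrightarrow>
     gaussian_rv M G 0 (\<sigma>\<^sup>2) \<and>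
     distr M borel (\<lambda>\<omega>. l * U \<omega> + \<nu>) = distr M borel (\<lambda>\<omega>. V \<omega> + G \<omega>) \<and>
     prob_space.indep_var M borel G borel V"

definition noise_on_second ::
  "'a measure \<Rightarrow> ('a \<Rightarrow> real) \<Rightarrow> real \<Rightarrow> ('a \<Rightarrow> real) \<Rightarrow> real \<Rightarrow> real \<Rightarrow> ('a \<Rightarrow> real) \<Rightarrow> bool" where
  "noise_on_second M U l V \<nu> \<sigma> G \<longleftrightarrow>
     gaussian_rv M G 0 (\<sigma>\<^sup>2) \<and>
     distr M borel V = distr M borel (\<lambda>\<omega>. (l * U \<omega> + \<nu>) + G \<omega>) \<and>
     prob_space.indep_var M borel G borel U"

end

theory Submission
  imports Defs "HOL-Complex_Analysis.Conformal_Mappings"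
begin

text \<open>
  Let \<open>a\<^sub>j\<close> be the columns of \<open>A\<close>. Independence turns a representation \<open>X = A Z + E\<close> into the product
  \<open>\<phi>\<^sub>X(t) = (\<Prod>j. \<phi>\<^bsub>Z\<^sub>j\<^esub>(a\<^sub>j \<bullet> t)) exp(\<i> t \<bullet> m - t \<bullet> S t / 2)\<close> (\<open>char_representation\<close>). Equating the products of two
  representations and taking logarithms near the origin gives a sum of ridge functions, one for each
  direction \<open>a\<^sub>j\<close> occurring on either side, that equals a quadratic polynomial.

  On a generic plane \<open>t = x u + y v\<close> a direction \<open>a\<close> is determined up to proportionality by its slope
  \<open>(a \<bullet> v) / (a \<bullet> u)\<close> (\<open>generic_plane\<close>). A difference taken along the line on which one ridge function is
  constant removes this function and replaces the others by their differences. Removing all but one in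
  this way, and then the quadratic polynomial by three more differences, shows that all high differences
  of the remaining function vanish. By Frechet's theorem (\<open>frechet_polynomial\<close>) the total ridge function
  of each direction is a polynomial near the origin (\<open>ridge_functions_polynomial\<close>,
  \<open>char_factors_by_slope\<close>).

  If a column of one matrix had no proportional column in the other, the characteristic function of its
  source would therefore be the exponential of a polynomial near the origin. By the theorem of Marcinkiewicz
  (\<open>marcinkiewicz\<close>) that source would be Gaussian, which is excluded. So the columns correspond to each other
  one to one, and the characteristic functions of corresponding sources differ by the exponential of a
  polynomial (\<open>representation_column_matched\<close>).

  If \<open>A\<^sub>1\<close> has a left inverse, then the rows of the left inverse are dual to the columns of \<open>A\<^sub>1\<close>, and
  evaluating the two products on a line spanned by such a row \<open>t\<close> leaves one source on each side. The
  relation between the sources then holds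
  on the whole real line, with the exponent \<open>\<i> d s + c s\<^sup>2 / 2\<close>, where \<open>c = t \<bullet> S\<^sub>2 t - t \<bullet> S\<^sub>1 t\<close>
  (\<open>source_relation_if_left_inverse\<close>). The sign of \<open>c\<close> tells on which side Gaussian noise of variance \<open>\<bar>c\<bar>\<close>
  has to be added. Such a noise variable exists on the given space: if \<open>c < 0\<close>, then \<open>t \<bullet> E\<^sub>1\<close> is a
  non-degenerate Gaussian variable independent of \<open>Z\<^sub>1\<close>, and it can be centred and rescaled; if \<open>c > 0\<close>,
  the same holds for \<open>E\<^sub>2\<close> and \<open>Z\<^sub>2\<close> (\<open>noise_from_representation\<close>).
\<close>

no_notation vec_nth (infixl \<open>$\<close> 90)
no_notation inner (infix \<open>\<bullet>\<close> 70)
no_notation fps_nth (infixl \<open>$\<close> 75)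

section \<open>Exponential moments from the characteristic function near the origin\<close>

lemma entire_derivs:
  assumes "f holomorphic_on UNIV"
  shows "((deriv ^^ n) f has_field_derivative (deriv ^^ Suc n) f z) (at z)"
    and "(deriv ^^ n) f holomorphic_on UNIV"
proof -
  show "(deriv ^^ n) f holomorphic_on UNIV"
    using assms by (intro holomorphic_higher_deriv) auto
  then show "((deriv ^^ n) f has_field_derivative (deriv ^^ Suc n) f z) (at z)"
    using holomorphic_derivI[of "(deriv ^^ n) f" UNIV z UNIV] by simp
qed

text \<open>
  The second-order Taylor expansion at \<open>z + h\<close> and \<open>z - h\<close>: the odd terms cancel in the sum.
\<close>

lemma second_difference_tendsto:
  fixes f :: "complex \<Rightarrow> complex"
  assumes "f holomorphic_on UNIV"
  shows "((\<lambda>h. (f (z + h) + f (z - h) - 2 * f z) / h\<^sup>2) \<longlongrightarrow> (deriv ^^ 2) f z) (at 0)"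
proof -
  have "continuous_on (cball z 1) ((deriv ^^ 3) f)"
    using entire_derivs(2)[OF assms, of 3] holomorphic_on_imp_continuous_on continuous_on_subset by blast
  then have "bounded ((deriv ^^ 3) f ` cball z 1)"
    by (intro compact_imp_bounded compact_continuous_image) auto
  then obtain B where B: "\<And>x. x \<in> cball z 1 \<Longrightarrow> cmod ((deriv ^^ 3) f x) \<le> B"
    unfolding bounded_iff by blast
  have taylor: "cmod (f w - (f z + deriv f z * (w - z) + (deriv ^^ 2) f z * (w - z)\<^sup>2 / 2)) \<le> B * cmod (w - z) ^ 3 / 2"
    if "w \<in> cball z 1" for w
  proof -
    have "cmod ((deriv ^^ 0) f w - (\<Sum>i\<le>2. (deriv ^^ i) f z * (w - z) ^ i / fact i)) \<le> B * cmod (w - z) ^ Suc 2 / fact 2"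
      by (rule complex_Taylor[of "cball z 1" 2 "\<lambda>i. (deriv ^^ i) f"])
        (use that B in \<open>auto simp: numeral_3_eq_3 intro!: DERIV_subset[OF entire_derivs(1)[OF assms, simplified]]\<close>)
    then show ?thesis by (simp add: numeral_2_eq_2 numeral_3_eq_3)
  qed
  have "cmod ((f (z + h) + f (z - h) - 2 * f z) / h\<^sup>2 - (deriv ^^ 2) f z) \<le> B * cmod h"
    if h: "h \<noteq> 0" "cmod h \<le> 1" for h
  proof -
    have 1: "cmod (f (z + h) - (f z + deriv f z * h + (deriv ^^ 2) f z * h\<^sup>2 / 2)) \<le> B * cmod h ^ 3 / 2"
      using taylor[of "z + h"] h by (simp add: dist_norm)
    have 2: "cmod (f (z - h) - (f z - deriv f z * h + (deriv ^^ 2) f z * h\<^sup>2 / 2)) \<le> B * cmod h ^ 3 / 2"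
      using taylor[of "z - h"] h by (simp add: dist_norm)
    have "cmod (f (z + h) + f (z - h) - 2 * f z - (deriv ^^ 2) f z * h\<^sup>2) \<le> B * cmod h ^ 3"
      using norm_triangle_ineq[of "f (z + h) - (f z + deriv f z * h + (deriv ^^ 2) f z * h\<^sup>2 / 2)"
        "f (z - h) - (f z - deriv f z * h + (deriv ^^ 2) f z * h\<^sup>2 / 2)"] 1 2
      by (simp add: algebra_simps)
    moreover have "(f (z + h) + f (z - h) - 2 * f z) / h\<^sup>2 - (deriv ^^ 2) f z
        = (f (z + h) + f (z - h) - 2 * f z - (deriv ^^ 2) f z * h\<^sup>2) / h\<^sup>2"
      using h by (simp add: field_simps)
    ultimately have "cmod ((f (z + h) + f (z - h) - 2 * f z) / h\<^sup>2 - (deriv ^^ 2) f z) \<le> B * cmod h ^ 3 / (cmod h)\<^sup>2"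
      by (simp add: norm_divide norm_power divide_right_mono)
    also have "\<dots> = B * cmod h" using h by (simp add: power2_eq_square power3_eq_cube)
    finally show ?thesis .
  qed
  then have "eventually (\<lambda>h. cmod ((f (z + h) + f (z - h) - 2 * f z) / h\<^sup>2 - (deriv ^^ 2) f z) \<le> B * cmod h) (at 0)"
    by (auto simp: eventually_at intro!: exI[of _ 1])
  moreover have "((\<lambda>h. B * cmod h) \<longlongrightarrow> 0) (at 0)" by (auto intro!: tendsto_eq_intros)
  ultimately show ?thesis
    by (subst Lim_null) (rule Lim_null_comparison)
qed

lemma cos_lower_bound: "1 - x\<^sup>2 / 2 \<le> cos x" for x :: real
proof -
  have "cos x = 1 - 2 * (sin (x/2))\<^sup>2" using cos_double_sin[of "x/2"] by simp
  moreover have "\<bar>sin (x/2)\<bar>\<^sup>2 \<le> \<bar>x/2\<bar>\<^sup>2" by (intro power_mono abs_sin_x_le_abs_x) auto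
  ultimately show ?thesis by (simp add: power_divide)
qed

text \<open>
  If the Fourier transform of the finite measure \<open>w dM\<close> is twice differentiable near the origin, then
  \<open>w dM\<close> has a second moment. Second differences of the transform are integrals of
  \<open>2 (1 - cos (h x)) / h\<^sup>2\<close>, which tends to \<open>x\<^sup>2\<close> from below; Fatou's lemma gives finiteness, and dominated
  convergence then identifies the transform of \<open>x\<^sup>2 w dM\<close> as minus the second derivative. Since the result
  has the form of the hypothesis, the step can be iterated.
\<close>

lemma (in real_distribution) weighted_second_moment:
  assumes f: "f holomorphic_on UNIV" and "\<delta> > 0"
    and w [measurable]: "w \<in> borel_measurable M" and w0: "\<And>x. w x \<ge> 0" and iw: "integrable M w"
    and F: "\<And>t. \<bar>t\<bar> < \<delta> \<Longrightarrow> (CLINT x|M. w x * iexp (t * x)) = f (of_real t)"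
  shows "integrable M (\<lambda>x. x\<^sup>2 * w x)"
    and "\<And>t. \<bar>t\<bar> < \<delta> \<Longrightarrow> (CLINT x|M. (x\<^sup>2 * w x) * iexp (t * x)) = - (deriv ^^ 2) f (of_real t)"
proof -
  define h where "h = (\<lambda>n. inverse (real (Suc n)))"
  have h0: "h n > 0" for n by (simp add: h_def)
  have hlim: "h \<longlonglongrightarrow> 0" unfolding h_def by (rule LIMSEQ_inverse_real_of_nat)
  define K where "K = (\<lambda>n x. w x * (2 * (1 - cos (h n * x)) / (h n)\<^sup>2))"
  have [measurable]: "K n \<in> borel_measurable M" for n unfolding K_def by measurable
  have K0: "K n x \<ge> 0" for n x unfolding K_def using w0 by (intro mult_nonneg_nonneg divide_nonneg_nonneg) auto
  have Kle: "K n x \<le> x\<^sup>2 * w x" for n x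
  proof -
    have "2 * (1 - cos (h n * x)) \<le> (h n)\<^sup>2 * x\<^sup>2"
      using cos_lower_bound[of "h n * x"] by (simp add: power_mult_distrib)
    then have "2 * (1 - cos (h n * x)) / (h n)\<^sup>2 \<le> x\<^sup>2"
      using h0[of n] by (simp add: divide_le_eq mult.commute)
    then show ?thesis unfolding K_def using w0[of x] by (metis mult.commute mult_left_mono)
  qed
  have Klim: "(\<lambda>n. K n x) \<longlonglongrightarrow> x\<^sup>2 * w x" for x
  proof -
    have "((\<lambda>y. 2 * (1 - cos (y * x)) / y\<^sup>2) \<longlongrightarrow> x\<^sup>2) (at 0)" 
    proof -
      have s: "((\<lambda>y. cos (of_real x * y) :: complex) holomorphic_on UNIV)"
        by (intro holomorphic_intros)
      have d1: "deriv (\<lambda>y. cos (of_real x * y) :: complex) = (\<lambda>y. - of_real x * sin (of_real x * y))"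
        by (rule ext, rule DERIV_imp_deriv) (auto intro!: derivative_eq_intros)
      have d2: "deriv (\<lambda>y. - of_real x * sin (of_real x * y) :: complex) 0 = - (of_real x)\<^sup>2"
        by (rule DERIV_imp_deriv) (auto intro!: derivative_eq_intros simp: power2_eq_square)
      have d: "(deriv ^^ 2) (\<lambda>y. cos (of_real x * y) :: complex) 0 = - (of_real x)\<^sup>2"
        unfolding d2[symmetric] d1[symmetric] by (simp add: numeral_2_eq_2)
      have "((\<lambda>y. (cos (of_real x * (0 + y)) + cos (of_real x * (0 - y)) - 2 * cos (of_real x * 0)) / y\<^sup>2)
         \<longlongrightarrow> - (complex_of_real x)\<^sup>2) (at 0)"
        using second_difference_tendsto[OF s, of 0] unfolding d .
      then have *: "((\<lambda>y. (2 * cos (of_real x * y) - 2) / y\<^sup>2) \<longlongrightarrow> - (complex_of_real x)\<^sup>2) (at 0)"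
        by simp
      have "((\<lambda>y::real. (2 * cos (of_real x * of_real y) - 2) / (of_real y)\<^sup>2) \<longlongrightarrow> - (complex_of_real x)\<^sup>2) (at 0)"
        by (rule filterlim_compose[OF *]) (auto simp: filterlim_at eventually_at intro!: tendsto_eq_intros exI[of _ 1])
      then have "((\<lambda>y::real. complex_of_real ((2 * cos (x * y) - 2) / y\<^sup>2)) \<longlongrightarrow> complex_of_real (- x\<^sup>2)) (at 0)"
        unfolding of_real_mult[symmetric] cos_of_real by simp
      then have "((\<lambda>y::real. (2 * cos (x * y) - 2) / y\<^sup>2) \<longlongrightarrow> - x\<^sup>2) (at 0)"
        by (simp only: tendsto_of_real_iff)
      from tendsto_minus[OF this] show ?thesis
        by (simp add: minus_divide_left algebra_simps del: minus_divide_left[symmetric])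
    qed
    then have "(\<lambda>n. 2 * (1 - cos (h n * x)) / (h n)\<^sup>2) \<longlonglongrightarrow> x\<^sup>2"
      by (rule filterlim_compose) (use hlim h0 in \<open>auto simp: filterlim_at intro!: always_eventually less_imp_neq[THEN not_sym]\<close>)
    from tendsto_mult_left[OF this, of "w x"] show ?thesis by (simp add: K_def mult.commute)
  qed
  have iwe: "integrable M (\<lambda>x. w x * iexp (t * x))" for t
    by (rule Bochner_Integration.integrable_bound[OF iw]) (use w0 in \<open>auto simp: norm_mult\<close>)
  have KF: "(CLINT x|M. K n x * iexp (t * x)) =
      - ((f (of_real t + of_real (h n)) + f (of_real t - of_real (h n)) - 2 * f (of_real t)) / (of_real (h n))\<^sup>2)"
    if t: "\<bar>t + h n\<bar> < \<delta>" "\<bar>t - h n\<bar> < \<delta>" "\<bar>t\<bar> < \<delta>" for n t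
  proof -
    have "K n x * iexp (t * x) = - ((w x * iexp ((t + h n) * x) + w x * iexp ((t - h n) * x) - 2 * (w x * iexp (t * x))) / (of_real (h n))\<^sup>2)" for x
    proof -
      define c where "c = complex_of_real (cos (h n * x))"
      have e: "exp (\<i> * complex_of_real (h n * x)) + exp (- (\<i> * complex_of_real (h n * x))) = 2 * c"
        unfolding c_def cos_of_real[symmetric] by (simp add: cos_exp_eq)
      have "iexp ((t + h n) * x) + iexp ((t - h n) * x) = iexp (t * x) * (2 * c)"
        unfolding e[symmetric] by (simp add: algebra_simps exp_add exp_diff exp_minus divide_inverse)
      then have *: "w x * iexp ((t + h n) * x) + w x * iexp ((t - h n) * x) = w x * (iexp (t * x) * (2 * c))"
        by (metis distrib_left)
      have K: "complex_of_real (K n x) = w x * (2 * (1 - c) / (of_real (h n))\<^sup>2)"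
        by (simp add: K_def c_def)
      show ?thesis
        unfolding * K using h0[of n] by (simp add: field_simps del: of_real_mult)
    qed
    then have "(CLINT x|M. K n x * iexp (t * x)) = (CLINT x|M. - ((w x * iexp ((t + h n) * x) + w x * iexp ((t - h n) * x) - 2 * (w x * iexp (t * x))) / (of_real (h n))\<^sup>2))"
      by simp
    also have "\<dots> = - (((CLINT x|M. w x * iexp ((t + h n) * x)) + (CLINT x|M. w x * iexp ((t - h n) * x)) - 2 * (CLINT x|M. w x * iexp (t * x))) / (of_real (h n))\<^sup>2)"
      using iwe by (simp del: of_real_add of_real_diff of_real_mult)
    finally show ?thesis using F[OF t(1)] F[OF t(2)] F[OF t(3)] by simp
  qed
  have lim: "(\<lambda>n. CLINT x|M. K n x * iexp (t * x)) \<longlonglongrightarrow> - (deriv ^^ 2) f (of_real t)" if "\<bar>t\<bar> < \<delta>" for t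
  proof -
    have "(\<lambda>n. - ((f (of_real t + of_real (h n)) + f (of_real t - of_real (h n)) - 2 * f (of_real t)) / (of_real (h n))\<^sup>2)) \<longlonglongrightarrow> - (deriv ^^ 2) f (of_real t)"
      by (intro tendsto_minus filterlim_compose[OF second_difference_tendsto[OF f]])
        (use tendsto_of_real[OF hlim] h0 in \<open>auto simp: filterlim_at intro!: always_eventually less_imp_neq[THEN not_sym]\<close>)
    moreover have "eventually (\<lambda>n. \<bar>t + h n\<bar> < \<delta> \<and> \<bar>t - h n\<bar> < \<delta>) sequentially"
      using order_tendstoD(2)[OF hlim, of "\<delta> - \<bar>t\<bar>"] that h0 by (auto elim!: eventually_mono) (smt (verit))+
    ultimately show ?thesis using that
      by (rule_tac Lim_transform_eventually) (auto elim!: eventually_mono simp: KF simp del: of_real_mult)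
  qed
  have bnd: "integrable M (\<lambda>x. K n x)" for n
  proof (rule Bochner_Integration.integrable_bound[of M "\<lambda>x. w x * (4 / (h n)\<^sup>2)"])
    show "AE x in M. norm (K n x) \<le> norm (w x * (4 / (h n)\<^sup>2))"
    proof (rule AE_I2)
      fix x :: real
      have "1 - cos (h n * x) \<le> 2" using cos_ge_minus_one[of "h n * x"] by linarith
      then have "2 * (1 - cos (h n * x)) \<le> 4" by argo
      then have "2 * (1 - cos (h n * x)) / (h n)\<^sup>2 \<le> 4 / (h n)\<^sup>2" by (rule divide_right_mono) simp
      then have "K n x \<le> w x * (4 / (h n)\<^sup>2)" unfolding K_def by (intro mult_left_mono w0)
      then show "norm (K n x) \<le> norm (w x * (4 / (h n)\<^sup>2))"
        using K0[of n x] w0[of x] by simp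
    qed
  qed (use iw in auto)
  show int: "integrable M (\<lambda>x. x\<^sup>2 * w x)"
  proof (rule integrableI_nonneg)
    have "(\<lambda>n. cmod (CLINT x|M. K n x * iexp (0 * x))) \<longlonglongrightarrow> cmod (- (deriv ^^ 2) f (of_real 0))"
      by (intro tendsto_norm lim) (use \<open>\<delta> > 0\<close> in simp)
    then have "(\<lambda>n. cmod (CLINT x|M. K n x)) \<longlonglongrightarrow> cmod ((deriv ^^ 2) f 0)" by simp
    then have "(\<lambda>n. LINT x|M. K n x) \<longlonglongrightarrow> cmod ((deriv ^^ 2) f 0)"
      using K0 by (simp add: integral_complex_of_real)
    then have *: "(\<lambda>n. ennreal (LINT x|M. K n x)) \<longlonglongrightarrow> ennreal (cmod ((deriv ^^ 2) f 0))"
      by (rule tendsto_ennrealI)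
    have "(\<integral>\<^sup>+x. ennreal (x\<^sup>2 * w x) \<partial>M) = (\<integral>\<^sup>+x. liminf (\<lambda>n. ennreal (K n x)) \<partial>M)"
      by (intro nn_integral_cong lim_imp_Liminf[symmetric] tendsto_ennrealI Klim) auto
    also have "\<dots> \<le> liminf (\<lambda>n. \<integral>\<^sup>+x. ennreal (K n x) \<partial>M)" by (rule nn_integral_liminf) auto
    also have "(\<lambda>n. \<integral>\<^sup>+x. ennreal (K n x) \<partial>M) = (\<lambda>n. ennreal (LINT x|M. K n x))"
      using bnd K0 by (intro ext nn_integral_eq_integral) auto
    also have "liminf \<dots> = ennreal (cmod ((deriv ^^ 2) f 0))" by (rule lim_imp_Liminf[OF _ *]) simp
    finally show "(\<integral>\<^sup>+x. ennreal (x\<^sup>2 * w x) \<partial>M) < \<infinity>"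
      by (simp add: order_le_less_trans)
  qed (use w0 in auto)
  fix t :: real assume t: "\<bar>t\<bar> < \<delta>"
  have "(\<lambda>n. CLINT x|M. K n x * iexp (t * x)) \<longlonglongrightarrow> (CLINT x|M. (x\<^sup>2 * w x) * iexp (t * x))"
  proof (rule integral_dominated_convergence[where w="\<lambda>x. x\<^sup>2 * w x"])
    show "AE x in M. (\<lambda>n. K n x * iexp (t * x)) \<longlonglongrightarrow> (x\<^sup>2 * w x) * iexp (t * x)"
      using Klim by (intro AE_I2 tendsto_mult_right tendsto_of_real)
    show "\<And>n. AE x in M. cmod (K n x * iexp (t * x)) \<le> x\<^sup>2 * w x"
      using Kle K0 by (auto simp: norm_mult)
  qed (use int in auto)
  from LIMSEQ_unique[OF this lim[OF t]]
  show "(CLINT x|M. (x\<^sup>2 * w x) * iexp (t * x)) = - (deriv ^^ 2) f (of_real t)" .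
qed

lemma (in real_distribution) even_moments:
  assumes f: "f holomorphic_on UNIV" and "\<delta> > 0"
    and F: "\<And>t. \<bar>t\<bar> < \<delta> \<Longrightarrow> char M t = f (of_real t)"
  shows "integrable M (\<lambda>x. x ^ (2 * n)) \<and>
    (\<forall>t. \<bar>t\<bar> < \<delta> \<longrightarrow> (CLINT x|M. x ^ (2 * n) * iexp (t * x)) = (-1) ^ n * (deriv ^^ (2 * n)) f (of_real t))"
proof (induction n)
  case 0
  then show ?case using F by (simp add: char_def)
next
  case (Suc n)
  let ?g = "\<lambda>z. (-1) ^ n * (deriv ^^ (2 * n)) f z"
  have hol: "?g holomorphic_on UNIV"
    by (intro holomorphic_intros entire_derivs(2)[OF f])
  have *: "deriv (\<lambda>z. c * (deriv ^^ k) f z) = (\<lambda>z. c * (deriv ^^ Suc k) f z)" for c k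
    by (rule ext, rule DERIV_imp_deriv) (intro DERIV_cmult entire_derivs(1)[OF f])
  have "(deriv ^^ 2) ?g = (\<lambda>z. (-1) ^ n * (deriv ^^ Suc (Suc (2 * n))) f z)"
  proof -
    have "(deriv ^^ 2) ?g = deriv (deriv ?g)" by (simp add: numeral_2_eq_2)
    then show ?thesis unfolding * .
  qed
  moreover have "(CLINT x|M. complex_of_real (x ^ (2 * n)) * iexp (t * x)) = ?g (of_real t)" if "\<bar>t\<bar> < \<delta>" for t
    using Suc.IH that by simp
  ultimately have "integrable M (\<lambda>x. x\<^sup>2 * x ^ (2 * n))"
      "\<And>t. \<bar>t\<bar> < \<delta> \<Longrightarrow> (CLINT x|M. complex_of_real (x\<^sup>2 * x ^ (2 * n)) * iexp (t * x)) =
         - ((-1) ^ n * (deriv ^^ Suc (Suc (2 * n))) f (of_real t))"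
    using weighted_second_moment[of ?g \<delta> "\<lambda>x. x ^ (2 * n)"] hol \<open>\<delta> > 0\<close> Suc.IH
    by (auto simp del: of_real_mult of_real_power funpow.simps)
  moreover have "Suc (Suc (2 * n)) = 2 * Suc n" by simp
  moreover have "x\<^sup>2 * x ^ (2 * n) = x ^ (2 * Suc n)" for x :: real
    by (simp add: power2_eq_square)
  ultimately show ?case by (simp del: of_real_mult of_real_power funpow.simps mult_Suc_right)
qed

text \<open>
  Cauchy's inequality on a circle of radius \<open>r\<close> bounds the moment of order \<open>2n\<close> by a multiple of
  \<open>(2n)! / r\<^sup>2\<^sup>n\<close>. As \<open>r\<close> is arbitrary, the power series of \<open>cosh (s x)\<close> can be integrated term by term
  for every \<open>s\<close>.
\<close>

lemma (in real_distribution) exp_moments: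
  assumes f: "f holomorphic_on UNIV" and "\<delta> > 0"
    and F: "\<And>t. \<bar>t\<bar> < \<delta> \<Longrightarrow> char M t = f (of_real t)"
  shows "integrable M (\<lambda>x. exp (s * \<bar>x\<bar>))"
proof -
  \<comment> \<open>any radius exceeding \<open>\<bar>s\<bar>\<close> makes the majorant a convergent geometric series\<close>
  define r where "r = \<bar>s\<bar> + 1"
  have "r > 0" by (simp add: r_def)
  have "continuous_on (cball 0 r) f"
    using f holomorphic_on_imp_continuous_on continuous_on_subset by blast
  then have "bounded (f ` cball 0 r)"
    by (intro compact_imp_bounded compact_continuous_image) auto
  then obtain C where C: "\<And>x. x \<in> cball 0 r \<Longrightarrow> cmod (f x) \<le> C"
    unfolding bounded_iff by blast
  have int: "integrable M (\<lambda>x. x ^ (2 * n))" for n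
    using even_moments[OF f \<open>\<delta> > 0\<close> F] by blast
  have mom: "(LINT x|M. x ^ (2 * n)) \<le> fact (2 * n) * C / r ^ (2 * n)" for n
  proof -
    have "complex_of_real (LINT x|M. x ^ (2 * n)) = (-1) ^ n * (deriv ^^ (2 * n)) f 0"
      using even_moments[OF f \<open>\<delta> > 0\<close> F, of n] \<open>\<delta> > 0\<close>
      by (auto dest!: conjunct2 spec[of _ 0] simp del: of_real_power simp: integral_complex_of_real)
    then have "cmod (complex_of_real (LINT x|M. x ^ (2 * n))) = cmod ((deriv ^^ (2 * n)) f 0)"
      by (simp add: norm_mult norm_power)
    also have "\<dots> \<le> fact (2 * n) * C / r ^ (2 * n)"
      using C f \<open>r > 0\<close>
      by (intro Cauchy_inequality holomorphic_on_subset[OF f] \<open>continuous_on (cball 0 r) f\<close>) (auto simp: dist_norm)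
    finally show ?thesis by (simp add: norm_of_real) 
  qed
  define q where "q = (s / r)\<^sup>2"
  have q: "0 \<le> q" "q < 1"
    using \<open>r > 0\<close> unfolding q_def abs_square_less_1 by (auto simp: r_def)
  have ci: "integrable M (\<lambda>x. cosh (s * x))"
  proof (rule integrableI_nonneg)
    have sums: "(\<lambda>n. (s * x) ^ (2 * n) / fact (2 * n)) sums cosh (s * x)" for x :: real
    proof -
      have "(\<lambda>n. if even (2 * n) then (s * x) ^ (2 * n) /\<^sub>R fact (2 * n) else 0) sums cosh (s * x)"
        using cosh_converges[of "s * x"]
        by (subst sums_mono_reindex[of "\<lambda>n. 2 * n"]) (auto simp: strict_mono_def image_iff elim!: evenE)
      then show ?thesis by (simp add: divide_inverse mult.commute)
    qed
    have "(\<integral>\<^sup>+x. ennreal (cosh (s * x)) \<partial>M) = (\<integral>\<^sup>+x. (\<Sum>n. ennreal ((s * x) ^ (2 * n) / fact (2 * n))) \<partial>M)"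
      using sums by (intro nn_integral_cong suminf_ennreal_eq[symmetric]) auto
    also have "\<dots> = (\<Sum>n. \<integral>\<^sup>+x. ennreal ((s * x) ^ (2 * n) / fact (2 * n)) \<partial>M)"
      by (intro nn_integral_suminf) auto
    also have "\<dots> = (\<Sum>n. ennreal (LINT x|M. (s * x) ^ (2 * n) / fact (2 * n)))"
    proof (intro arg_cong[of _ _ suminf] ext nn_integral_eq_integral)
      show "integrable M (\<lambda>x. (s * x) ^ (2 * n) / fact (2 * n))" for n
        using int[of n] by (simp add: power_mult_distrib)
    qed auto
    finally have expansion: "(\<integral>\<^sup>+x. ennreal (cosh (s * x)) \<partial>M) =
        (\<Sum>n. ennreal (LINT x|M. (s * x) ^ (2 * n) / fact (2 * n)))" .
    have majorant: "(\<Sum>n. ennreal (LINT x|M. (s * x) ^ (2 * n) / fact (2 * n))) \<le> (\<Sum>n. ennreal (C * q ^ n))"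
    proof (rule suminf_le)
      fix n
      have "(LINT x|M. (s * x) ^ (2 * n) / fact (2 * n)) = (LINT x|M. s ^ (2 * n) / fact (2 * n) * x ^ (2 * n))"
        by (simp only: power_mult_distrib times_divide_eq_left)
      also have "\<dots> = s ^ (2 * n) / fact (2 * n) * (LINT x|M. x ^ (2 * n))"
        by (rule integral_mult_right_zero)
      also have "\<dots> \<le> s ^ (2 * n) / fact (2 * n) * (fact (2 * n) * C / r ^ (2 * n))"
        by (intro mult_left_mono mom) auto
      also have "\<dots> = C * q ^ n"
        by (simp add: q_def power_mult power_divide)
      finally show "ennreal (LINT x|M. (s * x) ^ (2 * n) / fact (2 * n)) \<le> ennreal (C * q ^ n)"
        by (rule ennreal_leI)
    qed (rule summableI)+
    have "(\<Sum>n. ennreal (C * q ^ n)) < \<infinity>"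
    proof -
      have "0 \<le> C" using order_trans[OF norm_ge_zero C[of 0]] \<open>r > 0\<close> by simp
      then have "(\<Sum>n. ennreal (C * q ^ n)) = ennreal (\<Sum>n. C * q ^ n)"
        using q by (intro suminf_ennreal2 summable_mult summable_geometric) auto
      then show ?thesis by simp
    qed
    then show "(\<integral>\<^sup>+x. ennreal (cosh (s * x)) \<partial>M) < \<infinity>"
      unfolding expansion by (rule le_less_trans[OF majorant])
  qed (auto simp: cosh_def)
  show ?thesis
  proof (rule Bochner_Integration.integrable_bound)
    show "integrable M (\<lambda>x. 2 * cosh (s * x))" using ci by simp
    show "AE x in M. norm (exp (s * \<bar>x\<bar>)) \<le> norm (2 * cosh (s * x))"
    proof (rule AE_I2)
      fix x :: real
      have "exp (s * \<bar>x\<bar>) \<le> exp (s * x) + exp (- (s * x))" by (cases "x < 0") auto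
      also have "\<dots> = 2 * cosh (s * x)" by (simp add: cosh_def)
      finally show "norm (exp (s * \<bar>x\<bar>)) \<le> norm (2 * cosh (s * x))" by simp
    qed
  qed auto
qed

text \<open>
  The series of \<open>exp (z x)\<close> may be integrated term by term, because its absolute values sum to
  \<open>exp (\<bar>z\<bar> \<bar>x\<bar>)\<close>. So the transform is a power series converging in the whole plane.
\<close>

lemma (in real_distribution) entire_laplace:
  assumes "\<And>s. integrable M (\<lambda>x. exp (s * \<bar>x\<bar>))"
  shows "(\<lambda>z. CLINT x|M. exp (z * of_real x)) holomorphic_on UNIV"
proof -
  have bound: "\<bar>x ^ n\<bar> \<le> fact n * exp (1 * \<bar>x\<bar>)" for x :: real and n
  proof -
    have "(\<lambda>k. \<bar>x\<bar> ^ k /\<^sub>R fact k) sums exp \<bar>x\<bar>" by (rule exp_converges)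
    from sum_le_suminf[OF sums_summable[OF this], of "{n}"] sums_unique[OF this]
    have "\<bar>x\<bar> ^ n / fact n \<le> exp \<bar>x\<bar>" by (simp add: divide_inverse mult.commute)
    then show ?thesis by (simp add: power_abs divide_le_eq mult.commute)
  qed
  have int: "integrable M (\<lambda>x. x ^ n)" for n
    by (rule Bochner_Integration.integrable_bound[OF integrable_mult_right[OF assms[of 1], of "fact n"]])
      (use bound in auto)
  have sums: "(\<lambda>n. (CLINT x|M. of_real x ^ n / fact n) * (z - 0) ^ n) sums (CLINT x|M. exp (z * of_real x))" for z
  proof -
    let ?f = "\<lambda>n x. (z * complex_of_real x) ^ n / fact n"
    have i: "integrable M (?f n)" for n
      using int[of n, THEN integrable_of_real, where 'a=complex] by (simp add: power_mult_distrib)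
    have nrm: "norm (?f n x) = (cmod z * \<bar>x\<bar>) ^ n /\<^sub>R fact n" for n x
      by (simp add: norm_divide norm_power norm_mult norm_inverse divide_inverse mult.commute)
    have S: "(\<lambda>n. norm (?f n x)) sums exp (cmod z * \<bar>x\<bar>)" for x
      unfolding nrm by (rule exp_converges)
    have e: "(\<Sum>n. ?f n x) = exp (z * of_real x)" for x
      using exp_converges[of "z * of_real x", THEN sums_unique]
      by (simp add: scaleR_conv_of_real divide_inverse mult.commute)
    have sm: "summable (\<lambda>n. LINT x|M. norm (?f n x))"
    proof (rule bounded_imp_summable)
      fix n
      have "(\<Sum>k\<le>n. LINT x|M. norm (?f k x)) = (LINT x|M. (\<Sum>k\<le>n. norm (?f k x)))"
        using i by (subst Bochner_Integration.integral_sum) auto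
      also have "\<dots> \<le> (LINT x|M. exp (cmod z * \<bar>x\<bar>))"
      proof (intro integral_mono Bochner_Integration.integrable_sum integrable_norm i assms)
        fix x
        show "(\<Sum>k\<le>n. norm (?f k x)) \<le> exp (cmod z * \<bar>x\<bar>)"
          unfolding sums_unique[OF S[of x]]
          by (rule sum_le_suminf) (use sums_summable[OF S[of x]] in auto)
      qed
      finally show "(\<Sum>k\<le>n. LINT x|M. norm (?f k x)) \<le> (LINT x|M. exp (cmod z * \<bar>x\<bar>))" .
    qed simp
    have ae: "AE x in M. summable (\<lambda>n. norm (?f n x))"
      using sums_summable[OF S] by (intro AE_I2)
    have "(CLINT x|M. of_real x ^ n / fact n) * (z - 0) ^ n = (CLINT x|M. ?f n x)" for n
    proof -
      have "(CLINT x|M. of_real x ^ n / fact n) * (z - 0) ^ n = (CLINT x|M. of_real x ^ n / fact n * (z - 0) ^ n)"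
        by (rule integral_mult_left_zero[symmetric])
      then show ?thesis by (simp add: power_mult_distrib mult.commute)
    qed
    then show ?thesis using sums_integral[OF i ae sm] unfolding e by simp
  qed
  have "(\<lambda>z. CLINT x|M. exp (z * of_real x)) holomorphic_on ball 0 r" for r
    by (rule power_series_holomorphic) (rule sums)
  then have "(\<lambda>z. CLINT x|M. exp (z * of_real x)) holomorphic_on (\<Union>r\<in>UNIV. ball 0 r)"
    by (rule holomorphic_on_UN_open) auto
  moreover have "z \<in> (\<Union>r\<in>UNIV. ball 0 r)" for z :: complex
    by (rule UN_I[of "norm z + 1"]) auto
  ultimately show ?thesis by (metis UNIV_eq_I)
qed

section \<open>The theorem of Marcinkiewicz\<close>

lemma poly_leading_asymptotics:
  fixes R :: "complex poly"
  shows "((\<lambda>r::real. poly R (of_real r * w) / of_real r ^ degree R) \<longlongrightarrow> lead_coeff R * w ^ degree R) at_top"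
proof -
  let ?d = "degree R"
  have summand: "((\<lambda>r::real. coeff R i * w ^ i * inverse (of_real (r ^ (?d - i)))) \<longlongrightarrow> (if i = ?d then lead_coeff R * w ^ ?d else 0)) at_top"
    if "i \<le> ?d" for i
  proof (cases "i = ?d")
    case False
    then have "?d - i > 0" using that by simp
    then have "filterlim (\<lambda>r::real. r ^ (?d - i)) at_top at_top" by (intro filterlim_pow_at_top filterlim_ident)
    then have "((\<lambda>r::real. inverse (r ^ (?d - i))) \<longlongrightarrow> 0) at_top" by (rule tendsto_inverse_0_at_top)
    from tendsto_of_real[OF this, where 'a=complex] have "((\<lambda>r::real. inverse (complex_of_real (r ^ (?d - i)))) \<longlongrightarrow> 0) at_top"
      by simp
    from tendsto_mult_left[OF this, of "coeff R i * w ^ i"] False show ?thesis by simp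
  qed simp
  have "((\<lambda>r::real. \<Sum>i\<le>?d. coeff R i * w ^ i * inverse (of_real (r ^ (?d - i)))) \<longlongrightarrow>
      (\<Sum>i\<le>?d. if i = ?d then lead_coeff R * w ^ ?d else 0)) at_top"
    by (intro tendsto_sum summand) auto
  moreover have "eventually (\<lambda>r::real. (\<Sum>i\<le>?d. coeff R i * w ^ i * inverse (of_real (r ^ (?d - i)))) = poly R (of_real r * w) / of_real r ^ ?d) at_top"
    using eventually_gt_at_top[of 0]
  proof eventually_elim
    case (elim r)
    show ?case unfolding poly_altdef sum_divide_distrib
    proof (rule sum.cong)
      fix i assume "i \<in> {..?d}"
      then have "complex_of_real r ^ ?d = of_real r ^ i * of_real r ^ (?d - i)" by (simp flip: power_add)
      then show "coeff R i * w ^ i * inverse (of_real (r ^ (?d - i))) = coeff R i * (of_real r * w) ^ i / of_real r ^ ?d"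
        using elim by (simp add: power_mult_distrib field_simps)
    qed simp
  qed
  ultimately show ?thesis by (rule_tac Lim_transform_eventually) auto
qed

text \<open>
  Compare the leading terms of both sides along the ray through a point \<open>w\<close> of the unit circle: with
  leading coefficient \<open>a\<close> and degree \<open>d\<close> the inequality becomes \<open>Re (a w\<^sup>d) \<le> Re (a (Re w)\<^sup>d)\<close>. For each of
  the \<open>d\<close> solutions of \<open>a w\<^sup>d = \<bar>a\<bar>\<close> it forces \<open>\<bar>Re w\<bar> = 1\<close>, so that \<open>w\<close> is \<open>1\<close> or \<open>-1\<close>, which leaves room for
  at most two solutions.
\<close>

lemma degree_le_2_if_Re_max_on_real_axis:
  fixes R :: "complex poly"
  assumes ineq: "\<And>s \<tau>. Re (poly R (Complex s \<tau>)) \<le> Re (poly R (of_real s))"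
  shows "degree R \<le> 2"
proof (rule ccontr)
  let ?d = "degree R"
  assume "\<not> ?thesis"
  then have d: "?d > 2" by simp
  define a where "a = lead_coeff R"
  have a: "a \<noteq> 0" using d by (auto simp: a_def)
  have "w \<in> {1, -1}" if w: "w ^ ?d = of_real (cmod a) / a" for w
  proof -
    have "cmod w ^ ?d = 1" using a arg_cong[OF w, of cmod] by (simp add: norm_power norm_divide)
    then have nw: "cmod w = 1" using d power_eq_iff_eq_base[of ?d "cmod w" 1] by simp
    have L: "((\<lambda>r::real. Re (poly R (of_real r * z) / of_real r ^ ?d)) \<longlongrightarrow> Re (a * z ^ ?d)) at_top" for z
      unfolding a_def by (intro tendsto_Re poly_leading_asymptotics)
    have "Re (a * w ^ ?d) \<le> Re (a * of_real (Re w) ^ ?d)"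
    proof (rule tendsto_le[OF _ L L])
      show "eventually (\<lambda>r::real. Re (poly R (of_real r * w) / of_real r ^ ?d) \<le> Re (poly R (of_real r * of_real (Re w)) / of_real r ^ ?d)) at_top"
        using eventually_gt_at_top[of 0]
      proof eventually_elim
        case (elim r)
        have "of_real r * w = Complex (r * Re w) (r * Im w)" by (simp add: complex_eq_iff)
        then have "Re (poly R (of_real r * w)) \<le> Re (poly R (of_real r * of_real (Re w)))"
          using ineq[of "r * Re w" "r * Im w"] by simp
        then show ?case using elim by (simp add: divide_right_mono flip: of_real_power)
      qed
    qed simp
    also have "\<dots> \<le> cmod a * \<bar>Re w\<bar> ^ ?d"
      using complex_Re_le_cmod[of "a * of_real (Re w) ^ ?d"] by (simp add: norm_mult norm_power)
    also have "Re (a * w ^ ?d) = cmod a" using a w by simp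
    finally have "1 \<le> \<bar>Re w\<bar> ^ ?d" using a by simp
    moreover have "\<bar>Re w\<bar> ^ ?d < 1 ^ ?d" if "\<bar>Re w\<bar> < 1" using that d by (intro power_strict_mono) auto
    ultimately have "\<bar>Re w\<bar> \<ge> 1" by (metis linorder_not_le power_one)
    then have "(Re w)\<^sup>2 \<ge> 1" by (simp add: abs_le_square_iff[of 1, simplified])
    moreover have "(Re w)\<^sup>2 + (Im w)\<^sup>2 = 1" using nw by (simp add: cmod_def)
    ultimately have "(Im w)\<^sup>2 \<le> 0" by smt
    then have "Im w = 0" by simp
    with \<open>(Re w)\<^sup>2 + (Im w)\<^sup>2 = 1\<close> have "Re w = 1 \<or> Re w = -1" by (simp add: power2_eq_1_iff)
    then show ?thesis using \<open>Im w = 0\<close> by (auto simp: complex_eq_iff)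
  qed
  then have "card {w. w ^ ?d = of_real (cmod a) / a} \<le> card {1, -1 :: complex}"
    by (intro card_mono) auto
  also have "\<dots> \<le> 2" by (simp add: card_insert_if)
  also have "card {w. w ^ ?d = of_real (cmod a) / a} = ?d"
    using a d by (intro card_nth_roots) auto
  finally show False using d by simp
qed

lemma (in real_distribution) char_minus: "char M (- t) = cnj (char M t)"
proof -
  have "cnj (char M t) = (CLINT x|M. cnj (iexp (t * x)))" unfolding char_def by simp
  also have "(\<lambda>x. cnj (iexp (t * x))) = (\<lambda>x. iexp (- t * x))" by (auto simp: exp_cnj)
  finally show ?thesis by (simp add: char_def)
qed

text \<open>
  The symmetry \<open>\<phi>(-t) = cnj (\<phi>(t))\<close> makes the linear coefficient imaginary and the quadratic one real, and
  \<open>\<bar>\<phi>\<bar> \<le> 1\<close> makes the latter nonpositive.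
\<close>

lemma (in real_distribution) quadratic_char_imp_gaussian:
  assumes "\<And>t. char M t = exp (a + b * of_real t + c * (of_real t)\<^sup>2)"
  shows "\<exists>m s. s \<ge> 0 \<and> (\<forall>t. char M t = exp (\<i> * of_real (t * m) - of_real (s * t\<^sup>2) / 2))"
proof -
  have "exp a = 1" using assms[of 0] char_zero by simp
  then have ch: "char M t = exp (b * of_real t + c * (of_real t)\<^sup>2)" for t
    using assms[of t] by (simp add: exp_add)
  have le: "Re b * t + Re c * t\<^sup>2 \<le> 0" for t
    using cmod_char_le_1[of t] unfolding ch by (simp add: power2_eq_square)
  have cn: "exp (- b * of_real t + c * (of_real t)\<^sup>2) = exp (cnj b * of_real t + cnj c * (of_real t)\<^sup>2)" for t
    using char_minus[of t] unfolding ch by (simp add: exp_cnj)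
  have "Re b = 0"
    using arg_cong[OF cn[of 1], of cmod] by simp
  have "Im c = 0"
  proof (rule ccontr)
    assume nz: "Im c \<noteq> 0"
    \<comment> \<open>here \<open>2 Im c t\<^sup>2\<close> is \<open>2\<close> or \<open>-2\<close>, which is not a multiple of \<open>2 pi\<close>\<close>
    define t where "t = sqrt (1 / \<bar>Im c\<bar>)"
    have t2: "t\<^sup>2 = 1 / \<bar>Im c\<bar>" unfolding t_def by simp
    have "- b * of_real t + c * (of_real t)\<^sup>2 - (cnj b * of_real t + cnj c * (of_real t)\<^sup>2) = \<i> * of_real (2 * Im c * t\<^sup>2)"
      using \<open>Re b = 0\<close> by (simp add: complex_eq_iff power2_eq_square)
    then have "exp (\<i> * of_real (2 * Im c * t\<^sup>2)) = 1"
      using cn[of t] by (metis exp_diff divide_self exp_not_eq_zero)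
    then have "cos (2 * Im c * t\<^sup>2) = 1"
      by (metis cis_conv_exp cis.sel(1) one_complex.sel(1))
    then have "cos (2::real) = 1" using nz unfolding t2 by (cases "Im c > 0") auto
    then show False using cos_two_less_zero by simp
  qed
  have "Re c \<le> 0" using le[of 1] \<open>Re b = 0\<close> by simp
  have "b * of_real t + c * (of_real t)\<^sup>2 = \<i> * of_real (t * Im b) - of_real (- 2 * Re c * t\<^sup>2) / 2" for t
    using \<open>Re b = 0\<close> \<open>Im c = 0\<close> by (simp add: complex_eq_iff power2_eq_square)
  then show ?thesis using \<open>Re c \<le> 0\<close> ch by (intro exI[of _ "Im b"] exI[of _ "- 2 * Re c"]) simp
qed

text \<open>
  The theorem of Marcinkiewicz, in the local form needed here: only a neighbourhood of the origin is
  controlled. The exponential moments make the Laplace transform \<open>L\<close> entire; it agrees with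
  \<open>exp (P (-\<i> z))\<close> on a segment of the imaginary axis, hence everywhere. As \<open>L\<close> is the transform of a
  positive measure, \<open>\<bar>L(s + \<i> \<tau>)\<bar> \<le> L(s)\<close>, and this bounds the degree by two.
\<close>

lemma (in real_distribution) marcinkiewicz:
  assumes "eventually (\<lambda>t. char M t = exp (poly P (of_real t))) (nhds 0)"
  shows "\<exists>m s. s \<ge> 0 \<and> (\<forall>t. char M t = exp (\<i> * of_real (t * m) - of_real (s * t\<^sup>2) / 2))"
proof -
  obtain \<delta> where \<delta>: "\<delta> > 0" "\<And>t. \<bar>t\<bar> < \<delta> \<Longrightarrow> char M t = exp (poly P (of_real t))"
    using assms unfolding eventually_nhds_metric by (auto simp: dist_norm)
  have hol: "(\<lambda>z. exp (poly P z)) holomorphic_on UNIV" by (intro holomorphic_intros)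
  have em: "integrable M (\<lambda>x. exp (s * \<bar>x\<bar>))" for s
    using exp_moments[OF hol \<delta>(1)] \<delta>(2) by simp
  define L where "L = (\<lambda>z. CLINT x|M. exp (z * of_real x))"
  have L: "L holomorphic_on UNIV" unfolding L_def by (rule entire_laplace[OF em])
  \<comment> \<open>the rotation \<open>z = \<i> t\<close> turns the characteristic function into the Laplace transform\<close>
  define Q where "Q = pcompose P [:0, -\<i>:]"
  have PQ: "poly Q z = poly P (- \<i> * z)" for z by (simp add: Q_def poly_pcompose mult.commute)
  have LQ: "L z = exp (poly Q z)" for z
  proof -
    have "L z - exp (poly Q z) = 0"
    proof (rule analytic_continuation[of "\<lambda>z. L z - exp (poly Q z)" UNIV "(\<lambda>t. \<i> * of_real t) ` {-\<delta><..<\<delta>}" 0])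
      show "(\<lambda>z. L z - exp (poly Q z)) holomorphic_on UNIV" by (intro holomorphic_intros L)
      show "0 islimpt (\<lambda>t. \<i> * complex_of_real t) ` {-\<delta><..<\<delta>}"
        unfolding islimpt_approachable
      proof (intro allI impI)
        fix e :: real assume "e > 0"
        then show "\<exists>x'\<in>(\<lambda>t. \<i> * complex_of_real t) ` {-\<delta><..<\<delta>}. x' \<noteq> 0 \<and> dist x' 0 < e"
          using \<delta>(1) by (intro bexI[OF _ imageI[of "min \<delta> e / 2"]]) (auto simp: dist_norm norm_mult)
      qed
      fix z assume "z \<in> (\<lambda>t. \<i> * complex_of_real t) ` {-\<delta><..<\<delta>}"
      then obtain t where z: "z = \<i> * of_real t" "\<bar>t\<bar> < \<delta>" by auto
      then show "L z - exp (poly Q z) = 0" using \<delta>(2)[of t] by (simp add: PQ L_def char_def mult.assoc)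
    qed auto
    then show ?thesis by simp
  qed
  have "Re (poly Q (Complex s \<tau>)) \<le> Re (poly Q (of_real s))" for s \<tau>
  proof -
    have "cmod (L (Complex s \<tau>)) \<le> (LINT x|M. cmod (exp (Complex s \<tau> * of_real x)))"
      unfolding L_def by (rule integral_norm_bound)
    also have "\<dots> = (LINT x|M. exp (s * x))" by simp
    also have "\<dots> = Re (CLINT x|M. of_real (exp (s * x)))"
      by (simp only: integral_complex_of_real Re_complex_of_real)
    also have "\<dots> = Re (L (of_real s))" unfolding L_def exp_of_real[symmetric] of_real_mult ..
    also have "\<dots> \<le> cmod (L (of_real s))" by (rule complex_Re_le_cmod)
    finally show ?thesis by (simp add: LQ)
  qed
  then have "degree Q \<le> 2" by (rule degree_le_2_if_Re_max_on_real_axis)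
  then have Q: "poly Q z = coeff Q 0 + coeff Q 1 * z + coeff Q 2 * z\<^sup>2" for z
  proof -
    have "poly Q z = (\<Sum>i\<le>2. coeff Q i * z ^ i)"
      unfolding poly_altdef using \<open>degree Q \<le> 2\<close>
      by (intro sum.mono_neutral_left) (auto simp: coeff_eq_0)
    then show ?thesis by (simp add: numeral_2_eq_2)
  qed
  have "char M t = exp (coeff Q 0 + (coeff Q 1 * \<i>) * of_real t + (- coeff Q 2) * (of_real t)\<^sup>2)" for t
  proof -
    have "char M t = L (\<i> * of_real t)" by (simp add: char_def L_def mult.assoc)
    then show ?thesis unfolding LQ Q by (simp add: power_mult_distrib mult.assoc)
  qed
  then show ?thesis by (rule quadratic_char_imp_gaussian)
qed

section \<open>Frechet's characterization of polynomials\<close>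

primrec iterated_difference :: "real \<Rightarrow> nat \<Rightarrow> (real \<Rightarrow> complex) \<Rightarrow> real \<Rightarrow> complex" where
  "iterated_difference h 0 f x = f x"
| "iterated_difference h (Suc n) f x = iterated_difference h n f (x + h) - iterated_difference h n f x"

text \<open>
  Newton's forward difference formula.
\<close>

lemma newton_forward:
  "f (x + of_nat n * h) = (\<Sum>k\<le>n. of_nat (n choose k) * iterated_difference h k f x)"
proof (induction n arbitrary: x)
  case (Suc n)
  have "f (x + of_nat (Suc n) * h) = f ((x + h) + of_nat n * h)" by (simp add: algebra_simps)
  also have "\<dots> = (\<Sum>k\<le>n. of_nat (n choose k) * iterated_difference h k f (x + h))" by (rule Suc)
  also have "\<dots> = (\<Sum>k\<le>n. of_nat (n choose k) * iterated_difference h (Suc k) f x) + (\<Sum>k\<le>n. of_nat (n choose k) * iterated_difference h k f x)"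
    by (simp add: sum.distrib[symmetric] algebra_simps)
  also have "(\<Sum>k\<le>n. of_nat (n choose k) * iterated_difference h k f x) = 
      iterated_difference h 0 f x + (\<Sum>k\<le>n. of_nat (n choose Suc k) * iterated_difference h (Suc k) f x)"
  proof -
    have "(\<Sum>k\<le>Suc n. of_nat (n choose k) * iterated_difference h k f x) =
       iterated_difference h 0 f x + (\<Sum>k\<le>n. of_nat (n choose Suc k) * iterated_difference h (Suc k) f x)"
      by (subst sum.atMost_Suc_shift) (simp only: binomial_n_0 of_nat_1 mult_1)
    then show ?thesis by (simp only: sum.atMost_Suc binomial_eq_0[OF lessI] of_nat_0 mult_zero_left add_0_right)
  qed
  also have "(\<Sum>k\<le>n. of_nat (n choose k) * iterated_difference h (Suc k) f x) +
      (iterated_difference h 0 f x + (\<Sum>k\<le>n. of_nat (n choose Suc k) * iterated_difference h (Suc k) f x)) =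
      iterated_difference h 0 f x + (\<Sum>k\<le>n. of_nat (Suc n choose Suc k) * iterated_difference h (Suc k) f x)"
    by (simp add: sum.distrib[symmetric] algebra_simps)
  also have "\<dots> = (\<Sum>k\<le>Suc n. of_nat (Suc n choose k) * iterated_difference h k f x)"
    by (subst sum.atMost_Suc_shift) simp
  finally show ?case .
qed simp

text \<open>The binomial coefficient as a polynomial in its upper argument.\<close>

definition binomial_poly :: "nat \<Rightarrow> complex poly" where
  "binomial_poly k = Polynomial.smult (inverse (fact k)) (\<Prod>i<k. [:- of_nat i, 1:])"

lemma poly_binomial_poly: "poly (binomial_poly k) (of_nat n) = of_nat (n choose k)"
proof -
  have "poly (binomial_poly k) (of_nat n) = of_nat n gchoose k"
    by (simp add: binomial_poly_def poly_prod gbinomial_prod_rev atLeast0LessThan divide_inverse mult.commute)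
  then show ?thesis by (simp add: binomial_gbinomial)
qed

lemma degree_binomial_poly: "degree (binomial_poly k) \<le> k"
proof -
  have "degree (\<Prod>i<k. [:- of_nat i, 1:] :: complex poly) \<le> (\<Sum>i<k. degree [:- of_nat i, 1 :: complex:])"
    using degree_prod_sum_le[of "{..<k}" "\<lambda>i. [:- of_nat i, 1 :: complex:]"] by (simp add: comp_def)
  then show ?thesis by (simp add: binomial_poly_def)
qed

lemma iterated_difference_zero_mono:
  assumes "\<And>x. l \<le> x \<Longrightarrow> x + of_nat N * h \<le> u \<Longrightarrow> iterated_difference h N f x = 0" "h > 0" "N \<le> k"
    "l \<le> x" "x + of_nat k * h \<le> u"
  shows "iterated_difference h k f x = 0"
  using \<open>N \<le> k\<close> \<open>l \<le> x\<close> \<open>x + of_nat k * h \<le> u\<close>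
proof (induction k arbitrary: x rule: dec_induct)
  case base
  then show ?case using assms(1) by simp
next
  case (step k)
  have "iterated_difference h k f (x + h) = 0" "iterated_difference h k f x = 0"
    using step.prems \<open>h > 0\<close> by (auto intro!: step.IH simp: algebra_simps)
  then show ?case by simp
qed

text \<open>
  In Newton's formula the terms beyond order \<open>N\<close> drop out, and the remaining binomial coefficients are
  polynomials in the grid index.
\<close>

lemma polynomial_on_grid:
  assumes "\<And>x. l \<le> x \<Longrightarrow> x + of_nat N * h \<le> u \<Longrightarrow> iterated_difference h N f x = 0" "h > 0"
  obtains P where "degree P < Suc N" "\<And>n. l + of_nat n * h \<le> u \<Longrightarrow> f (l + of_nat n * h) = poly P (of_real (l + of_nat n * h))"
proof -
  define P where "P = pcompose (\<Sum>k\<le>N. Polynomial.smult (iterated_difference h k f l) (binomial_poly k)) [:- of_real (l / h), of_real (1 / h):]"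
  have "degree P \<le> N" unfolding P_def
  proof (rule order_trans[OF degree_pcompose_le])
    have "degree (\<Sum>k\<le>N. Polynomial.smult (iterated_difference h k f l) (binomial_poly k)) \<le> N"
      by (rule degree_sum_le) (auto intro: order_trans[OF degree_smult_le] order_trans[OF degree_binomial_poly])
    then show "degree (\<Sum>k\<le>N. Polynomial.smult (iterated_difference h k f l) (binomial_poly k)) * degree [:- complex_of_real (l / h), of_real (1 / h):] \<le> N"
      using \<open>h > 0\<close> by simp
  qed
  moreover have "f (l + of_nat n * h) = poly P (of_real (l + of_nat n * h))" if n: "l + of_nat n * h \<le> u" for n
  proof -
    have "f (l + of_nat n * h) = (\<Sum>k\<le>n. of_nat (n choose k) * iterated_difference h k f l)" by (rule newton_forward)
    also have "\<dots> = (\<Sum>k\<le>max n N. of_nat (n choose k) * iterated_difference h k f l)"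
      by (rule sum.mono_neutral_left) (auto simp: binomial_eq_0)
    also have "\<dots> = (\<Sum>k\<le>N. of_nat (n choose k) * iterated_difference h k f l)"
    proof (rule sum.mono_neutral_right)
      show "\<forall>k\<in>{..max n N} - {..N}. of_nat (n choose k) * iterated_difference h k f l = 0"
      proof
        fix k assume k: "k \<in> {..max n N} - {..N}"
        then have "k \<le> n" "N \<le> k" by auto
        then have "real k * h \<le> real n * h" using \<open>h > 0\<close> by (intro mult_right_mono) auto
        then have "l + real k * h \<le> u" using n by simp
        then have "iterated_difference h k f l = 0"
          using iterated_difference_zero_mono[of l N h u f k l] assms \<open>N \<le> k\<close> by auto
        then show "of_nat (n choose k) * iterated_difference h k f l = 0" by simp
      qed
    qed auto
    also have "\<dots> = poly P (of_real (l + of_nat n * h))"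
    proof -
      have "complex_of_real (l + real n * h) * complex_of_real (1 / h) = of_real (l / h + real n)"
        using \<open>h > 0\<close> unfolding of_real_mult[symmetric] by (simp add: add_divide_distrib)
      then have "poly [:- of_real (l / h), of_real (1 / h):] (of_real (l + real n * h)) = complex_of_real (real n)"
        by simp
      then show ?thesis
        by (simp only: P_def poly_pcompose poly_sum poly_smult of_real_of_nat_eq poly_binomial_poly mult.commute)
    qed
    finally show ?thesis .
  qed
  ultimately show ?thesis using that[of P] by simp
qed

lemma poly_eq_if_eq_on_grid:
  fixes P Q :: "complex poly"
  assumes "degree P \<le> N" "degree Q \<le> N" "h > 0"
    "\<And>n. n \<le> N \<Longrightarrow> poly P (of_real (l + of_nat n * h)) = poly Q (of_real (l + of_nat n * h))"
  shows "P = Q"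
proof (rule ccontr)
  assume "P \<noteq> Q"
  then have nz: "P - Q \<noteq> 0" by simp
  have "inj_on (\<lambda>n. complex_of_real (l + of_nat n * h)) {..N}"
    using \<open>h > 0\<close> by (intro inj_onI) (simp only: of_real_eq_iff, simp)
  then have "Suc N = card ((\<lambda>n. complex_of_real (l + of_nat n * h)) ` {..N})" by (simp add: card_image)
  also have "\<dots> \<le> card {z. poly (P - Q) z = 0}"
    using assms(4) poly_roots_finite[OF nz] by (intro card_mono) auto
  also have "\<dots> \<le> degree (P - Q)" by (rule card_poly_roots_bound[OF nz])
  also have "\<dots> \<le> N" using assms by (intro degree_diff_le)
  finally show False by simp
qed

text \<open>
  On each of the grids of mesh \<open>h, h/2, h/4, \<dots>\<close> the function agrees with a polynomial of degree at most
  \<open>N\<close>. The coarsest grid has more than \<open>N\<close> points and is contained in all others, so the polynomial is the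
  same for all grids. Their union is dense, and continuity does the rest.
\<close>

lemma frechet_polynomial:
  fixes f :: "real \<Rightarrow> complex"
  assumes lu: "l < u" and cont: "continuous_on {l..u} f"
    and diff: "\<And>h x. h > 0 \<Longrightarrow> l \<le> x \<Longrightarrow> x + of_nat N * h \<le> u \<Longrightarrow> iterated_difference h N f x = 0"
  shows "\<exists>P. \<forall>x\<in>{l..u}. f x = poly P (of_real x)"
proof -
  \<comment> \<open>\<open>N + 1\<close> steps of the coarsest mesh fit exactly, giving more grid points than a polynomial of degree \<open>N\<close> needs\<close>
  define h where "h = (\<lambda>j. (u - l) / (real (Suc N) * 2 ^ j))"
  have h0: "h j > 0" for j using lu by (simp add: h_def)
  have "\<exists>P. degree P < Suc N \<and> (\<forall>n. l + of_nat n * h j \<le> u \<longrightarrow> f (l + of_nat n * h j) = poly P (of_real (l + of_nat n * h j)))" for j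
    using polynomial_on_grid[of l N "h j" u f] diff h0 by metis
  then obtain P where P: "\<And>j. degree (P j) < Suc N"
    "\<And>j n. l + of_nat n * h j \<le> u \<Longrightarrow> f (l + of_nat n * h j) = poly (P j) (of_real (l + of_nat n * h j))"
    by metis
  have grid: "real n * h 0 = real (n * 2 ^ j) * h j" for n j by (simp add: h_def)
  have PP: "P j = P 0" for j
  proof (rule poly_eq_if_eq_on_grid[of _ N _ "h 0" l])
    fix n assume "n \<le> N"
    then have "real n * h 0 \<le> real (Suc N) * h 0" using h0[of 0] by (intro mult_right_mono) auto
    also have "\<dots> = u - l" by (simp add: h_def)
    finally have le: "l + real n * h 0 \<le> u" by simp
    show "poly (P j) (of_real (l + of_nat n * h 0)) = poly (P 0) (of_real (l + of_nat n * h 0))"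
      using P(2)[of n 0] P(2)[of "n * 2 ^ j" j] le unfolding grid[of n j] by simp
  qed (use P(1) h0 less_Suc_eq_le in auto)
  have "f x = poly (P 0) (of_real x)" if x: "x \<in> {l..u}" for x
  proof -
    define y where "y = (\<lambda>j. l + of_nat (nat \<lfloor>(x - l) / h j\<rfloor>) * h j)"
    have yx: "y j \<le> x" "x - h j \<le> y j" "l \<le> y j" for j
    proof -
      have nn: "0 \<le> (x - l) / h j" using x h0[of j] by simp
      have "of_nat (nat \<lfloor>(x - l) / h j\<rfloor>) \<le> (x - l) / h j" using nn by simp
      then show "y j \<le> x" using h0[of j] by (simp add: y_def field_simps)
      have "(x - l) / h j - 1 \<le> of_nat (nat \<lfloor>(x - l) / h j\<rfloor>)" using nn by linarith
      then show "x - h j \<le> y j" using h0[of j] by (simp add: y_def field_simps)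
      show "l \<le> y j" using h0[of j] by (simp add: y_def)
    qed
    have "(\<lambda>j. (u - l) / real (Suc N) * (1 / 2) ^ j) \<longlonglongrightarrow> (u - l) / real (Suc N) * 0"
      by (intro tendsto_mult_left LIMSEQ_power_zero) simp
    then have hl: "h \<longlonglongrightarrow> 0" by (simp add: h_def[abs_def] field_simps)
    have yl: "y \<longlonglongrightarrow> x"
    proof (rule tendsto_sandwich[of "\<lambda>j. x - h j" _ _ "\<lambda>_. x"])
      show "(\<lambda>j. x - h j) \<longlonglongrightarrow> x" using tendsto_diff[OF tendsto_const[of x] hl] by simp
    qed (use yx in auto)
    have yin: "y j \<in> {l..u}" for j using yx[of j] x by auto
    have "(\<lambda>j. f (y j)) \<longlonglongrightarrow> f x"
      using continuous_on_tendsto_compose[OF cont yl x] yin by simp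
    moreover have "f (y j) = poly (P 0) (of_real (y j))" for j
      using P(2)[of "nat \<lfloor>(x - l) / h j\<rfloor>" j] yin[of j] PP[of j] by (simp add: y_def)
    moreover have "(\<lambda>j. poly (P 0) (of_real (y j))) \<longlonglongrightarrow> poly (P 0) (of_real x)"
      by (intro tendsto_intros yl)
    ultimately show ?thesis using LIMSEQ_unique by auto
  qed
  then show ?thesis by blast
qed

section \<open>Sums of ridge functions in the plane\<close>

lemma iterated_difference_inner: "iterated_difference h n (\<lambda>x. f (x + h) - f x) x = iterated_difference h (Suc n) f x"
  by (induction n arbitrary: x) auto

lemma iterated_difference_3:
  "iterated_difference h (Suc (Suc (Suc n))) f x = iterated_difference h n f (x + 3 * h) - 3 * iterated_difference h n f (x + 2 * h)
      + 3 * iterated_difference h n f (x + h) - iterated_difference h n f x"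
proof -
  have "x + h + h = x + 2 * h" "x + h + h + h = x + 3 * h" by simp_all
  then show ?thesis by (simp add: add.commute)
qed

definition bivariate_quadratic :: "(real \<Rightarrow> real \<Rightarrow> complex) \<Rightarrow> bool" where
  "bivariate_quadratic q \<longleftrightarrow> (\<exists>a b c d e f. \<forall>x y. q x y = a + b * of_real x + c * of_real y
      + d * of_real (x * x) + e * of_real (x * y) + f * of_real (y * y))"

lemma bivariate_quadratic_difference:
  assumes "bivariate_quadratic q"
  shows "bivariate_quadratic (\<lambda>x y. q (x + u) (y + v) - q x y)"
proof -
  obtain a b c d e f where q: "\<And>x y. q x y = a + b * of_real x + c * of_real y
      + d * of_real (x * x) + e * of_real (x * y) + f * of_real (y * y)"
    using assms unfolding bivariate_quadratic_def by blast
  show ?thesis unfolding bivariate_quadratic_def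
  proof (intro exI allI)
    fix x y
    show "q (x + u) (y + v) - q x y =
        (b * of_real u + c * of_real v + d * of_real (u * u) + e * of_real (u * v) + f * of_real (v * v))
         + (2 * d * of_real u + e * of_real v) * of_real x + (2 * f * of_real v + e * of_real u) * of_real y
         + 0 * of_real (x * x) + 0 * of_real (x * y) + 0 * of_real (y * y)"
      unfolding q by (simp add: algebra_simps)
  qed
qed

text \<open>
  The shift \<open>(x, y) \<mapsto> (x - b e, y + e)\<close> does not change \<open>x + b y\<close>, so the difference along it kills the ridge
  function of slope \<open>b\<close>. It moves \<open>x + b0 y\<close> by \<open>(b0 - b) e\<close>; the choice \<open>e = s / (b0 - b)\<close> makes this
  the same step \<open>s\<close> for every eliminated slope, so that \<open>G\<close> accumulates an iterated difference with equal
  steps. The domain shrinks by the size of the shifts.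
\<close>

lemma eliminate_directions:
  fixes F :: "real \<Rightarrow> real \<Rightarrow> complex"
  assumes "finite C" "b0 \<notin> C" "bivariate_quadratic q"
    and "\<And>x y. \<bar>x\<bar> < \<delta> \<Longrightarrow> \<bar>y\<bar> < \<delta> \<Longrightarrow> G (x + b0 * y) + (\<Sum>b\<in>C. F b (x + b * y)) = q x y"
  shows "\<exists>q'. bivariate_quadratic q' \<and> (\<forall>x y. \<bar>x\<bar> < \<delta> - \<bar>s\<bar> * (\<Sum>b\<in>C. (1 + \<bar>b\<bar>) / \<bar>b0 - b\<bar>) \<longrightarrow>
      \<bar>y\<bar> < \<delta> - \<bar>s\<bar> * (\<Sum>b\<in>C. (1 + \<bar>b\<bar>) / \<bar>b0 - b\<bar>) \<longrightarrow> iterated_difference s (card C) G (x + b0 * y) = q' x y)"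
  using assms
proof (induction C arbitrary: G F q \<delta> rule: finite_induct)
  case empty
  then show ?case by (intro exI[of _ q]) auto
next
  case (insert b C)
  define e where "e = s / (b0 - b)"
  have b: "b0 \<noteq> b" using insert.prems by auto
  have es: "b0 * e - b * e = s"
  proof -
    have "(b0 - b) * e = s" using b by (simp add: e_def)
    then show ?thesis by (simp only: left_diff_distrib)
  qed
  define F' where "F' = (\<lambda>c z. F c (z + (c - b) * e) - F c z)"
  define G' where "G' = (\<lambda>z. G (z + s) - G z)"
  define q' where "q' = (\<lambda>x y. q (x + - (b * e)) (y + e) - q x y)"
  define \<delta>' where "\<delta>' = \<delta> - \<bar>s\<bar> * ((1 + \<bar>b\<bar>) / \<bar>b0 - b\<bar>)"
  have d': "\<delta>' = \<delta> - (1 + \<bar>b\<bar>) * \<bar>e\<bar>" by (simp add: \<delta>'_def e_def abs_divide)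
  have "\<exists>q''. bivariate_quadratic q'' \<and> (\<forall>x y. \<bar>x\<bar> < \<delta>' - \<bar>s\<bar> * (\<Sum>b\<in>C. (1 + \<bar>b\<bar>) / \<bar>b0 - b\<bar>) \<longrightarrow>
      \<bar>y\<bar> < \<delta>' - \<bar>s\<bar> * (\<Sum>b\<in>C. (1 + \<bar>b\<bar>) / \<bar>b0 - b\<bar>) \<longrightarrow> iterated_difference s (card C) G' (x + b0 * y) = q'' x y)"
  proof (rule insert.IH)
    show "b0 \<notin> C" using insert.prems by auto
    show "bivariate_quadratic q'" unfolding q'_def by (rule bivariate_quadratic_difference) (rule insert.prems)
    fix x y assume xy: "\<bar>x\<bar> < \<delta>'" "\<bar>y\<bar> < \<delta>'"
    have "0 \<le> \<bar>e\<bar>" "0 \<le> \<bar>b\<bar> * \<bar>e\<bar>" by auto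
    moreover have "(1 + \<bar>b\<bar>) * \<bar>e\<bar> = \<bar>e\<bar> + \<bar>b\<bar> * \<bar>e\<bar>" by (simp add: algebra_simps)
    moreover have "\<bar>b * e\<bar> = \<bar>b\<bar> * \<bar>e\<bar>" by (rule abs_mult)
    ultimately have dom: "\<bar>x\<bar> < \<delta>" "\<bar>y\<bar> < \<delta>" "\<bar>x + - (b * e)\<bar> < \<delta>" "\<bar>y + e\<bar> < \<delta>"
      using xy unfolding d' by linarith+
    have step: "c * e - b * e = (c - b) * e" for c by (simp add: algebra_simps)
    have arg: "x + - (b * e) + c * (y + e) = x + c * y + (c - b) * e" for c by (simp add: algebra_simps)
    have "q' x y = (G (x + - (b * e) + b0 * (y + e)) + (\<Sum>c\<in>insert b C. F c (x + - (b * e) + c * (y + e))))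
       - (G (x + b0 * y) + (\<Sum>c\<in>insert b C. F c (x + c * y)))"
      unfolding q'_def insert.prems(3)[OF dom(1,2)] insert.prems(3)[OF dom(3,4)] ..
    also have "\<dots> = G' (x + b0 * y) + (\<Sum>c\<in>insert b C. F' c (x + c * y))"
      unfolding arg G'_def F'_def sum_subtractf using es step[of b0] by simp
    also have "(\<Sum>c\<in>insert b C. F' c (x + c * y)) = (\<Sum>c\<in>C. F' c (x + c * y))"
      using insert.hyps by (simp add: F'_def)
    finally show "G' (x + b0 * y) + (\<Sum>c\<in>C. F' c (x + c * y)) = q' x y" by simp
  qed
  moreover have "\<delta>' - \<bar>s\<bar> * (\<Sum>b\<in>C. (1 + \<bar>b\<bar>) / \<bar>b0 - b\<bar>) = \<delta> - \<bar>s\<bar> * (\<Sum>b\<in>insert b C. (1 + \<bar>b\<bar>) / \<bar>b0 - b\<bar>)"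
    using insert.hyps by (simp add: \<delta>'_def algebra_simps)
  moreover have "iterated_difference s (card C) G' z = iterated_difference s (card (insert b C)) G z" for z
    using insert.hyps unfolding G'_def by (simp add: iterated_difference_inner del: iterated_difference.simps)
  ultimately show ?case by simp
qed

text \<open>
  After eliminating all other slopes and setting \<open>y = 0\<close>, an iterated difference of \<open>F b0\<close> is a quadratic
  polynomial, which three further differences annihilate. The constant \<open>\<eta>\<close> is small enough that
  every step \<open>h\<close> that fits into \<open>[-\<eta>, \<eta>]\<close> keeps the shifts inside the domain of the functional equation.
\<close>

lemma ridge_functions_polynomial:
  fixes F :: "real \<Rightarrow> real \<Rightarrow> complex"
  assumes "finite B" "b0 \<in> B" "bivariate_quadratic q" "\<delta> > 0"
    and cont: "continuous_on {-\<delta><..<\<delta>} (F b0)"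
    and eq: "\<And>x y. \<bar>x\<bar> < \<delta> \<Longrightarrow> \<bar>y\<bar> < \<delta> \<Longrightarrow> (\<Sum>b\<in>B. F b (x + b * y)) = q x y"
  shows "\<exists>P. eventually (\<lambda>z. F b0 z = poly P (of_real z)) (nhds 0)"
proof -
  define C where "C = B - {b0}"
  \<comment> \<open>\<open>\<kappa> \<bar>s\<bar>\<close> is the amount by which the eliminations with step \<open>s\<close> shrink the domain\<close>
  define \<kappa> where "\<kappa> = (\<Sum>b\<in>C. (1 + \<bar>b\<bar>) / \<bar>b0 - b\<bar>)"
  have "\<kappa> \<ge> 0" unfolding \<kappa>_def by (intro sum_nonneg) auto
  define \<eta> where "\<eta> = \<delta> / (4 * (1 + \<kappa>))"
  have "\<eta> > 0" using \<open>\<delta> > 0\<close> \<open>\<kappa> \<ge> 0\<close> by (simp add: \<eta>_def)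
  have \<eta>: "4 * \<eta> + 4 * \<eta> * \<kappa> = \<delta>"
  proof -
    have "4 * \<eta> + 4 * \<eta> * \<kappa> = (4 * (1 + \<kappa>)) * \<eta>" by (simp add: algebra_simps)
    also have "\<dots> = \<delta>" using \<open>\<kappa> \<ge> 0\<close> by (simp add: \<eta>_def)
    finally show ?thesis .
  qed
  let ?N = "Suc (Suc (Suc (card C)))"
  have "\<exists>P. \<forall>x\<in>{-\<eta>..\<eta>}. F b0 x = poly P (of_real x)"
  proof (rule frechet_polynomial[where N="?N"])
    show "-\<eta> < \<eta>" using \<open>\<eta> > 0\<close> by simp
    have "0 \<le> \<eta> * \<kappa>" using \<open>\<eta> > 0\<close> \<open>\<kappa> \<ge> 0\<close> by simp
    then have "\<eta> < \<delta>" using \<open>\<eta> > 0\<close> \<eta> by linarith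
    then show "continuous_on {-\<eta>..\<eta>} (F b0)" by (intro continuous_on_subset[OF cont]) auto
    fix h x :: real assume h: "h > 0" "-\<eta> \<le> x" "x + real ?N * h \<le> \<eta>"
    have "real ?N * h = real (card C) * h + 3 * h" by (simp add: algebra_simps)
    moreover have "0 \<le> real (card C) * h" using h by simp
    ultimately have h3: "x + 3 * h \<le> \<eta>" using h(3) by linarith
    then have "h \<le> \<eta>" using h \<open>\<eta> > 0\<close> by linarith
    then have "h * \<kappa> \<le> \<eta> * \<kappa>" using \<open>\<kappa> \<ge> 0\<close> by (rule mult_right_mono)
    then have dom: "2 * \<eta> < \<delta> - \<bar>h\<bar> * \<kappa>" using \<eta> h \<open>\<eta> > 0\<close> \<open>0 \<le> \<eta> * \<kappa>\<close> by linarith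
    have sumC: "F b0 (x + b0 * y) + (\<Sum>b\<in>C. F b (x + b * y)) = (\<Sum>b\<in>B. F b (x + b * y))" for x y
      unfolding C_def using assms(1,2) by (simp add: sum.remove)
    have "\<exists>q'. bivariate_quadratic q' \<and> (\<forall>x y. \<bar>x\<bar> < \<delta> - \<bar>h\<bar> * \<kappa> \<longrightarrow> \<bar>y\<bar> < \<delta> - \<bar>h\<bar> * \<kappa> \<longrightarrow>
        iterated_difference h (card C) (F b0) (x + b0 * y) = q' x y)"
      unfolding \<kappa>_def by (rule eliminate_directions[where F=F and q=q]) (use assms(1,3) eq sumC in \<open>auto simp: C_def\<close>)
    then obtain q' where q': "bivariate_quadratic q'"
        "\<And>x y. \<bar>x\<bar> < \<delta> - \<bar>h\<bar> * \<kappa> \<Longrightarrow> \<bar>y\<bar> < \<delta> - \<bar>h\<bar> * \<kappa> \<Longrightarrow> iterated_difference h (card C) (F b0) (x + b0 * y) = q' x y"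
      by blast
    then obtain a b c d e f where q'': "\<And>x y. q' x y = a + b * of_real x + c * of_real y
        + d * of_real (x * x) + e * of_real (x * y) + f * of_real (y * y)"
      unfolding bivariate_quadratic_def by blast
    have D: "iterated_difference h (card C) (F b0) z = a + b * of_real z + d * of_real (z * z)" if "\<bar>z\<bar> \<le> \<eta>" for z
    proof -
      have "\<bar>z\<bar> < \<delta> - \<bar>h\<bar> * \<kappa>" "\<bar>0\<bar> < \<delta> - \<bar>h\<bar> * \<kappa>" using that dom \<open>\<eta> > 0\<close> by linarith+
      from q'(2)[OF this] show ?thesis unfolding q'' by simp
    qed
    have "\<bar>x\<bar> \<le> \<eta>" "\<bar>x + h\<bar> \<le> \<eta>" "\<bar>x + 2 * h\<bar> \<le> \<eta>" "\<bar>x + 3 * h\<bar> \<le> \<eta>"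
      using h h3 by linarith+
    from this[THEN D] show "iterated_difference h ?N (F b0) x = 0"
      unfolding iterated_difference_3 by (simp add: algebra_simps)
  qed
  then obtain P where P: "\<And>x. x \<in> {-\<eta>..\<eta>} \<Longrightarrow> F b0 x = poly P (of_real x)" by blast
  have "eventually (\<lambda>z. z \<in> {-\<eta><..<\<eta>}) (nhds 0)"
    using \<open>\<eta> > 0\<close> by (intro eventually_nhds_in_open) auto
  then have "eventually (\<lambda>z. F b0 z = poly P (of_real z)) (nhds 0)"
    by eventually_elim (use P in auto)
  then show ?thesis ..
qed

lemma exp_eq_1_small: "exp z = 1 \<Longrightarrow> cmod z < 2 * pi \<Longrightarrow> z = 0"
proof -
  assume "exp z = 1" "cmod z < 2 * pi"
  then obtain n :: int where n: "Re z = 0" "Im z = of_int (2 * n) * pi" by (auto simp: exp_eq_1)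
  have "\<bar>Im z\<bar> < 2 * pi" using abs_Im_le_cmod[of z] \<open>cmod z < 2 * pi\<close> by simp
  then have "\<bar>real_of_int n\<bar> < 1" unfolding n(2) by (simp add: abs_mult)
  then have "n = 0" by linarith
  then show ?thesis using n by (simp add: complex_eq_iff)
qed

text \<open>
  The logarithmic form of the functional equation. Near the origin all factors are close to \<open>1\<close>, so principal
  logarithms are continuous, and the equation between products gives the equation between sums of logarithms
  up to a multiple of \<open>2 pi \<i>\<close> that is continuous and vanishes at the origin. Grouping the logarithms by
  slope yields ridge functions with distinct slopes.
\<close>

lemma char_factors_by_slope:
  fixes \<phi>1 :: "'i \<Rightarrow> real \<Rightarrow> complex" and \<phi>2 :: "'j \<Rightarrow> real \<Rightarrow> complex"
    and a1 b1 :: "'i \<Rightarrow> real" and a2 b2 :: "'j \<Rightarrow> real"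
  assumes fin: "finite I" "finite J"
    and cont: "\<And>i. i \<in> I \<Longrightarrow> continuous_on UNIV (\<phi>1 i)" "\<And>j. j \<in> J \<Longrightarrow> continuous_on UNIV (\<phi>2 j)"
    and one: "\<And>i. i \<in> I \<Longrightarrow> \<phi>1 i 0 = 1" "\<And>j. j \<in> J \<Longrightarrow> \<phi>2 j 0 = 1"
    and nz: "\<And>i. i \<in> I \<Longrightarrow> a1 i \<noteq> 0" "\<And>j. j \<in> J \<Longrightarrow> a2 j \<noteq> 0"
    and q: "bivariate_quadratic q" "q 0 0 = 0"
    and eq: "\<And>x y. (\<Prod>i\<in>I. \<phi>1 i (a1 i * x + b1 i * y)) = (\<Prod>j\<in>J. \<phi>2 j (a2 j * x + b2 j * y)) * exp (q x y)"
  shows "\<exists>P. eventually (\<lambda>z. (\<Prod>i\<in>{i\<in>I. b1 i / a1 i = b}. \<phi>1 i (a1 i * z)) =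
      (\<Prod>j\<in>{j\<in>J. b2 j / a2 j = b}. \<phi>2 j (a2 j * z)) * exp (poly P (of_real z))) (nhds 0)"
proof -
  define L1 where "L1 = (\<lambda>i z. Ln (\<phi>1 i (a1 i * z)))"
  define L2 where "L2 = (\<lambda>j z. Ln (\<phi>2 j (a2 j * z)))"
  define s1 where "s1 = (\<lambda>i. b1 i / a1 i)"
  define s2 where "s2 = (\<lambda>j. b2 j / a2 j)"
  \<comment> \<open>the total ridge function of slope \<open>b\<close>; its first part or its second part may be an empty sum\<close>
  define F where "F = (\<lambda>b z. (\<Sum>i\<in>{i\<in>I. s1 i = b}. L1 i z) - (\<Sum>j\<in>{j\<in>J. s2 j = b}. L2 j z))"
  define B where "B = insert b (s1 ` I \<union> s2 ` J)"
  have "finite B" using fin by (simp add: B_def)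
  have c1: "continuous_on UNIV (\<lambda>z. \<phi>1 i (a1 i * z))" if "i \<in> I" for i
    by (rule continuous_on_compose2[OF cont(1)[OF that]]) (auto intro!: continuous_intros)
  have c2: "continuous_on UNIV (\<lambda>z. \<phi>2 j (a2 j * z))" if "j \<in> J" for j
    by (rule continuous_on_compose2[OF cont(2)[OF that]]) (auto intro!: continuous_intros)
  have pos: "eventually (\<lambda>z. Re (g z) > 0) (nhds 0)" if "continuous_on UNIV g" "g 0 = 1" for g :: "real \<Rightarrow> complex"
  proof -
    have "isCont g 0" using that(1) by (simp add: continuous_on_eq_continuous_at)
    then have "filterlim (\<lambda>z. Re (g z)) (nhds (Re (g 0))) (nhds 0)"
      by (intro tendsto_Re) (simp add: isCont_def tendsto_at_iff_tendsto_nhds)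
    then show ?thesis by (rule order_tendstoD) (simp add: that(2))
  qed
  have "eventually (\<lambda>z. (\<forall>i\<in>I. Re (\<phi>1 i (a1 i * z)) > 0) \<and> (\<forall>j\<in>J. Re (\<phi>2 j (a2 j * z)) > 0)) (nhds 0)"
    using fin c1 c2 one by (intro eventually_conj eventually_ball_finite ballI pos) auto
  then obtain r where r: "r > 0" "\<And>z i. \<bar>z\<bar> < r \<Longrightarrow> i \<in> I \<Longrightarrow> Re (\<phi>1 i (a1 i * z)) > 0"
      "\<And>z j. \<bar>z\<bar> < r \<Longrightarrow> j \<in> J \<Longrightarrow> Re (\<phi>2 j (a2 j * z)) > 0"
    unfolding eventually_nhds_metric by (auto simp: dist_norm)
  have cL1: "continuous_on {-r<..<r} (L1 i)" if "i \<in> I" for i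
    unfolding L1_def
  proof (rule continuous_on_Ln')
    show "continuous_on {-r<..<r} (\<lambda>z. \<phi>1 i (a1 i * z))" by (rule continuous_on_subset[OF c1[OF that]]) auto
    show "\<phi>1 i (a1 i * z) \<notin> \<real>\<^sub>\<le>\<^sub>0" if "z \<in> {-r<..<r}" for z
      using r(2)[of z i] \<open>i \<in> I\<close> that by (auto simp: complex_nonpos_Reals_iff abs_less_iff)
  qed
  have cL2: "continuous_on {-r<..<r} (L2 j)" if "j \<in> J" for j
    unfolding L2_def
  proof (rule continuous_on_Ln')
    show "continuous_on {-r<..<r} (\<lambda>z. \<phi>2 j (a2 j * z))" by (rule continuous_on_subset[OF c2[OF that]]) auto
    show "\<phi>2 j (a2 j * z) \<notin> \<real>\<^sub>\<le>\<^sub>0" if "z \<in> {-r<..<r}" for z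
      using r(3)[of z j] \<open>j \<in> J\<close> that by (auto simp: complex_nonpos_Reals_iff abs_less_iff)
  qed
  have e1: "exp (L1 i z) = \<phi>1 i (a1 i * z)" if "\<bar>z\<bar> < r" "i \<in> I" for i z
    using r(2)[OF that] unfolding L1_def by (intro exp_Ln) auto
  have e2: "exp (L2 j z) = \<phi>2 j (a2 j * z)" if "\<bar>z\<bar> < r" "j \<in> J" for j z
    using r(3)[OF that] unfolding L2_def by (intro exp_Ln) auto
  define D where "D = (\<lambda>x y. (\<Sum>i\<in>I. L1 i (x + s1 i * y)) - (\<Sum>j\<in>J. L2 j (x + s2 j * y)) - q x y)"
  have lim0: "((\<lambda>p. g (fst p + s * snd p)) \<longlongrightarrow> g 0) (nhds (0::real,0::real))"
    if "continuous_on {-r<..<r} g" for g :: "real \<Rightarrow> complex" and s :: real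
  proof -
    have "isCont g 0" using that r(1) by (simp add: continuous_on_eq_continuous_at)
    then have "filterlim g (nhds (g 0)) (nhds 0)" by (simp add: isCont_def tendsto_at_iff_tendsto_nhds)
    moreover have "((\<lambda>p. fst p + s * snd p) \<longlongrightarrow> fst (0::real,0::real) + s * snd (0::real,0::real)) (nhds (0,0))"
      by (intro tendsto_intros filterlim_ident)
    ultimately show ?thesis by (auto intro: filterlim_compose)
  qed
  have lim_arg: "eventually (\<lambda>p. \<bar>fst p + s * snd p\<bar> < r) (nhds (0::real,0::real))" for s
  proof -
    have "((\<lambda>p. \<bar>fst p + s * snd p\<bar>) \<longlongrightarrow> \<bar>fst (0::real,0::real) + s * snd (0::real,0::real)\<bar>) (nhds (0,0))"
      by (intro tendsto_intros filterlim_ident)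
    then show ?thesis by (rule order_tendstoD) (use r(1) in simp)
  qed
  obtain k0 k1 k2 k3 k4 k5 where qf: "\<And>x y. q x y = k0 + k1 * of_real x + k2 * of_real y
        + k3 * of_real (x * x) + k4 * of_real (x * y) + k5 * of_real (y * y)"
    using q(1) unfolding bivariate_quadratic_def by blast
  have q0: "((\<lambda>p. q (fst p) (snd p)) \<longlongrightarrow> q (fst (0::real,0::real)) (snd (0::real,0::real))) (nhds (0,0))"
    unfolding qf by (intro tendsto_intros filterlim_ident)
  have "((\<lambda>p. D (fst p) (snd p)) \<longlongrightarrow> (\<Sum>i\<in>I. L1 i 0) - (\<Sum>j\<in>J. L2 j 0) - q (fst (0::real,0::real)) (snd (0::real,0::real))) (nhds (0,0))"
    unfolding D_def by (intro tendsto_diff tendsto_sum q0 lim0 cL1 cL2)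
  also have "(\<Sum>i\<in>I. L1 i 0) - (\<Sum>j\<in>J. L2 j 0) - q (fst (0::real,0::real)) (snd (0::real,0::real)) = 0"
    using one q by (simp add: L1_def L2_def)
  finally have "((\<lambda>p. cmod (D (fst p) (snd p))) \<longlongrightarrow> 0) (nhds (0,0))"
    by (rule tendsto_norm_zero)
  then have "eventually (\<lambda>p. cmod (D (fst p) (snd p)) < 2 * pi) (nhds (0,0))"
    by (rule order_tendstoD) simp
  moreover have "eventually (\<lambda>p. (\<forall>i\<in>I. \<bar>fst p + s1 i * snd p\<bar> < r) \<and> (\<forall>j\<in>J. \<bar>fst p + s2 j * snd p\<bar> < r)) (nhds (0::real,0::real))"
    using fin by (intro eventually_conj eventually_ball_finite ballI lim_arg)
  ultimately have "eventually (\<lambda>p. D (fst p) (snd p) = 0) (nhds (0,0))"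
  proof eventually_elim
    case (elim p)
    obtain x y where p: "p = (x, y)" by force
    have "exp (D x y) = (\<Prod>i\<in>I. exp (L1 i (x + s1 i * y))) / (\<Prod>j\<in>J. exp (L2 j (x + s2 j * y))) / exp (q x y)"
      using fin by (simp add: D_def exp_diff exp_sum)
    also have "(\<Prod>i\<in>I. exp (L1 i (x + s1 i * y))) = (\<Prod>i\<in>I. \<phi>1 i (a1 i * x + b1 i * y))"
      using elim nz by (intro prod.cong) (auto simp: p e1 s1_def distrib_left)
    also have "(\<Prod>j\<in>J. exp (L2 j (x + s2 j * y))) = (\<Prod>j\<in>J. \<phi>2 j (a2 j * x + b2 j * y))"
      using elim nz by (intro prod.cong) (auto simp: p e2 s2_def distrib_left)
    finally have "exp (D x y) = (\<Prod>j\<in>J. \<phi>2 j (a2 j * x + b2 j * y)) * exp (q x y) / (\<Prod>j\<in>J. \<phi>2 j (a2 j * x + b2 j * y)) / exp (q x y)"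
      by (simp only: eq)
    moreover have "(\<Prod>j\<in>J. exp (L2 j (x + s2 j * y))) \<noteq> 0" using fin by simp
    ultimately have "exp (D x y) = 1"
      using \<open>(\<Prod>j\<in>J. exp (L2 j (x + s2 j * y))) = _\<close> by simp
    then show ?case using elim by (auto simp: p intro: exp_eq_1_small)
  qed
  then obtain \<delta>0 where \<delta>0: "\<delta>0 > 0" "\<And>x y. dist (x, y) (0, 0) < \<delta>0 \<Longrightarrow> D x y = 0"
    unfolding eventually_nhds_metric by auto
  define \<delta> where "\<delta> = min r (\<delta>0 / 2)"
  have "\<delta> > 0" using r(1) \<delta>0(1) by (simp add: \<delta>_def)
  have D0: "D x y = 0" if "\<bar>x\<bar> < \<delta>" "\<bar>y\<bar> < \<delta>" for x y
  proof (rule \<delta>0(2))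
    have "dist (x, y) (0, 0) \<le> \<bar>x\<bar> + \<bar>y\<bar>" using sqrt_sum_squares_le_sum_abs[of x y] by (simp add: dist_Pair_Pair)
    then show "dist (x, y) (0, 0) < \<delta>0" using that by (simp add: \<delta>_def)
  qed
  have grouped: "(\<Sum>b\<in>B. F b (x + b * y)) = q x y" if "\<bar>x\<bar> < \<delta>" "\<bar>y\<bar> < \<delta>" for x y
  proof -
    have "(\<Sum>b\<in>B. F b (x + b * y)) =
        (\<Sum>b\<in>B. \<Sum>i\<in>{i\<in>I. s1 i = b}. L1 i (x + s1 i * y)) - (\<Sum>b\<in>B. \<Sum>j\<in>{j\<in>J. s2 j = b}. L2 j (x + s2 j * y))"
      unfolding F_def sum_subtractf by (intro arg_cong2[of _ _ _ _ minus] sum.cong) auto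
    also have "\<dots> = (\<Sum>i\<in>I. L1 i (x + s1 i * y)) - (\<Sum>j\<in>J. L2 j (x + s2 j * y))"
      using fin \<open>finite B\<close> by (intro arg_cong2[of _ _ _ _ minus] sum.group) (auto simp: B_def)
    also have "\<dots> = q x y" using D0[OF that] by (simp add: D_def)
    finally show ?thesis .
  qed
  have "continuous_on {-\<delta><..<\<delta>} (F b)"
    unfolding F_def
    by (intro continuous_on_diff continuous_on_sum continuous_on_subset[OF cL1] continuous_on_subset[OF cL2])
      (auto simp: \<delta>_def)
  then have "\<exists>P. eventually (\<lambda>z. F b z = poly P (of_real z)) (nhds 0)"
    by (intro ridge_functions_polynomial[OF \<open>finite B\<close> _ q(1) \<open>\<delta> > 0\<close> _ grouped]) (auto simp: B_def)
  then obtain P where P: "eventually (\<lambda>z. F b z = poly P (of_real z)) (nhds 0)" ..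
  have "eventually (\<lambda>z. z \<in> {-r<..<r}) (nhds 0)"
    using r(1) by (intro eventually_nhds_in_open) auto
  with P have "eventually (\<lambda>z. (\<Prod>i\<in>{i\<in>I. b1 i / a1 i = b}. \<phi>1 i (a1 i * z)) =
      (\<Prod>j\<in>{j\<in>J. b2 j / a2 j = b}. \<phi>2 j (a2 j * z)) * exp (poly P (of_real z))) (nhds 0)"
  proof eventually_elim
    case (elim z)
    have "exp (\<Sum>i\<in>{i\<in>I. s1 i = b}. L1 i z) = exp (\<Sum>j\<in>{j\<in>J. s2 j = b}. L2 j z) * exp (F b z)"
      by (simp add: F_def flip: exp_add)
    moreover have "exp (\<Sum>i\<in>{i\<in>I. s1 i = b}. L1 i z) = (\<Prod>i\<in>{i\<in>I. b1 i / a1 i = b}. \<phi>1 i (a1 i * z))"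
      using fin elim by (auto simp: exp_sum e1 s1_def abs_less_iff intro!: prod.cong)
    moreover have "exp (\<Sum>j\<in>{j\<in>J. s2 j = b}. L2 j z) = (\<Prod>j\<in>{j\<in>J. b2 j / a2 j = b}. \<phi>2 j (a2 j * z))"
      using fin elim by (auto simp: exp_sum e2 s2_def abs_less_iff intro!: prod.cong)
    ultimately show ?case using elim by simp
  qed
  then show ?thesis ..
qed

section \<open>Generic planes\<close>

text \<open>
  Restricted to the moment curve, a linear form becomes a polynomial with the same coefficients.
\<close>

lemma linear_form_moment_curve:
  fixes v :: "real Matrix.vec"
  assumes "v \<in> carrier_vec p"
  shows "v \<bullet> vec p (\<lambda>i. s ^ i) = poly (\<Sum>i<p. monom (v $ i) i) s"
  using assms by (simp add: scalar_prod_def poly_sum poly_monom atLeast0LessThan)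

text \<open>
  A vector on the moment curve avoids finitely many hyperplanes, since each of them meets the curve in the
  roots of a nonzero polynomial.
\<close>

lemma avoid_hyperplanes:
  fixes V :: "real Matrix.vec set"
  assumes "finite V" "V \<subseteq> carrier_vec p" "0\<^sub>v p \<notin> V"
  obtains u where "u \<in> carrier_vec p" "\<And>v. v \<in> V \<Longrightarrow> v \<bullet> u \<noteq> 0"
proof -
  define Q where "Q = (\<lambda>v :: real Matrix.vec. \<Sum>i<p. monom (v $ i) i)"
  have co: "coeff (Q v) i = v $ i" if "i < p" for v i
    using that by (simp add: Q_def coeff_sum)
  have nz: "Q v \<noteq> 0" if v: "v \<in> V" for v
  proof
    assume "Q v = 0"
    then have "v $ i = 0" if "i < p" for i using co[OF that, of v] by simp
    then have "v = 0\<^sub>v p" using assms(2) v by (intro eq_vecI) auto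
    then show False using assms(3) v by simp
  qed
  have "finite (\<Union>v\<in>V. {s. poly (Q v) s = 0})" using assms(1) nz by (auto intro: poly_roots_finite)
  then obtain s where "s \<notin> (\<Union>v\<in>V. {s. poly (Q v) s = 0})"
    using ex_new_if_finite[OF infinite_UNIV_char_0] by blast
  then have "v \<bullet> vec p (\<lambda>i. s ^ i) \<noteq> 0" if "v \<in> V" for v
    using that assms(2) by (auto simp: linear_form_moment_curve Q_def)
  then show ?thesis using that[of "vec p (\<lambda>i. s ^ i)"] by auto
qed

text \<open>
  Equality of the slopes of \<open>a\<close> and \<open>b\<close> says that \<open>v\<close> is orthogonal to \<open>(b \<bullet> u) a - (a \<bullet> u) b\<close>. So \<open>v\<close> has to
  avoid the hyperplanes orthogonal to those of these vectors that are nonzero; the others express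
  proportionality.
\<close>

lemma generic_plane:
  fixes V :: "real Matrix.vec set"
  assumes "finite V" "V \<subseteq> carrier_vec p" "0\<^sub>v p \<notin> V"
  obtains u v where "u \<in> carrier_vec p" "v \<in> carrier_vec p" "\<And>a. a \<in> V \<Longrightarrow> a \<bullet> u \<noteq> 0"
    "\<And>a b. a \<in> V \<Longrightarrow> b \<in> V \<Longrightarrow> (a \<bullet> v) / (a \<bullet> u) = (b \<bullet> v) / (b \<bullet> u) \<Longrightarrow> b = ((b \<bullet> u) / (a \<bullet> u)) \<cdot>\<^sub>v a"
proof -
  obtain u where u: "u \<in> carrier_vec p" "\<And>a. a \<in> V \<Longrightarrow> a \<bullet> u \<noteq> 0"
    using avoid_hyperplanes[OF assms] by metis
  define W where "W = ((\<lambda>(a, b). (b \<bullet> u) \<cdot>\<^sub>v a - (a \<bullet> u) \<cdot>\<^sub>v b) ` (V \<times> V)) - {0\<^sub>v p}"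
  have "finite W" "W \<subseteq> carrier_vec p" "0\<^sub>v p \<notin> W"
    using assms by (auto simp: W_def intro!: minus_carrier_vec smult_carrier_vec)
  then obtain v where v: "v \<in> carrier_vec p" "\<And>w. w \<in> W \<Longrightarrow> w \<bullet> v \<noteq> 0"
    using avoid_hyperplanes by metis
  have "b = ((b \<bullet> u) / (a \<bullet> u)) \<cdot>\<^sub>v a" if ab: "a \<in> V" "b \<in> V" and eq: "(a \<bullet> v) / (a \<bullet> u) = (b \<bullet> v) / (b \<bullet> u)" for a b
  proof -
    have car: "a \<in> carrier_vec p" "b \<in> carrier_vec p" using ab assms by auto
    let ?w = "(b \<bullet> u) \<cdot>\<^sub>v a - (a \<bullet> u) \<cdot>\<^sub>v b"
    have "?w \<bullet> v = (b \<bullet> u) * (a \<bullet> v) - (a \<bullet> u) * (b \<bullet> v)"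
      using car v(1) by (simp add: minus_scalar_prod_distrib[of _ p])
    also have "\<dots> = 0" using eq u(2)[OF ab(1)] u(2)[OF ab(2)] by (simp add: field_simps)
    finally have "?w \<notin> W" using v(2) by blast
    then have "?w = 0\<^sub>v p" using ab by (auto simp: W_def)
    then have "(b \<bullet> u) * a $ i - (a \<bullet> u) * b $ i = 0" if "i < p" for i
    proof -
      have "(b \<bullet> u) * a $ i - (a \<bullet> u) * b $ i = ?w $ i" using that car by simp
      then show ?thesis using \<open>?w = 0\<^sub>v p\<close> that by simp
    qed
    then show ?thesis using car u(2)[OF ab(1)] by (intro eq_vecI) (auto simp: field_simps)
  qed
  then show ?thesis using that u v by blast
qed

section \<open>Matrices\<close>

lemma rank_eq_if_cols_multiples:
  fixes A B :: "real mat"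
  assumes A: "A \<in> carrier_mat p k" and B: "B \<in> carrier_mat p k"
    and AB: "\<And>j. j < k \<Longrightarrow> \<exists>i<k. \<exists>c. col A j = c \<cdot>\<^sub>v col B i"
    and BA: "\<And>i. i < k \<Longrightarrow> \<exists>j<k. \<exists>c. col B i = c \<cdot>\<^sub>v col A j"
  shows "vec_space.rank p A = vec_space.rank p B"
proof -
  interpret vec_space "TYPE(real)" p .
  have le: "span (set (cols A)) \<subseteq> span (set (cols B))"
    if A: "A \<in> carrier_mat p k" and B: "B \<in> carrier_mat p k" and AB: "\<And>j. j < k \<Longrightarrow> \<exists>i<k. \<exists>c. col A j = c \<cdot>\<^sub>v col B i"
    for A B :: "real mat"
  proof (rule span_subsetI)
    have cB: "set (cols B) \<subseteq> carrier_vec p" using B cols_dim by blast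
    then show "set (cols B) \<subseteq> carrier_vec p" .
    show "set (cols A) \<subseteq> span (set (cols B))"
    proof
      fix a assume "a \<in> set (cols A)"
      then obtain j where j: "j < k" "a = col A j" using A by (auto simp: cols_def)
      then obtain i c where i: "i < k" "a = c \<cdot>\<^sub>v col B i" using AB by blast
      have "col B i \<in> set (cols B)" using B i by (auto simp: cols_def)
      then show "a \<in> span (set (cols B))"
        unfolding i(2) using cB by (intro smult_in_span span_mem) auto
    qed
  qed
  have "span (set (cols A)) = span (set (cols B))" using le[OF A B AB] le[OF B A BA] by blast
  then show ?thesis by (simp add: rank_def)
qed

text \<open>
  A kernel vector \<open>v\<close> of the Gram matrix satisfies \<open>(A v) \<bullet> (A v) = v \<bullet> A\<^sup>T A v = 0\<close>.
\<close>

lemma gram_invertible: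
  fixes A :: "real mat"
  assumes A: "A \<in> carrier_mat p k" and inj: "\<And>v. v \<in> carrier_vec k \<Longrightarrow> A *\<^sub>v v = 0\<^sub>v p \<Longrightarrow> v = 0\<^sub>v k"
  shows "det (A\<^sup>T * A) \<noteq> 0"
proof
  have G: "A\<^sup>T * A \<in> carrier_mat k k" using A by auto
  assume "det (A\<^sup>T * A) = 0"
  then obtain v where v: "v \<in> carrier_vec k" "v \<noteq> 0\<^sub>v k" "(A\<^sup>T * A) *\<^sub>v v = 0\<^sub>v k"
    using det_0_iff_vec_prod_zero_field[OF G] by blast
  define w where "w = A *\<^sub>v v"
  have w: "w \<in> carrier_vec p" using A v by (simp add: w_def)
  have "A\<^sup>T *\<^sub>v w = 0\<^sub>v k" using v A by (simp add: w_def assoc_mult_mat_vec[of "A\<^sup>T" k p A k v])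
  then have "w \<bullet> w = 0"
    using transpose_vec_mult_scalar[OF A v(1) w] v(1) by (simp add: w_def)
  then have "(\<Sum>i<p. (w $ i)\<^sup>2) = 0" using w by (simp add: scalar_prod_def atLeast0LessThan power2_eq_square)
  then have "w $ i = 0" if "i < p" for i using that by (simp add: sum_nonneg_eq_0_iff)
  then have "w = 0\<^sub>v p" using w by (intro eq_vecI) auto
  then show False using inj v by (auto simp: w_def)
qed

text \<open>
  With linearly independent columns, \<open>(A\<^sup>T A)\<^sup>-\<^sup>1 A\<^sup>T\<close> is a left inverse.
\<close>

lemma has_left_inverse_iff_full_rank:
  fixes A :: "real mat"
  assumes A: "A \<in> carrier_mat p k" and dist: "distinct (cols A)"
  shows "has_left_inverse A \<longleftrightarrow> vec_space.rank p A = k"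
proof -
  interpret vec_space "TYPE(real)" p .
  show ?thesis
  proof
    assume "has_left_inverse A"
    then obtain B where B: "B \<in> carrier_mat k p" "B * A = 1\<^sub>m k"
      using A by (auto simp: has_left_inverse_def)
    have inj: "v = 0\<^sub>v k" if "v \<in> carrier_vec k" "A *\<^sub>v v = 0\<^sub>v p" for v
    proof -
      have "v = (B * A) *\<^sub>v v" using B that by simp
      also have "\<dots> = B *\<^sub>v (A *\<^sub>v v)" using A B(1) that by (intro assoc_mult_mat_vec) auto
      also have "\<dots> = 0\<^sub>v k" using that B by (intro eq_vecI) auto
      finally show ?thesis .
    qed
    have "lin_indpt (set (cols A))"
      using lin_depE[OF A _ dist] inj by metis
    then show "rank A = k" by (rule lin_indpt_full_rank[OF A dist])
  next
    assume "rank A = k"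
    then have ind: "lin_indpt (set (cols A))" by (rule full_rank_lin_indpt[OF A _ dist])
    have det: "det (A\<^sup>T * A) \<noteq> 0"
      by (rule gram_invertible[OF A]) (use lin_depI[OF A _ _ _ dist] ind in blast)
    have G: "A\<^sup>T * A \<in> carrier_mat k k" using A by auto
    define H where "H = (1 / det (A\<^sup>T * A)) \<cdot>\<^sub>m adj_mat (A\<^sup>T * A)"
    have H: "H \<in> carrier_mat k k" using adj_mat(1)[OF G] by (simp add: H_def)
    have "H * (A\<^sup>T * A) = (1 / det (A\<^sup>T * A)) \<cdot>\<^sub>m (adj_mat (A\<^sup>T * A) * (A\<^sup>T * A))"
      unfolding H_def by (rule mult_smult_assoc_mat[OF adj_mat(1)[OF G] G])
    also have "\<dots> = 1\<^sub>m k" unfolding adj_mat(3)[OF G] using det by (intro eq_matI) auto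
    finally have "(H * A\<^sup>T) * A = 1\<^sub>m k" using H A by (subst assoc_mult_mat[of _ k k _ p]) auto
    then show "has_left_inverse A"
      using A H unfolding has_left_inverse_def by (intro exI[of _ "H * A\<^sup>T"]) auto
  qed
qed

definition permutation_matrix :: "nat \<Rightarrow> (nat \<Rightarrow> nat) \<Rightarrow> real mat" where
  "permutation_matrix k \<rho> = mat k k (\<lambda>(i, j). if i = \<rho> j then 1 else 0)"

lemma permutation_matrix_unit_vec:
  assumes "j < k"
  shows "permutation_matrix k \<rho> *\<^sub>v unit_vec k j = unit_vec k (\<rho> j)"
proof (rule eq_vecI)
  fix i assume "i < dim_vec (unit_vec k (\<rho> j) :: real Matrix.vec)"
  then have i: "i < k" by simp
  have "(permutation_matrix k \<rho> *\<^sub>v unit_vec k j) $ i = (\<Sum>l<k. (if i = \<rho> l then 1 else 0) * (if l = j then 1 else 0))"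
    using i assms by (simp add: permutation_matrix_def scalar_prod_def atLeast0LessThan)
  also have "\<dots> = (\<Sum>l<k. if l = j then if i = \<rho> l then 1 else 0 else 0)"
    by (intro sum.cong) auto
  also have "\<dots> = unit_vec k (\<rho> j) $ i"
    using i assms by (simp add: unit_vec_def)
  finally show "(permutation_matrix k \<rho> *\<^sub>v unit_vec k j) $ i = unit_vec k (\<rho> j) $ i" .
qed (simp add: permutation_matrix_def)

lemma mult_permutation_diag:
  fixes A1 A2 :: "real mat"
  assumes A1: "A1 \<in> carrier_mat p k" and A2: "A2 \<in> carrier_mat p k" and \<rho>: "\<And>j. j < k \<Longrightarrow> \<rho> j < k"
    and cols: "\<And>j. j < k \<Longrightarrow> col A2 j = lam j \<cdot>\<^sub>v col A1 (\<rho> j)"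
  shows "A2 = A1 * permutation_matrix k \<rho> * mat_diag k lam"
proof (rule eq_matI)
  have P: "permutation_matrix k \<rho> \<in> carrier_mat k k" by (simp add: permutation_matrix_def)
  show "dim_row A2 = dim_row (A1 * permutation_matrix k \<rho> * mat_diag k lam)"
    "dim_col A2 = dim_col (A1 * permutation_matrix k \<rho> * mat_diag k lam)" using A1 A2 by (auto simp: mat_diag_def)
  fix i j assume "i < dim_row (A1 * permutation_matrix k \<rho> * mat_diag k lam)" "j < dim_col (A1 * permutation_matrix k \<rho> * mat_diag k lam)"
  then have ij: "i < p" "j < k" using A1 by (auto simp: mat_diag_def)
  have "(A1 * permutation_matrix k \<rho>) $$ (i, j) = (\<Sum>l<k. A1 $$ (i, l) * (if l = \<rho> j then 1 else 0))"
    using ij A1 by (simp add: permutation_matrix_def scalar_prod_def atLeast0LessThan)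
  also have "\<dots> = A1 $$ (i, \<rho> j)" using \<rho>[OF ij(2)] by (simp add: if_distrib cong: if_cong)
  finally have "(A1 * permutation_matrix k \<rho> * mat_diag k lam) $$ (i, j) = A1 $$ (i, \<rho> j) * lam j"
    using ij A1 P by (simp add: mat_diag_mult_right[of _ p])
  also have "\<dots> = A2 $$ (i, j)"
    using arg_cong[OF cols[OF ij(2)], of "\<lambda>v. v $ i"] ij A1 A2 \<rho>[OF ij(2)] by simp
  finally show "A2 $$ (i, j) = (A1 * permutation_matrix k \<rho> * mat_diag k lam) $$ (i, j)" ..
qed

lemma invertible_mat_diag:
  fixes lam :: "nat \<Rightarrow> real"
  assumes "\<And>j. j < k \<Longrightarrow> lam j \<noteq> 0"
  shows "invertible_mat (mat_diag k lam)"
proof -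
  have "mat_diag k lam * mat_diag k (\<lambda>j. 1 / lam j) = 1\<^sub>m k" "mat_diag k (\<lambda>j. 1 / lam j) * mat_diag k lam = 1\<^sub>m k"
    unfolding mat_diag_diag mat_diag_one[symmetric] using assms by (auto simp: mat_diag_def intro!: cong_mat)
  then show ?thesis unfolding invertible_mat_def inverts_mat_def
    by (auto intro!: exI[of _ "mat_diag k (\<lambda>j. 1 / lam j)"] simp: mat_diag_def)
qed

section \<open>Characteristic functions of representations\<close>

context prob_space begin

lemma indep_var_measurable_pair:
  assumes "indep_var N1 X N2 Y" "f \<in> N1 \<rightarrow>\<^sub>M borel" "g \<in> N2 \<rightarrow>\<^sub>M borel"
  shows "indep_var borel (\<lambda>\<omega>. f (X \<omega>)) borel (\<lambda>\<omega>. g (Y \<omega>))"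
  using indep_var_compose[OF assms] by (simp add: comp_def)

lemma char_rv_scale: "char_rv M (\<lambda>\<omega>. c * Y \<omega>) t = char_rv M Y (t * c)" if "Y \<in> borel_measurable M"
  using that by (simp add: char_rv_def char_def integral_distr mult.assoc)

lemma char_rv_shift: "char_rv M (\<lambda>\<omega>. Y \<omega> + c) t = char_rv M Y t * iexp (t * c)" if "Y \<in> borel_measurable M"
  using that by (simp add: char_rv_def char_def integral_distr distrib_left exp_add)

lemma char_rv_add: "indep_var borel X borel Y \<Longrightarrow> char_rv M (\<lambda>\<omega>. X \<omega> + Y \<omega>) t = char_rv M X t * char_rv M Y t"
  unfolding char_rv_def by (rule char_distr_add)

lemma continuous_char_rv: "Y \<in> borel_measurable M \<Longrightarrow> continuous_on UNIV (char_rv M Y)"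
  unfolding char_rv_def
  by (intro continuous_at_imp_continuous_on ballI real_distribution.isCont_char) simp

lemma char_rv_0: "Y \<in> borel_measurable M \<Longrightarrow> char_rv M Y 0 = 1"
  unfolding char_rv_def by (rule real_distribution.char_zero) simp

lemma measurable_scalar_prod_borel_vec:
  assumes "t \<in> carrier_vec n"
  shows "(\<lambda>v. t \<bullet> v) \<in> borel_measurable (borel_vec n)"
proof -
  have id: "\<forall>i<n. (\<lambda>v. v $ i) \<in> borel_measurable (borel_vec n)"
    using measurable_borel_vec_iff[of "\<lambda>v. v" "borel_vec n" n] by simp
  have "(\<lambda>v. \<Sum>i<n. t $ i * v $ i) \<in> borel_measurable (borel_vec n)"
    using id by (intro borel_measurable_sum borel_measurable_times) auto
  moreover have "t \<bullet> v = (\<Sum>i<n. t $ i * v $ i)" if "v \<in> space (borel_vec n)" for v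
    using that by (simp add: borel_vec_def scalar_prod_def atLeast0LessThan)
  ultimately show ?thesis by (simp cong: measurable_cong)
qed

lemma char_representation:
  assumes rep: "linear_gaussian_representation M p X k A Z E m S" and X: "X \<in> M \<rightarrow>\<^sub>M borel_vec p"
    and t: "t \<in> carrier_vec p"
  shows "char_vec M X t = (\<Prod>j<k. char_rv M (\<lambda>\<omega>. Z \<omega> $ j) (col A j \<bullet> t)) * exp (\<i> * of_real (t \<bullet> m) - of_real (t \<bullet> (S *\<^sub>v t)) / 2)"
proof -
  have A: "A \<in> carrier_mat p k" and E: "E \<in> M \<rightarrow>\<^sub>M borel_vec p" and Z: "Z \<in> M \<rightarrow>\<^sub>M borel_vec k"
    and AE: "AE \<omega> in M. A *\<^sub>v Z \<omega> + E \<omega> = X \<omega>" and ind: "indep_vars (\<lambda>_. borel) (\<lambda>j \<omega>. Z \<omega> $ j) {..<k}"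
    and indE: "indep_var (borel_vec p) E (borel_vec k) Z"
    and chE: "char_vec M E t = exp (\<i> * of_real (t \<bullet> m) - of_real (t \<bullet> (S *\<^sub>v t)) / 2)"
    using rep t unfolding linear_gaussian_representation_def gaussian_vec_def by auto
  define w where "w = A\<^sup>T *\<^sub>v t"
  have w: "w \<in> carrier_vec k" using A t by (simp add: w_def)
  have wj: "w $ j = col A j \<bullet> t" if "j < k" for j using that A t by (simp add: w_def)
  have [measurable]: "(\<lambda>\<omega>. t \<bullet> E \<omega>) \<in> borel_measurable M" "(\<lambda>\<omega>. w \<bullet> Z \<omega>) \<in> borel_measurable M"
    "(\<lambda>\<omega>. t \<bullet> X \<omega>) \<in> borel_measurable M"
    using measurable_compose[OF E measurable_scalar_prod_borel_vec[OF t]]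
      measurable_compose[OF Z measurable_scalar_prod_borel_vec[OF w]]
      measurable_compose[OF X measurable_scalar_prod_borel_vec[OF t]] by auto
  have Zj: "(\<lambda>\<omega>. Z \<omega> $ j) \<in> borel_measurable M" if "j < k" for j
    using Z that unfolding measurable_borel_vec_iff by blast
  have Zc: "Z \<omega> \<in> carrier_vec k" "E \<omega> \<in> carrier_vec p" if "\<omega> \<in> space M" for \<omega>
    using Z E that unfolding measurable_borel_vec_iff by blast+
  have cv: "char_vec M Y t = char_rv M (\<lambda>\<omega>. t \<bullet> Y \<omega>) 1" if "(\<lambda>\<omega>. t \<bullet> Y \<omega>) \<in> borel_measurable M" for Y
    using that by (simp add: char_vec_def char_rv_def char_def integral_distr)
  have "char_vec M X t = char_rv M (\<lambda>\<omega>. t \<bullet> X \<omega>) 1" by (rule cv) measurable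
  also have "\<dots> = char_rv M (\<lambda>\<omega>. t \<bullet> E \<omega> + w \<bullet> Z \<omega>) 1"
  proof -
    have "AE \<omega> in M. t \<bullet> X \<omega> = t \<bullet> E \<omega> + w \<bullet> Z \<omega>"
      using AE AE_space
    proof eventually_elim
      case (elim \<omega>)
      have "t \<bullet> X \<omega> = t \<bullet> (A *\<^sub>v Z \<omega>) + t \<bullet> E \<omega>"
        unfolding elim(1)[symmetric] using A t Zc[OF elim(2)] by (intro scalar_prod_add_distrib[of _ p]) auto
      also have "t \<bullet> (A *\<^sub>v Z \<omega>) = w \<bullet> Z \<omega>"
        unfolding w_def using transpose_vec_mult_scalar[OF A _ t] Zc[OF elim(2)] by simp
      finally show ?case by simp
    qed
    then have "distr M borel (\<lambda>\<omega>. t \<bullet> X \<omega>) = distr M borel (\<lambda>\<omega>. t \<bullet> E \<omega> + w \<bullet> Z \<omega>)"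
      by (intro distr_cong_AE) auto
    then show ?thesis by (simp add: char_rv_def)
  qed
  also have "\<dots> = char_rv M (\<lambda>\<omega>. t \<bullet> E \<omega>) 1 * char_rv M (\<lambda>\<omega>. w \<bullet> Z \<omega>) 1"
    by (intro char_rv_add indep_var_measurable_pair[OF indE] measurable_scalar_prod_borel_vec t w)
  also have "char_rv M (\<lambda>\<omega>. t \<bullet> E \<omega>) 1 = char_vec M E t" by (rule cv[symmetric]) measurable
  also have "char_rv M (\<lambda>\<omega>. w \<bullet> Z \<omega>) 1 = char_rv M (\<lambda>\<omega>. \<Sum>j<k. w $ j * Z \<omega> $ j) 1"
    using Zc w unfolding char_rv_def by (intro arg_cong[of _ _ "\<lambda>D. char D 1"] distr_cong) (auto simp: scalar_prod_def atLeast0LessThan dest!: Zc(1)[THEN carrier_vecD])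
  also have "\<dots> = (\<Prod>j<k. char_rv M (\<lambda>\<omega>. w $ j * Z \<omega> $ j) 1)"
    unfolding char_rv_def by (intro char_distr_sum indep_vars_compose2[OF ind]) auto
  also have "\<dots> = (\<Prod>j<k. char_rv M (\<lambda>\<omega>. Z \<omega> $ j) (col A j \<bullet> t))"
    using Zj by (intro prod.cong) (auto simp: char_rv_scale wj)
  finally show ?thesis using chE by (simp add: mult.commute)
qed

end

lemma degree_add_const: "degree (g + [:c:]) = degree g" for g :: "complex poly"
  by (cases "degree g = 0") (auto elim!: degree_eq_zeroE intro: degree_add_eq_left)

lemma pderiv2_add_const: "pderiv (pderiv (g + [:c:])) = pderiv (pderiv g)" for g :: "complex poly"
  by (simp add: pderiv_add)

section \<open>Uniqueness of the exponent\<close>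

context prob_space begin

lemma distr_eq_if_char_rv_eq:
  assumes "X \<in> borel_measurable M" "Y \<in> borel_measurable M" "\<And>t. char_rv M X t = char_rv M Y t"
  shows "distr M borel X = distr M borel Y"
  using assms unfolding char_rv_def by (intro Levy_uniqueness) auto

lemma AE_zero_if_gaussian_variance_0:
  assumes "gaussian_rv M G 0 0"
  shows "AE \<omega> in M. G \<omega> = 0"
proof -
  have [measurable]: "G \<in> borel_measurable M" using assms by (simp add: gaussian_rv_def)
  have "distr M borel G = distr M borel (\<lambda>_. 0)"
    using assms by (intro distr_eq_if_char_rv_eq) (auto simp: gaussian_rv_def char_rv_def char_def integral_distr prob_space simp del: distr_const)
  moreover have "AE x in distr M borel (\<lambda>_. 0 :: real). x = 0"
    by (subst AE_distr_iff) auto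
  ultimately have "AE x in distr M borel G. x = 0" by (simp only:)
  then show ?thesis by (subst (asm) AE_distr_iff) auto
qed

text \<open>
  An almost surely constant variable is independent of everything, as its events have probability
  \<open>0\<close> or \<open>1\<close>.
\<close>

lemma indep_var_AE_zero:
  fixes G Y :: "'a \<Rightarrow> real"
  assumes [measurable]: "G \<in> borel_measurable M" "Y \<in> borel_measurable M" and AE: "AE \<omega> in M. G \<omega> = 0"
  shows "indep_var borel G borel Y"
  unfolding indep_var_eq
proof (intro conjI indep_set_sigma_sets)
  show "indep_set {G -` A \<inter> space M |A. A \<in> sets borel} {Y -` A \<inter> space M |A. A \<in> sets borel}"
  proof (rule indep_setI; safe?)
    fix A B :: "real set" assume [measurable]: "A \<in> sets borel" "B \<in> sets borel"
    show "prob ((G -` A \<inter> space M) \<inter> (Y -` B \<inter> space M)) = prob (G -` A \<inter> space M) * prob (Y -` B \<inter> space M)"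
    proof (cases "0 \<in> A")
      case True
      have "prob (G -` A \<inter> space M) = prob (space M)"
        using AE True by (intro finite_measure_eq_AE) (auto elim!: eventually_mono)
      moreover have "prob ((G -` A \<inter> space M) \<inter> (Y -` B \<inter> space M)) = prob (Y -` B \<inter> space M)"
        using AE True by (intro finite_measure_eq_AE) (auto elim!: eventually_mono)
      ultimately show ?thesis by (simp add: prob_space)
    next
      case False
      have "prob (G -` A \<inter> space M) = prob {}"
        using AE False by (intro finite_measure_eq_AE) (auto elim!: eventually_mono)
      moreover have "prob ((G -` A \<inter> space M) \<inter> (Y -` B \<inter> space M)) = prob {}"
        using AE False by (intro finite_measure_eq_AE) (auto elim!: eventually_mono)
      ultimately show ?thesis by simp
    qed
  qed auto
  have "Int_stable {f -` A \<inter> space M |A. A \<in> sets borel}" for f :: "'a \<Rightarrow> real"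
    unfolding Int_stable_def
  proof safe
    fix A B :: "real set" assume "A \<in> sets borel" "B \<in> sets borel"
    then show "\<exists>C. f -` A \<inter> space M \<inter> (f -` B \<inter> space M) = f -` C \<inter> space M \<and> C \<in> sets borel"
      by (intro exI[of _ "A \<inter> B"]) auto
  qed
  then show "Int_stable {G -` A \<inter> space M |A. A \<in> sets borel}" "Int_stable {Y -` A \<inter> space M |A. A \<in> sets borel}"
    by blast+
qed auto

lemma char_rv_nonzero_near_0:
  assumes "Y \<in> borel_measurable M"
  shows "eventually (\<lambda>t. char_rv M Y t \<noteq> 0) (nhds 0)"
proof -
  have "isCont (char_rv M Y) 0" using continuous_char_rv[OF assms] by (simp add: continuous_on_eq_continuous_at)
  then have "(char_rv M Y \<longlongrightarrow> char_rv M Y 0) (nhds 0)" by (simp add: isCont_def tendsto_at_iff_tendsto_nhds)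
  then show ?thesis by (rule tendsto_imp_eventually_ne) (simp add: char_rv_0[OF assms])
qed

text \<open>
  Two exponents differ near the origin by a function with values in \<open>2 pi \<i> \<int>\<close>, as the characteristic functions
  do not vanish there. The difference is continuous, hence constant near the origin, and it is a polynomial,
  hence constant.
\<close>

lemma char_related_unique:
  assumes U: "U \<in> borel_measurable M" and V: "V \<in> borel_measurable M" and g: "char_related M U l V g"
  shows "char_related M U l V h \<longleftrightarrow> (\<exists>n::int. h = g + [: 2 * of_real pi * \<i> * of_int n :])"
proof
  assume h: "char_related M U l V h"
  have "eventually (\<lambda>t. exp (poly (h - g) (of_real t)) = 1) (nhds (0::real))"
    using g[unfolded char_related_def] h[unfolded char_related_def] char_rv_nonzero_near_0[OF V]
    by eventually_elim (simp add: exp_diff)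
  moreover have "((\<lambda>t::real. poly (h - g) (of_real t)) \<longlongrightarrow> poly (h - g) (of_real 0)) (nhds 0)"
    by (intro tendsto_intros filterlim_ident)
  then have "((\<lambda>t::real. cmod (poly (h - g) (of_real t) - poly (h - g) 0)) \<longlongrightarrow> 0) (nhds 0)"
    by (intro tendsto_norm_zero) (simp add: LIM_zero_iff tendsto_diff[where b="poly (h - g) 0", OF _ tendsto_const, simplified] flip: Lim_null)
  then have "eventually (\<lambda>t::real. cmod (poly (h - g) (of_real t) - poly (h - g) 0) < 2 * pi) (nhds 0)"
    by (rule order_tendstoD) simp
  ultimately have ev: "eventually (\<lambda>t::real. exp (poly (h - g) (of_real t)) = 1 \<and> cmod (poly (h - g) (of_real t) - poly (h - g) 0) < 2 * pi) (nhds 0)"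
    by eventually_elim simp
  then obtain d where d: "d > 0" "\<And>t. \<bar>t\<bar> < d \<Longrightarrow> exp (poly (h - g) (of_real t)) = 1 \<and> cmod (poly (h - g) (of_real t) - poly (h - g) 0) < 2 * pi"
    unfolding eventually_nhds_metric by (auto simp: dist_norm)
  have e0: "exp (poly (h - g) 0) = 1" using d(2)[of 0] d(1) by simp
  have const: "poly (h - g) (of_real t) = poly (h - g) 0" if t: "\<bar>t\<bar> < d" for t :: real
  proof -
    have "exp (poly (h - g) (of_real t) - poly (h - g) 0) = 1" using d(2)[OF t] e0 by (simp only: exp_diff) simp
    from exp_eq_1_small[OF this] d(2)[OF t] show ?thesis by simp
  qed
  have "h - g = [: poly (h - g) 0 :]"
  proof (rule ccontr)
    assume "h - g \<noteq> [: poly (h - g) 0 :]"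
    then have "finite {z. poly (h - g - [: poly (h - g) 0 :]) z = 0}" by (intro poly_roots_finite) simp
    moreover have "of_real ` {-d<..<d} \<subseteq> {z. poly (h - g - [: poly (h - g) 0 :]) z = 0}"
      using const by auto
    ultimately have "finite (complex_of_real ` {-d<..<d})" by (rule rev_finite_subset)
    then have "finite {-d<..<d}" by (rule finite_imageD) (auto simp: inj_on_def)
    then show False using d(1) by (simp add: infinite_Ioo)
  qed
  moreover from e0 obtain n :: int where "Re (poly (h - g) 0) = 0" "Im (poly (h - g) 0) = of_int (2 * n) * pi"
    by (auto simp: exp_eq_1)
  then have "poly (h - g) 0 = 2 * of_real pi * \<i> * of_int n" by (simp add: complex_eq_iff)
  ultimately show "\<exists>n::int. h = g + [: 2 * of_real pi * \<i> * of_int n :]" by (metis add_diff_cancel_left' diff_add_cancel add.commute)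
next
  assume "\<exists>n::int. h = g + [: 2 * of_real pi * \<i> * of_int n :]"
  then obtain n :: int where h: "h = g + [: 2 * of_real pi * \<i> * of_int n :]" by blast
  have "exp (2 * of_real pi * \<i> * of_int n) = (1 :: complex)"
    using exp_two_pi_i by (simp add: exp_eq_1)
  then have "exp (poly h z) = exp (poly g z)" for z by (simp add: h exp_add)
  then show "char_related M U l V h" using g by (simp add: char_related_def)
qed

end

section \<open>Gaussian noise\<close>

context prob_space begin

text \<open>
  In this lemma and the next one, the global relation between the characteristic functions has the same quadratic
  exponent as centred Gaussian noise of variance \<open>\<bar>c\<bar>\<close>; the linear part is a shift by \<open>d\<close>. The sign of \<open>c\<close>
  decides on which side the noise goes.
\<close>

lemma noise_on_firstI:
  assumes U [measurable]: "U \<in> borel_measurable M" and V [measurable]: "V \<in> borel_measurable M"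
    and rel: "\<And>s. char_rv M U (l * s) = char_rv M V s * exp (\<i> * of_real (d * s) + of_real (c * s\<^sup>2 / 2))"
    and G: "gaussian_rv M G 0 (\<sigma>\<^sup>2)" "indep_var borel G borel V" and \<sigma>: "\<sigma>\<^sup>2 = - c"
  shows "noise_on_first M U l V (- d) \<sigma> G"
proof -
  have [measurable]: "G \<in> borel_measurable M" using G by (simp add: gaussian_rv_def)
  have "char_rv M (\<lambda>\<omega>. l * U \<omega> + - d) s = char_rv M (\<lambda>\<omega>. V \<omega> + G \<omega>) s" for s
  proof -
    have "char_rv M (\<lambda>\<omega>. l * U \<omega> + - d) s = char_rv M (\<lambda>\<omega>. l * U \<omega>) s * iexp (s * - d)"
      by (rule char_rv_shift) measurable
    also have "char_rv M (\<lambda>\<omega>. l * U \<omega>) s = char_rv M V s * exp (\<i> * of_real (d * s) + of_real (c * s\<^sup>2 / 2))"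
      by (simp only: char_rv_scale[OF U] rel[symmetric] mult.commute[of s l])
    also have "\<dots> * iexp (s * - d) = char_rv M V s * exp (of_real (c * s\<^sup>2 / 2))"
      unfolding mult.assoc by (simp add: mult_exp_exp mult.commute mult.left_commute)
    also have "exp (of_real (c * s\<^sup>2 / 2)) = char_rv M G s"
      using G \<sigma> by (simp add: gaussian_rv_def)
    also have "char_rv M V s * char_rv M G s = char_rv M (\<lambda>\<omega>. G \<omega> + V \<omega>) s"
      using G(2) by (simp add: char_rv_add mult.commute)
    finally show ?thesis by (simp add: add.commute)
  qed
  then have "distr M borel (\<lambda>\<omega>. l * U \<omega> + - d) = distr M borel (\<lambda>\<omega>. V \<omega> + G \<omega>)"
    by (intro distr_eq_if_char_rv_eq) measurable
  then show ?thesis using G unfolding noise_on_first_def by auto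
qed

lemma noise_on_secondI:
  assumes U [measurable]: "U \<in> borel_measurable M" and V [measurable]: "V \<in> borel_measurable M"
    and rel: "\<And>s. char_rv M U (l * s) = char_rv M V s * exp (\<i> * of_real (d * s) + of_real (c * s\<^sup>2 / 2))"
    and G: "gaussian_rv M G 0 (\<sigma>\<^sup>2)" "indep_var borel G borel U" and \<sigma>: "\<sigma>\<^sup>2 = c"
  shows "noise_on_second M U l V (- d) \<sigma> G"
proof -
  have [measurable]: "G \<in> borel_measurable M" using G by (simp add: gaussian_rv_def)
  have "char_rv M V s = char_rv M (\<lambda>\<omega>. (l * U \<omega> + - d) + G \<omega>) s" for s
  proof -
    have ind: "indep_var borel G borel (\<lambda>\<omega>. l * U \<omega> + - d)"
      using indep_var_measurable_pair[OF G(2), of "\<lambda>x. x" "\<lambda>x. l * x + - d"] by simp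
    have "char_rv M (\<lambda>\<omega>. (l * U \<omega> + - d) + G \<omega>) s = char_rv M (\<lambda>\<omega>. l * U \<omega> + - d) s * char_rv M G s"
      using char_rv_add[OF ind, of s] by (simp add: add.commute mult.commute)
    also have "char_rv M (\<lambda>\<omega>. l * U \<omega> + - d) s = char_rv M (\<lambda>\<omega>. l * U \<omega>) s * iexp (s * - d)"
      by (rule char_rv_shift) measurable
    also have "char_rv M (\<lambda>\<omega>. l * U \<omega>) s = char_rv M V s * exp (\<i> * of_real (d * s) + of_real (c * s\<^sup>2 / 2))"
      by (simp only: char_rv_scale[OF U] rel[symmetric] mult.commute[of s l])
    also have "\<dots> * iexp (s * - d) = char_rv M V s * exp (of_real (c * s\<^sup>2 / 2))"
      unfolding mult.assoc by (simp add: mult_exp_exp mult.commute mult.left_commute)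
    also have "char_rv M G s = exp (- of_real (c * s\<^sup>2 / 2))"
      using G \<sigma> by (simp add: gaussian_rv_def)
    also have "char_rv M V s * exp (of_real (c * s\<^sup>2 / 2)) * exp (- of_real (c * s\<^sup>2 / 2)) = char_rv M V s"
      by (simp add: exp_minus)
    finally show ?thesis ..
  qed
  then have "distr M borel V = distr M borel (\<lambda>\<omega>. (l * U \<omega> + - d) + G \<omega>)"
    by (intro distr_eq_if_char_rv_eq) measurable
  then show ?thesis using G unfolding noise_on_second_def by auto
qed

text \<open>
  The linear part of the exponent and the shift only contribute factors of modulus \<open>1\<close>. At a point
  \<open>s \<noteq> 0\<close> where \<open>\<phi>\<^sub>V\<close> does not vanish, the moduli of both sides give the quadratic coefficient.
\<close>

lemma variance_from_modulus:
  assumes V: "V \<in> borel_measurable M"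
    and eq: "\<And>s. char_rv M V s * exp (\<i> * of_real (d * s) + of_real (c * s\<^sup>2 / 2)) * iexp (s * \<nu>) = char_rv M V s * exp (of_real (c' * s\<^sup>2 / 2))"
  shows "c = c'"
proof -
  obtain e where e: "e > 0" "\<And>s. \<bar>s\<bar> < e \<Longrightarrow> char_rv M V s \<noteq> 0"
    using char_rv_nonzero_near_0[OF V] unfolding eventually_nhds_metric by (auto simp: dist_norm)
  define s where "s = e / 2"
  have s: "char_rv M V s \<noteq> 0" "s \<noteq> 0" using e by (auto simp: s_def)
  have "cmod (exp (\<i> * of_real (d * s) + of_real (c * s\<^sup>2 / 2)) * iexp (s * \<nu>)) = cmod (exp (of_real (c' * s\<^sup>2 / 2)))"
    using eq[of s] s by (simp add: mult.assoc)
  then have "exp (c * s\<^sup>2 / 2) = exp (c' * s\<^sup>2 / 2)"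
    by (simp add: norm_mult)
  then show ?thesis using s by simp
qed

text \<open>
  The converse direction: the relation determines the variance of the noise. Noise on the first side forces
  \<open>c \<le> 0\<close>, noise on the second side \<open>c \<ge> 0\<close>; so they exclude each other unless \<open>c = 0\<close>.
\<close>

lemma noise_on_first_variance:
  assumes U [measurable]: "U \<in> borel_measurable M" and V [measurable]: "V \<in> borel_measurable M"
    and rel: "\<And>s. char_rv M U (l * s) = char_rv M V s * exp (\<i> * of_real (d * s) + of_real (c * s\<^sup>2 / 2))"
    and N: "noise_on_first M U l V \<nu> \<sigma> G"
  shows "\<sigma>\<^sup>2 = - c"
proof -
  have G: "gaussian_rv M G 0 (\<sigma>\<^sup>2)" "indep_var borel G borel V"
    and D: "distr M borel (\<lambda>\<omega>. l * U \<omega> + \<nu>) = distr M borel (\<lambda>\<omega>. V \<omega> + G \<omega>)"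
    using N by (auto simp: noise_on_first_def)
  have "c = - \<sigma>\<^sup>2"
  proof (rule variance_from_modulus[OF V])
    fix s
    have "char_rv M (\<lambda>\<omega>. l * U \<omega> + \<nu>) s = char_rv M (\<lambda>\<omega>. l * U \<omega>) s * iexp (s * \<nu>)"
      by (rule char_rv_shift) measurable
    also have "char_rv M (\<lambda>\<omega>. l * U \<omega>) s = char_rv M V s * exp (\<i> * of_real (d * s) + of_real (c * s\<^sup>2 / 2))"
      by (simp only: char_rv_scale[OF U] rel[symmetric] mult.commute[of s l])
    also have "char_rv M (\<lambda>\<omega>. l * U \<omega> + \<nu>) s = char_rv M (\<lambda>\<omega>. G \<omega> + V \<omega>) s"
      unfolding char_rv_def D by (simp add: add.commute)
    also have "\<dots> = char_rv M G s * char_rv M V s" by (rule char_rv_add[OF G(2)])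
    also have "char_rv M G s = exp (of_real (- \<sigma>\<^sup>2 * s\<^sup>2 / 2))" using G(1) by (simp add: gaussian_rv_def)
    finally show "char_rv M V s * exp (\<i> * of_real (d * s) + of_real (c * s\<^sup>2 / 2)) * iexp (s * \<nu>) =
        char_rv M V s * exp (of_real (- \<sigma>\<^sup>2 * s\<^sup>2 / 2))" by (subst eq_commute) (simp add: mult.commute)
  qed
  then show ?thesis by simp
qed

lemma noise_on_second_variance:
  assumes U [measurable]: "U \<in> borel_measurable M" and V [measurable]: "V \<in> borel_measurable M"
    and rel: "\<And>s. char_rv M U (l * s) = char_rv M V s * exp (\<i> * of_real (d * s) + of_real (c * s\<^sup>2 / 2))"
    and N: "noise_on_second M U l V \<nu> \<sigma> G"
  shows "\<sigma>\<^sup>2 = c"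
proof -
  have G: "gaussian_rv M G 0 (\<sigma>\<^sup>2)" "indep_var borel G borel U"
    and D: "distr M borel V = distr M borel (\<lambda>\<omega>. (l * U \<omega> + \<nu>) + G \<omega>)"
    using N by (auto simp: noise_on_second_def)
  have ind: "indep_var borel G borel (\<lambda>\<omega>. l * U \<omega> + \<nu>)"
    using indep_var_measurable_pair[OF G(2), of "\<lambda>x. x" "\<lambda>x. l * x + \<nu>"] by simp
  have "c = \<sigma>\<^sup>2"
  proof (rule variance_from_modulus[OF V])
    fix s
    have "char_rv M (\<lambda>\<omega>. l * U \<omega> + \<nu>) s = char_rv M (\<lambda>\<omega>. l * U \<omega>) s * iexp (s * \<nu>)"
      by (rule char_rv_shift) measurable
    also have "char_rv M (\<lambda>\<omega>. l * U \<omega>) s = char_rv M V s * exp (\<i> * of_real (d * s) + of_real (c * s\<^sup>2 / 2))"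
      by (simp only: char_rv_scale[OF U] rel[symmetric] mult.commute[of s l])
    finally have 1: "char_rv M (\<lambda>\<omega>. l * U \<omega> + \<nu>) s = char_rv M V s * exp (\<i> * of_real (d * s) + of_real (c * s\<^sup>2 / 2)) * iexp (s * \<nu>)" .
    have "char_rv M V s = char_rv M (\<lambda>\<omega>. G \<omega> + (l * U \<omega> + \<nu>)) s"
      unfolding char_rv_def D by (simp add: add.commute)
    also have "\<dots> = char_rv M G s * char_rv M (\<lambda>\<omega>. l * U \<omega> + \<nu>) s" by (rule char_rv_add[OF ind])
    also have "char_rv M G s = exp (- of_real (\<sigma>\<^sup>2 * s\<^sup>2 / 2))" using G(1) by (simp add: gaussian_rv_def)
    finally have 2: "char_rv M V s * exp (of_real (\<sigma>\<^sup>2 * s\<^sup>2 / 2)) = char_rv M (\<lambda>\<omega>. l * U \<omega> + \<nu>) s"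
      by (simp add: exp_minus)
    show "char_rv M V s * exp (\<i> * of_real (d * s) + of_real (c * s\<^sup>2 / 2)) * iexp (s * \<nu>) =
        char_rv M V s * exp (of_real (\<sigma>\<^sup>2 * s\<^sup>2 / 2))" by (simp only: 1[symmetric] 2)
  qed
  then show ?thesis by simp
qed

lemma noise_on_first_iff_second_if_zero:
  assumes U [measurable]: "U \<in> borel_measurable M" and V [measurable]: "V \<in> borel_measurable M"
    and AE: "AE \<omega> in M. G \<omega> = 0"
  shows "noise_on_first M U l V \<nu> \<sigma> G \<longleftrightarrow> noise_on_second M U l V \<nu> \<sigma> G"
proof (cases "G \<in> borel_measurable M")
  case [measurable]: True
  have "distr M borel (\<lambda>\<omega>. V \<omega> + G \<omega>) = distr M borel V"
    using AE by (intro distr_cong_AE) (auto elim!: eventually_mono)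
  moreover have "distr M borel (\<lambda>\<omega>. (l * U \<omega> + \<nu>) + G \<omega>) = distr M borel (\<lambda>\<omega>. l * U \<omega> + \<nu>)"
    using AE by (intro distr_cong_AE) (auto elim!: eventually_mono)
  ultimately show ?thesis
    using indep_var_AE_zero[OF True U AE] indep_var_AE_zero[OF True V AE]
    unfolding noise_on_first_def noise_on_second_def by auto
qed (auto simp: noise_on_first_def noise_on_second_def gaussian_rv_def)

lemma gaussian_rv_scaled_projection:
  assumes E: "gaussian_vec M p E m S" and t: "t \<in> carrier_vec p"
  shows "gaussian_rv M (\<lambda>\<omega>. r * (t \<bullet> E \<omega> - t \<bullet> m)) 0 (r\<^sup>2 * (t \<bullet> (S *\<^sub>v t)))"
proof -
  have E': "E \<in> M \<rightarrow>\<^sub>M borel_vec p" "m \<in> carrier_vec p" "S \<in> carrier_mat p p"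
    and pos: "t \<bullet> (S *\<^sub>v t) \<ge> 0"
    and ch: "\<And>t. t \<in> carrier_vec p \<Longrightarrow> char_vec M E t = exp (\<i> * of_real (t \<bullet> m) - of_real (t \<bullet> (S *\<^sub>v t)) / 2)"
    using E t by (auto simp: gaussian_vec_def pos_semidef_def)
  have [measurable]: "(\<lambda>\<omega>. t \<bullet> E \<omega>) \<in> borel_measurable M"
    by (rule measurable_compose[OF E'(1) measurable_scalar_prod_borel_vec[OF t]])
  have Ec: "E \<omega> \<in> carrier_vec p" if "\<omega> \<in> space M" for \<omega>
    using E'(1) that unfolding measurable_borel_vec_iff by blast
  have "char_rv M (\<lambda>\<omega>. r * (t \<bullet> E \<omega> - t \<bullet> m)) s = exp (- of_real (r\<^sup>2 * (t \<bullet> (S *\<^sub>v t)) * s\<^sup>2 / 2))" for s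
  proof -
    have "char_rv M (\<lambda>\<omega>. r * (t \<bullet> E \<omega> - t \<bullet> m)) s = char_rv M (\<lambda>\<omega>. t \<bullet> E \<omega> + - (t \<bullet> m)) (s * r)"
      using char_rv_scale[of "\<lambda>\<omega>. t \<bullet> E \<omega> - t \<bullet> m" r s] by simp
    also have "\<dots> = char_rv M (\<lambda>\<omega>. t \<bullet> E \<omega>) (s * r) * iexp (s * r * - (t \<bullet> m))"
      by (rule char_rv_shift) measurable
    also have "char_rv M (\<lambda>\<omega>. t \<bullet> E \<omega>) (s * r) = char_vec M E ((s * r) \<cdot>\<^sub>v t)"
      using Ec t by (simp add: char_rv_def char_def char_vec_def integral_distr cong: Bochner_Integration.integral_cong)
    also have "\<dots> = exp (\<i> * of_real (s * r * (t \<bullet> m)) - of_real ((s * r)\<^sup>2 * (t \<bullet> (S *\<^sub>v t))) / 2)"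
      using t E' by (simp add: ch mult_mat_vec[of _ p p] power2_eq_square mult.assoc)
    also have "\<dots> * iexp (s * r * - (t \<bullet> m)) = exp (- of_real (r\<^sup>2 * (t \<bullet> (S *\<^sub>v t)) * s\<^sup>2 / 2))"
      by (simp add: power_mult_distrib mult.commute mult.left_commute flip: exp_add)
    finally show ?thesis .
  qed
  then show ?thesis using pos by (simp add: gaussian_rv_def)
qed

end

section \<open>Matching the columns of two representations\<close>

lemma bivariate_quadratic_gaussian_exponent:
  assumes "u \<in> carrier_vec p" "v \<in> carrier_vec p" "m \<in> carrier_vec p" "S \<in> carrier_mat p p"
    and "m' \<in> carrier_vec p" "S' \<in> carrier_mat p p"
  defines "w \<equiv> \<lambda>x y. x \<cdot>\<^sub>v u + y \<cdot>\<^sub>v v"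
  shows "bivariate_quadratic (\<lambda>x y. (\<i> * of_real (w x y \<bullet> m) - of_real (w x y \<bullet> (S *\<^sub>v w x y)) / 2)
      - (\<i> * of_real (w x y \<bullet> m') - of_real (w x y \<bullet> (S' *\<^sub>v w x y)) / 2))"
proof -
  have lin: "w x y \<bullet> n = x * (u \<bullet> n) + y * (v \<bullet> n)" if "n \<in> carrier_vec p" for n x y
    using assms that by (simp add: w_def add_scalar_prod_distrib[of _ p])
  have quad: "w x y \<bullet> (T *\<^sub>v w x y) = (u \<bullet> (T *\<^sub>v u)) * (x * x) + (u \<bullet> (T *\<^sub>v v) + v \<bullet> (T *\<^sub>v u)) * (x * y) + (v \<bullet> (T *\<^sub>v v)) * (y * y)"
    if T: "T \<in> carrier_mat p p" for T x y
  proof -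
    have "T *\<^sub>v w x y = x \<cdot>\<^sub>v (T *\<^sub>v u) + y \<cdot>\<^sub>v (T *\<^sub>v v)"
      using assms(1,2) T by (simp add: w_def mult_add_distrib_mat_vec[of _ p p] mult_mat_vec[of _ p p])
    then have "n \<bullet> (T *\<^sub>v w x y) = x * (n \<bullet> (T *\<^sub>v u)) + y * (n \<bullet> (T *\<^sub>v v))" if "n \<in> carrier_vec p" for n
      using assms(1,2) T that by (simp add: scalar_prod_add_distrib[of _ p])
    moreover have "T *\<^sub>v w x y \<in> carrier_vec p" using T assms(1,2) by (simp add: w_def)
    ultimately show ?thesis using assms(1,2) by (simp add: lin algebra_simps)
  qed
  show ?thesis
    unfolding bivariate_quadratic_def lin[OF assms(3)] lin[OF assms(5)] quad[OF assms(4)] quad[OF assms(6)]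
  proof (intro exI allI)
    fix x y :: real
    show "(\<i> * of_real (x * (u \<bullet> m) + y * (v \<bullet> m)) -
         of_real ((u \<bullet> (S *\<^sub>v u)) * (x * x) + (u \<bullet> (S *\<^sub>v v) + v \<bullet> (S *\<^sub>v u)) * (x * y) + (v \<bullet> (S *\<^sub>v v)) * (y * y)) / 2) -
        (\<i> * of_real (x * (u \<bullet> m') + y * (v \<bullet> m')) -
         of_real ((u \<bullet> (S' *\<^sub>v u)) * (x * x) + (u \<bullet> (S' *\<^sub>v v) + v \<bullet> (S' *\<^sub>v u)) * (x * y) + (v \<bullet> (S' *\<^sub>v v)) * (y * y)) / 2)
      = 0 + \<i> * of_real (u \<bullet> m - u \<bullet> m') * of_real x + \<i> * of_real (v \<bullet> m - v \<bullet> m') * of_real y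
        + of_real ((u \<bullet> (S' *\<^sub>v u) - u \<bullet> (S *\<^sub>v u)) / 2) * of_real (x * x)
        + of_real ((u \<bullet> (S' *\<^sub>v v) + v \<bullet> (S' *\<^sub>v u) - (u \<bullet> (S *\<^sub>v v) + v \<bullet> (S *\<^sub>v u))) / 2) * of_real (x * y)
        + of_real ((v \<bullet> (S' *\<^sub>v v) - v \<bullet> (S *\<^sub>v v)) / 2) * of_real (y * y)"
      by (simp add: complex_eq_iff field_simps)
  qed
qed

lemma eventually_scaled:
  fixes c :: real
  assumes "eventually P (nhds 0)"
  shows "eventually (\<lambda>t. P (c * t)) (nhds 0)"
proof -
  have "((\<lambda>t. c * t) \<longlongrightarrow> c * 0) (nhds 0)" by (intro tendsto_intros filterlim_ident)
  then show ?thesis using assms by (auto simp: filterlim_iff)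
qed

context prob_space begin

lemma not_non_gaussian_if_exp_poly:
  assumes Y: "Y \<in> borel_measurable M"
    and ev: "eventually (\<lambda>t. char_rv M Y t = exp (poly P (of_real t))) (nhds 0)"
  shows "\<not> non_gaussian M Y"
proof -
  interpret D: real_distribution "distr M borel Y" using Y by simp
  obtain m s where "s \<ge> 0" "\<forall>t. char (distr M borel Y) t = exp (\<i> * of_real (t * m) - of_real (s * t\<^sup>2) / 2)"
    using D.marcinkiewicz ev unfolding char_rv_def by blast
  then have "gaussian_rv M Y m s" using Y by (simp add: gaussian_rv_def char_rv_def)
  then show ?thesis by (auto simp: non_gaussian_def)
qed

text \<open>
  The core of the identification. Consider the slope \<open>b\<close> of column \<open>j\<close> of \<open>A2\<close> in a generic plane. As the columns
  of each matrix are pairwise non-proportional, at most one column of each matrix has this slope. If \<open>A1\<close> had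
  none, then \<open>\<phi>\<^bsub>Z2 j\<^esub>\<close> would be the exponential of a polynomial near the origin and \<open>Z2 j\<close> would be Gaussian.
\<close>

lemma representation_column_matched:
  assumes X: "X \<in> M \<rightarrow>\<^sub>M borel_vec p"
    and rep1: "linear_gaussian_representation M p X k1 A1 Z1 E1 m1 S1"
    and rep2: "linear_gaussian_representation M p X k2 A2 Z2 E2 m2 S2"
    and j: "j < k2"
  shows "\<exists>i<k1. \<exists>l g. l \<noteq> 0 \<and> col A2 j = l \<cdot>\<^sub>v col A1 i \<and> char_related M (\<lambda>\<omega>. Z2 \<omega> $ j) l (\<lambda>\<omega>. Z1 \<omega> $ i) g"
proof -
  have A1: "A1 \<in> carrier_mat p k1" and A2: "A2 \<in> carrier_mat p k2"
    and Z1: "\<And>i. i < k1 \<Longrightarrow> (\<lambda>\<omega>. Z1 \<omega> $ i) \<in> borel_measurable M" and Z2: "\<And>i. i < k2 \<Longrightarrow> (\<lambda>\<omega>. Z2 \<omega> $ i) \<in> borel_measurable M"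
    and nz1: "\<And>i. i < k1 \<Longrightarrow> col A1 i \<noteq> 0\<^sub>v p" and nz2: "\<And>i. i < k2 \<Longrightarrow> col A2 i \<noteq> 0\<^sub>v p"
    and np1: "\<And>i i'. i < k1 \<Longrightarrow> i' < k1 \<Longrightarrow> i \<noteq> i' \<Longrightarrow> \<not> proportional (col A1 i) (col A1 i')"
    and np2: "\<And>i i'. i < k2 \<Longrightarrow> i' < k2 \<Longrightarrow> i \<noteq> i' \<Longrightarrow> \<not> proportional (col A2 i) (col A2 i')"
    and ng: "\<And>i. i < k2 \<Longrightarrow> non_gaussian M (\<lambda>\<omega>. Z2 \<omega> $ i)"
    and mS: "m1 \<in> carrier_vec p" "S1 \<in> carrier_mat p p" "m2 \<in> carrier_vec p" "S2 \<in> carrier_mat p p"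
    using rep1 rep2 unfolding linear_gaussian_representation_def gaussian_vec_def pos_semidef_def measurable_borel_vec_iff
    by auto
  define V where "V = col A1 ` {..<k1} \<union> col A2 ` {..<k2}"
  have V: "finite V" "V \<subseteq> carrier_vec p" "0\<^sub>v p \<notin> V"
  proof -
    show "finite V" "V \<subseteq> carrier_vec p" using A1 A2 by (auto simp: V_def)
    show "0\<^sub>v p \<notin> V" using nz1 nz2 unfolding V_def by (metis Un_iff imageE lessThan_iff)
  qed
  obtain u v where u: "u \<in> carrier_vec p" and v: "v \<in> carrier_vec p" and nzV: "\<And>a. a \<in> V \<Longrightarrow> a \<bullet> u \<noteq> 0"
    and slope: "\<And>a b. a \<in> V \<Longrightarrow> b \<in> V \<Longrightarrow> (a \<bullet> v) / (a \<bullet> u) = (b \<bullet> v) / (b \<bullet> u) \<Longrightarrow> b = ((b \<bullet> u) / (a \<bullet> u)) \<cdot>\<^sub>v a"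
    using generic_plane[OF V] by metis
  define a1 where "a1 = (\<lambda>i. col A1 i \<bullet> u)"
  define b1 where "b1 = (\<lambda>i. col A1 i \<bullet> v)"
  define a2 where "a2 = (\<lambda>i. col A2 i \<bullet> u)"
  define b2 where "b2 = (\<lambda>i. col A2 i \<bullet> v)"
  define \<phi>1 where "\<phi>1 = (\<lambda>i. char_rv M (\<lambda>\<omega>. Z1 \<omega> $ i))"
  define \<phi>2 where "\<phi>2 = (\<lambda>i. char_rv M (\<lambda>\<omega>. Z2 \<omega> $ i))"
  have a1: "a1 i \<noteq> 0" if "i < k1" for i using that nzV by (auto simp: a1_def V_def)
  have a2: "a2 i \<noteq> 0" if "i < k2" for i using that nzV by (auto simp: a2_def V_def)
  define w where "w = (\<lambda>x y. x \<cdot>\<^sub>v u + y \<cdot>\<^sub>v v)"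
  have w: "w x y \<in> carrier_vec p" for x y using u v by (simp add: w_def)
  have arg: "a \<bullet> w x y = (a \<bullet> u) * x + (a \<bullet> v) * y" if "a \<in> carrier_vec p" for a x y
    using that u v by (simp add: w_def scalar_prod_add_distrib[of _ p])
  define e1 where "e1 = (\<lambda>t. \<i> * of_real (t \<bullet> m1) - of_real (t \<bullet> (S1 *\<^sub>v t)) / 2 :: complex)"
  define e2 where "e2 = (\<lambda>t. \<i> * of_real (t \<bullet> m2) - of_real (t \<bullet> (S2 *\<^sub>v t)) / 2 :: complex)"
  have q: "bivariate_quadratic (\<lambda>x y. e2 (w x y) - e1 (w x y))"
    unfolding e1_def e2_def w_def by (rule bivariate_quadratic_gaussian_exponent[OF u v mS(3,4,1,2)])
  have q0: "e2 (w 0 0) - e1 (w 0 0) = 0"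
  proof -
    have "w 0 0 = 0\<^sub>v p" using u v by (intro eq_vecI) (auto simp: w_def)
    then show ?thesis using mS by (simp add: e1_def e2_def)
  qed
  have eq: "(\<Prod>i<k1. \<phi>1 i (a1 i * x + b1 i * y)) = (\<Prod>i<k2. \<phi>2 i (a2 i * x + b2 i * y)) * exp (e2 (w x y) - e1 (w x y))" for x y
  proof -
    have "(\<Prod>i<k1. \<phi>1 i (a1 i * x + b1 i * y)) * exp (e1 (w x y)) = char_vec M X (w x y)"
      unfolding char_representation[OF rep1 X w] e1_def \<phi>1_def a1_def b1_def using A1 by (simp add: arg)
    also have "\<dots> = (\<Prod>i<k2. \<phi>2 i (a2 i * x + b2 i * y)) * exp (e2 (w x y))"
      unfolding char_representation[OF rep2 X w] e2_def \<phi>2_def a2_def b2_def using A2 by (simp add: arg)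
    finally show ?thesis by (simp add: exp_diff field_simps)
  qed
  define b where "b = b2 j / a2 j"
  obtain P where P: "eventually (\<lambda>z. (\<Prod>i\<in>{i\<in>{..<k1}. b1 i / a1 i = b}. \<phi>1 i (a1 i * z)) =
      (\<Prod>i\<in>{i\<in>{..<k2}. b2 i / a2 i = b}. \<phi>2 i (a2 i * z)) * exp (poly P (of_real z))) (nhds 0)"
    using char_factors_by_slope[of "{..<k1}" "{..<k2}" \<phi>1 \<phi>2 a1 a2 "\<lambda>x y. e2 (w x y) - e1 (w x y)" b1 b2 b]
      Z1 Z2 a1 a2 q q0 eq by (auto simp: \<phi>1_def \<phi>2_def continuous_char_rv char_rv_0)
  have J: "{i\<in>{..<k2}. b2 i / a2 i = b} = {j}"
  proof -
    have "i = j" if "i < k2" "b2 i / a2 i = b" for i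
    proof (rule ccontr)
      assume "i \<noteq> j"
      have "col A2 i = (a2 i / a2 j) \<cdot>\<^sub>v col A2 j"
        using slope[of "col A2 j" "col A2 i"] that j by (auto simp: V_def a2_def b2_def b_def)
      then have "proportional (col A2 i) (col A2 j)"
        unfolding proportional_def using a2 that j by (intro exI[of _ "a2 i / a2 j"]) auto
      then show False using np2[OF \<open>i < k2\<close> j \<open>i \<noteq> j\<close>] by blast
    qed
    then show ?thesis using j b_def by blast
  qed
  show ?thesis
  proof (cases "\<exists>i<k1. b1 i / a1 i = b")
    case False
    then have I: "{i\<in>{..<k1}. b1 i / a1 i = b} = {}" by auto
    have "eventually (\<lambda>z. \<phi>2 j (a2 j * z) = exp (poly (- P) (of_real z))) (nhds 0)"
      using P unfolding I J by eventually_elim (simp add: exp_minus field_simps)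
    then have "eventually (\<lambda>z. \<phi>2 j (a2 j * (1 / a2 j * z)) = exp (poly (- P) (of_real (1 / a2 j * z)))) (nhds 0)"
      by (rule eventually_scaled)
    then have "eventually (\<lambda>t. \<phi>2 j t = exp (poly (pcompose (- P) [:0, of_real (1 / a2 j):]) (of_real t))) (nhds 0)"
      using a2[OF j] by (simp add: poly_pcompose mult.commute)
    then have "\<not> non_gaussian M (\<lambda>\<omega>. Z2 \<omega> $ j)"
      unfolding \<phi>2_def by (rule not_non_gaussian_if_exp_poly[OF Z2[OF j]])
    then show ?thesis using ng[OF j] by blast
  next
    case True
    then obtain i where i: "i < k1" "b1 i / a1 i = b" by blast
    have I: "{i\<in>{..<k1}. b1 i / a1 i = b} = {i}"
    proof -
      have "i' = i" if "i' < k1" "b1 i' / a1 i' = b" for i'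
      proof (rule ccontr)
        assume "i' \<noteq> i"
        have "col A1 i' = (a1 i' / a1 i) \<cdot>\<^sub>v col A1 i"
          using slope[of "col A1 i" "col A1 i'"] that i by (auto simp: V_def a1_def b1_def)
        then have "proportional (col A1 i') (col A1 i)"
          unfolding proportional_def using a1 that i by (intro exI[of _ "a1 i' / a1 i"]) auto
        then show False using np1[OF \<open>i' < k1\<close> i(1) \<open>i' \<noteq> i\<close>] by blast
      qed
      then show ?thesis using i by blast
    qed
    have "eventually (\<lambda>z. \<phi>2 j (a2 j * z) = \<phi>1 i (a1 i * z) * exp (poly (- P) (of_real z))) (nhds 0)"
      using P unfolding I J by eventually_elim (simp add: exp_minus field_simps)
    then have "eventually (\<lambda>z. \<phi>2 j (a2 j * (1 / a1 i * z)) = \<phi>1 i (a1 i * (1 / a1 i * z)) * exp (poly (- P) (of_real (1 / a1 i * z)))) (nhds 0)"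
      by (rule eventually_scaled)
    then have "eventually (\<lambda>t. \<phi>2 j (a2 j / a1 i * t) = \<phi>1 i t * exp (poly (pcompose (- P) [:0, of_real (1 / a1 i):]) (of_real t))) (nhds 0)"
      using a1[OF i(1)] by (simp add: poly_pcompose mult.commute)
    then have "char_related M (\<lambda>\<omega>. Z2 \<omega> $ j) (a2 j / a1 i) (\<lambda>\<omega>. Z1 \<omega> $ i) (pcompose (- P) [:0, of_real (1 / a1 i):])"
      by (simp add: char_related_def \<phi>1_def \<phi>2_def)
    moreover have "col A2 j = (a2 j / a1 i) \<cdot>\<^sub>v col A1 i"
      using slope[of "col A1 i" "col A2 j"] i j by (auto simp: V_def a1_def b1_def a2_def b2_def b_def)
    moreover have "a2 j / a1 i \<noteq> 0" using a1 a2 i j by simp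
    ultimately show ?thesis using i(1) by blast
  qed
qed

text \<open>
  Two columns matched with the same vector are proportional to each other.
\<close>

lemma matching_inj:
  assumes rep: "linear_gaussian_representation M p X k A Z E m S"
    and f: "\<And>j. j < k \<Longrightarrow> l j \<noteq> 0 \<and> col A j = l j \<cdot>\<^sub>v c (f j)" 
  shows "inj_on f {..<k}"
proof (rule inj_onI, rule ccontr)
  fix i j assume ij: "i \<in> {..<k}" "j \<in> {..<k}" "f i = f j" "i \<noteq> j"
  have "col A i = (l i / l j) \<cdot>\<^sub>v col A j"
    using f[of i] f[of j] ij by (simp add: smult_smult_assoc)
  then have "proportional (col A i) (col A j)"
    unfolding proportional_def using f ij by (intro exI[of _ "l i / l j"]) auto
  then show False using rep ij by (auto simp: linear_gaussian_representation_def)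
qed

lemma distinct_cols_representation:
  assumes rep: "linear_gaussian_representation M p X k A Z E m S"
  shows "distinct (cols A)"
proof -
  have "inj_on (col A) {..<k}"
    by (rule matching_inj[OF rep, of "\<lambda>_. 1" "\<lambda>v. v"]) simp
  then show ?thesis using rep
    by (auto simp: linear_gaussian_representation_def cols_def distinct_map atLeast0LessThan atLeastLessThan_upt[symmetric])
qed

text \<open>
  The vector \<open>t\<close> is dual to the column \<open>\<rho> j\<close> of \<open>A1\<close>, hence orthogonal to all columns of \<open>A2\<close> except the \<open>j\<close>-th.
  Along the line spanned by \<open>t\<close> all other factors are \<open>\<phi>(0) = 1\<close>, and the sources \<open>\<rho> j\<close> and \<open>j\<close> are compared
  on the whole real line.
\<close>

lemma source_relation_if_left_inverse:
  assumes X: "X \<in> M \<rightarrow>\<^sub>M borel_vec p"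
    and rep1: "linear_gaussian_representation M p X k A1 Z1 E1 m1 S1"
    and rep2: "linear_gaussian_representation M p X k A2 Z2 E2 m2 S2"
    and \<rho>: "\<rho> permutes {..<k}" and lam: "\<And>j. j < k \<Longrightarrow> col A2 j = lam j \<cdot>\<^sub>v col A1 (\<rho> j)"
    and t: "t \<in> carrier_vec p" "\<And>i. i < k \<Longrightarrow> col A1 i \<bullet> t = (if i = \<rho> j then 1 else 0)" and j: "j < k"
  shows "char_rv M (\<lambda>\<omega>. Z2 \<omega> $ j) (lam j * s) = char_rv M (\<lambda>\<omega>. Z1 \<omega> $ \<rho> j) s *
     exp (\<i> * of_real ((t \<bullet> m1 - t \<bullet> m2) * s) + of_real ((t \<bullet> (S2 *\<^sub>v t) - t \<bullet> (S1 *\<^sub>v t)) * s\<^sup>2 / 2))"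
proof -
  have A1: "A1 \<in> carrier_mat p k" and A2: "A2 \<in> carrier_mat p k"
    and Z1: "\<And>i. i < k \<Longrightarrow> (\<lambda>\<omega>. Z1 \<omega> $ i) \<in> borel_measurable M" and Z2: "\<And>i. i < k \<Longrightarrow> (\<lambda>\<omega>. Z2 \<omega> $ i) \<in> borel_measurable M"
    and mS: "m1 \<in> carrier_vec p" "S1 \<in> carrier_mat p p" "m2 \<in> carrier_vec p" "S2 \<in> carrier_mat p p"
    using rep1 rep2 unfolding linear_gaussian_representation_def gaussian_vec_def pos_semidef_def measurable_borel_vec_iff
    by auto
  have \<rho>k: "\<rho> i < k" if "i < k" for i using permutes_in_image[OF \<rho>, of i] that by simp
  have st: "s \<cdot>\<^sub>v t \<in> carrier_vec p" using t by simp
  have ex: "(s \<cdot>\<^sub>v t) \<bullet> m = s * (t \<bullet> m)" "(s \<cdot>\<^sub>v t) \<bullet> (S *\<^sub>v (s \<cdot>\<^sub>v t)) = s\<^sup>2 * (t \<bullet> (S *\<^sub>v t))"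
    if "m \<in> carrier_vec p" "S \<in> carrier_mat p p" for m S
    using that t(1) by (simp_all add: mult_mat_vec[of _ p p] power2_eq_square)
  have "(\<Prod>i<k. char_rv M (\<lambda>\<omega>. Z1 \<omega> $ i) (col A1 i \<bullet> (s \<cdot>\<^sub>v t))) = (\<Prod>i<k. if i = \<rho> j then char_rv M (\<lambda>\<omega>. Z1 \<omega> $ i) s else 1)"
    using A1 t Z1 by (intro prod.cong) (auto simp: char_rv_0)
  also have "\<dots> = char_rv M (\<lambda>\<omega>. Z1 \<omega> $ \<rho> j) s" using \<rho>k[OF j] by simp
  finally have p1: "(\<Prod>i<k. char_rv M (\<lambda>\<omega>. Z1 \<omega> $ i) (col A1 i \<bullet> (s \<cdot>\<^sub>v t))) = char_rv M (\<lambda>\<omega>. Z1 \<omega> $ \<rho> j) s" .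
  have c2: "col A2 i \<bullet> (s \<cdot>\<^sub>v t) = (if i = j then lam j * s else 0)" if "i < k" for i
  proof -
    have "col A2 i \<bullet> (s \<cdot>\<^sub>v t) = lam i * (s * (col A1 (\<rho> i) \<bullet> t))"
      unfolding lam[OF that] using A1 t(1) \<rho>k[OF that] by simp
    also have "\<dots> = (if i = j then lam j * s else 0)"
      using t(2)[OF \<rho>k[OF that]] permutes_inj[OF \<rho>] by (auto simp: inj_eq)
    finally show ?thesis .
  qed
  have "(\<Prod>i<k. char_rv M (\<lambda>\<omega>. Z2 \<omega> $ i) (col A2 i \<bullet> (s \<cdot>\<^sub>v t))) = (\<Prod>i<k. if i = j then char_rv M (\<lambda>\<omega>. Z2 \<omega> $ i) (lam j * s) else 1)"
    using Z2 by (intro prod.cong) (auto simp: char_rv_0 c2)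
  also have "\<dots> = char_rv M (\<lambda>\<omega>. Z2 \<omega> $ j) (lam j * s)" using j by simp
  finally have p2: "(\<Prod>i<k. char_rv M (\<lambda>\<omega>. Z2 \<omega> $ i) (col A2 i \<bullet> (s \<cdot>\<^sub>v t))) = char_rv M (\<lambda>\<omega>. Z2 \<omega> $ j) (lam j * s)" .
  let ?e1 = "\<i> * of_real (s * (t \<bullet> m1)) - of_real (s\<^sup>2 * (t \<bullet> (S1 *\<^sub>v t))) / 2 :: complex"
  let ?e2 = "\<i> * of_real (s * (t \<bullet> m2)) - of_real (s\<^sup>2 * (t \<bullet> (S2 *\<^sub>v t))) / 2 :: complex"
  have "char_rv M (\<lambda>\<omega>. Z2 \<omega> $ j) (lam j * s) * exp ?e2 = char_rv M (\<lambda>\<omega>. Z1 \<omega> $ \<rho> j) s * exp ?e1"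
    using char_representation[OF rep1 X st] char_representation[OF rep2 X st]
    unfolding p1 p2 ex[OF mS(1,2)] ex[OF mS(3,4)] by simp
  moreover have "x = y * exp (e1 - e2)" if "x * exp e2 = y * exp e1" for x y e1 e2 :: complex
    using that by (simp add: exp_diff eq_divide_eq)
  ultimately have "char_rv M (\<lambda>\<omega>. Z2 \<omega> $ j) (lam j * s) = char_rv M (\<lambda>\<omega>. Z1 \<omega> $ \<rho> j) s * exp (?e1 - ?e2)"
    by blast
  also have "?e1 - ?e2 = \<i> * of_real ((t \<bullet> m1 - t \<bullet> m2) * s) + of_real ((t \<bullet> (S2 *\<^sub>v t) - t \<bullet> (S1 *\<^sub>v t)) * s\<^sup>2 / 2)"
    by (simp add: complex_eq_iff field_simps)
  finally show ?thesis .
qed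

text \<open>
  The Gaussian part of a representation supplies noise independent of the sources on the given probability
  space, as soon as it is non-degenerate in some direction \<open>t\<close>.
\<close>

lemma noise_from_representation:
  assumes rep: "linear_gaussian_representation M p X k A Z E m S"
    and t: "t \<in> carrier_vec p" and i: "i < k" and pos: "t \<bullet> (S *\<^sub>v t) > 0" and c: "c \<ge> 0"
  obtains G where "gaussian_rv M G 0 ((sqrt c)\<^sup>2)" "indep_var borel G borel (\<lambda>\<omega>. Z \<omega> $ i)"
proof -
  have E: "gaussian_vec M p E m S" and ind: "indep_var (borel_vec p) E (borel_vec k) Z"
    using rep by (auto simp: linear_gaussian_representation_def)
  \<comment> \<open>rescales the variance \<open>t \<bullet> S t\<close> of the projection \<open>t \<bullet> E\<close> to \<open>c\<close>\<close>
  define r where "r = sqrt (c / (t \<bullet> (S *\<^sub>v t)))"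
  have "r\<^sup>2 * (t \<bullet> (S *\<^sub>v t)) = (sqrt c)\<^sup>2" using pos c by (simp add: r_def)
  then have "gaussian_rv M (\<lambda>\<omega>. r * (t \<bullet> E \<omega> - t \<bullet> m)) 0 ((sqrt c)\<^sup>2)"
    using gaussian_rv_scaled_projection[OF E t, of r] by simp
  moreover have "indep_var borel (\<lambda>\<omega>. r * (t \<bullet> E \<omega> - t \<bullet> m)) borel (\<lambda>\<omega>. Z \<omega> $ i)"
  proof (rule indep_var_measurable_pair[OF ind, of "\<lambda>e. r * (t \<bullet> e - t \<bullet> m)" "\<lambda>z. z $ i"])
    show "(\<lambda>e. r * (t \<bullet> e - t \<bullet> m)) \<in> borel_measurable (borel_vec p)"
      using measurable_scalar_prod_borel_vec[OF t] by measurable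
    show "(\<lambda>z. z $ i) \<in> borel_measurable (borel_vec k)"
      using measurable_borel_vec_iff[of "\<lambda>v. v" "borel_vec k" k] i by simp
  qed
  ultimately show ?thesis using that by blast
qed

text \<open>
  For \<open>c < 0\<close> and \<open>c > 0\<close> the noise is supplied by the hypotheses; for \<open>c = 0\<close> the zero variable serves, and
  every admissible noise has variance \<open>0\<close>.
\<close>

lemma noise_dichotomy:
  assumes U [measurable]: "U \<in> borel_measurable M" and V [measurable]: "V \<in> borel_measurable M"
    and rel: "\<And>s. char_rv M U (l * s) = char_rv M V s * exp (\<i> * of_real (d * s) + of_real (c * s\<^sup>2 / 2))"
    and G1: "c < 0 \<Longrightarrow> \<exists>G. gaussian_rv M G 0 ((sqrt (- c))\<^sup>2) \<and> indep_var borel G borel V"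
    and G2: "c > 0 \<Longrightarrow> \<exists>G. gaussian_rv M G 0 ((sqrt c)\<^sup>2) \<and> indep_var borel G borel U"
  shows "\<exists>\<nu> \<sigma> G. (c \<le> 0 \<longrightarrow> noise_on_first M U l V \<nu> \<sigma> G) \<and> (c \<ge> 0 \<longrightarrow> noise_on_second M U l V \<nu> \<sigma> G)"
    and "c \<noteq> 0 \<longrightarrow> (\<exists>\<nu> \<sigma> G. noise_on_first M U l V \<nu> \<sigma> G) \<noteq> (\<exists>\<nu> \<sigma> G. noise_on_second M U l V \<nu> \<sigma> G)"
    and "c = 0 \<longrightarrow> (\<forall>\<nu> \<sigma> G. (noise_on_first M U l V \<nu> \<sigma> G \<longleftrightarrow> noise_on_second M U l V \<nu> \<sigma> G) \<and>
        (noise_on_first M U l V \<nu> \<sigma> G \<longrightarrow> (AE \<omega> in M. G \<omega> = 0)))"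
proof -
  have first_neg: "c \<le> 0" if "noise_on_first M U l V \<nu> \<sigma> G" for \<nu> \<sigma> G
    using noise_on_first_variance[OF U V rel that] by (metis neg_0_le_iff_le zero_le_power2)
  have second_pos: "c \<ge> 0" if "noise_on_second M U l V \<nu> \<sigma> G" for \<nu> \<sigma> G
    using noise_on_second_variance[OF U V rel that] by (metis zero_le_power2)
  have neg: "\<exists>\<nu> \<sigma> G. noise_on_first M U l V \<nu> \<sigma> G" if "c < 0"
  proof -
    obtain G where "gaussian_rv M G 0 ((sqrt (- c))\<^sup>2)" "indep_var borel G borel V" using G1[OF \<open>c < 0\<close>] by blast
    then have "noise_on_first M U l V (- d) (sqrt (- c)) G"
      using that by (intro noise_on_firstI[OF U V rel]) auto
    then show ?thesis by blast
  qed
  have pos: "\<exists>\<nu> \<sigma> G. noise_on_second M U l V \<nu> \<sigma> G" if "c > 0"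
  proof -
    obtain G where "gaussian_rv M G 0 ((sqrt c)\<^sup>2)" "indep_var borel G borel U" using G2[OF \<open>c > 0\<close>] by blast
    then have "noise_on_second M U l V (- d) (sqrt c) G"
      using that by (intro noise_on_secondI[OF U V rel]) auto
    then show ?thesis by blast
  qed
  have zero: "noise_on_first M U l V (- d) 0 (\<lambda>_. 0) \<and> noise_on_second M U l V (- d) 0 (\<lambda>_. 0)" if "c = 0"
  proof -
    have g: "gaussian_rv M (\<lambda>_. 0) 0 (0\<^sup>2)"
      by (simp add: gaussian_rv_def char_rv_def char_def integral_distr prob_space del: distr_const)
    have "indep_var borel (\<lambda>_. 0 :: real) borel V" "indep_var borel (\<lambda>_. 0 :: real) borel U"
      by (intro indep_var_AE_zero; simp)+
    then show ?thesis using that g by (auto intro!: noise_on_firstI[OF U V rel] noise_on_secondI[OF U V rel])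
  qed
  show "\<exists>\<nu> \<sigma> G. (c \<le> 0 \<longrightarrow> noise_on_first M U l V \<nu> \<sigma> G) \<and> (c \<ge> 0 \<longrightarrow> noise_on_second M U l V \<nu> \<sigma> G)"
    using neg pos zero by (cases c "0 :: real" rule: linorder_cases) (fastforce, blast, fastforce)
  show "c \<noteq> 0 \<longrightarrow> (\<exists>\<nu> \<sigma> G. noise_on_first M U l V \<nu> \<sigma> G) \<noteq> (\<exists>\<nu> \<sigma> G. noise_on_second M U l V \<nu> \<sigma> G)"
    using neg pos first_neg second_pos by (metis leD linorder_neqE_linordered_idom)
  show "c = 0 \<longrightarrow> (\<forall>\<nu> \<sigma> G. (noise_on_first M U l V \<nu> \<sigma> G \<longleftrightarrow> noise_on_second M U l V \<nu> \<sigma> G) \<and>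
        (noise_on_first M U l V \<nu> \<sigma> G \<longrightarrow> (AE \<omega> in M. G \<omega> = 0)))"
  proof (intro impI allI)
    fix \<nu> \<sigma> G assume "c = 0"
    have AE1: "AE \<omega> in M. G \<omega> = 0" if N: "noise_on_first M U l V \<nu> \<sigma> G"
    proof -
      have "\<sigma>\<^sup>2 = 0" using noise_on_first_variance[OF U V rel N] \<open>c = 0\<close> by simp
      then show ?thesis using N AE_zero_if_gaussian_variance_0 by (simp add: noise_on_first_def)
    qed
    have AE2: "AE \<omega> in M. G \<omega> = 0" if N: "noise_on_second M U l V \<nu> \<sigma> G"
    proof -
      have "\<sigma>\<^sup>2 = 0" using noise_on_second_variance[OF U V rel N] \<open>c = 0\<close> by simp
      then show ?thesis using N AE_zero_if_gaussian_variance_0 by (simp add: noise_on_second_def)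
    qed
    show "(noise_on_first M U l V \<nu> \<sigma> G \<longleftrightarrow> noise_on_second M U l V \<nu> \<sigma> G) \<and>
        (noise_on_first M U l V \<nu> \<sigma> G \<longrightarrow> (AE \<omega> in M. G \<omega> = 0))"
      using AE1 AE2 noise_on_first_iff_second_if_zero[OF U V] by blast
  qed
qed

end

section \<open>The identifiability theorem\<close>

theorem theorem5p5:
  fixes M :: "'a measure"
    and p k1 k2 :: nat
    and X Z1 Z2 E1 E2 :: "'a \<Rightarrow> real Matrix.vec"
    and A1 A2 S1 S2 :: "real mat"
    and m1 m2 :: "real Matrix.vec"
  assumes "prob_space M"
    and "X \<in> M \<rightarrow>\<^sub>M borel_vec p"
    and "linear_gaussian_representation M p X k1 A1 Z1 E1 m1 S1"
    and "linear_gaussian_representation M p X k2 A2 Z2 E2 m2 S2"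
  shows "k1 = k2 \<and>
    (\<exists>\<rho> P lam. \<exists>g :: nat \<Rightarrow> complex poly.
      \<rho> permutes {..<k1} \<and>
      P \<in> carrier_mat k1 k1 \<and> (\<forall>j<k1. P *\<^sub>v unit_vec k1 j = unit_vec k1 (\<rho> j)) \<and>
      invertible_mat (mat_diag k1 lam) \<and>
      A2 = A1 * P * mat_diag k1 lam \<and>
      vec_space.rank p A2 = vec_space.rank p A1 \<and>
      (\<forall>j<k1. char_related M (\<lambda>\<omega>. Z2 \<omega> $ j) (lam j) (\<lambda>\<omega>. Z1 \<omega> $ \<rho> j) (g j)) \<and>
      (\<forall>j<k1. \<forall>h.
        (char_related M (\<lambda>\<omega>. Z2 \<omega> $ j) (lam j) (\<lambda>\<omega>. Z1 \<omega> $ \<rho> j) h \<longleftrightarrow>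
          (\<exists>n::int. h = g j + [: 2 * of_real pi * \<i> * of_int n :])) \<and>
        (char_related M (\<lambda>\<omega>. Z2 \<omega> $ j) (lam j) (\<lambda>\<omega>. Z1 \<omega> $ \<rho> j) h \<longrightarrow>
          degree h = degree (g j) \<and> pderiv (pderiv h) = pderiv (pderiv (g j)))) \<and>
      (has_left_inverse A1 \<longleftrightarrow> vec_space.rank p A1 = k1) \<and>
      (has_left_inverse A2 \<longleftrightarrow> vec_space.rank p A2 = k1) \<and>
      (has_left_inverse A2 \<longleftrightarrow> has_left_inverse A1) \<and>
      (has_left_inverse A1 \<longrightarrow>
        (\<forall>j<k1.
          degree (g j) \<le> 2 \<and>
          (\<exists>c::real. pderiv (pderiv (g j)) = [: of_real c :] \<and>
            (\<exists>\<nu> \<sigma> G.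
              (c \<le> 0 \<longrightarrow> noise_on_first M (\<lambda>\<omega>. Z2 \<omega> $ j) (lam j) (\<lambda>\<omega>. Z1 \<omega> $ \<rho> j) \<nu> \<sigma> G) \<and>
              (c \<ge> 0 \<longrightarrow> noise_on_second M (\<lambda>\<omega>. Z2 \<omega> $ j) (lam j) (\<lambda>\<omega>. Z1 \<omega> $ \<rho> j) \<nu> \<sigma> G)) \<and>
            (c \<noteq> 0 \<longrightarrow>
              (\<exists>\<nu> \<sigma> G. noise_on_first M (\<lambda>\<omega>. Z2 \<omega> $ j) (lam j) (\<lambda>\<omega>. Z1 \<omega> $ \<rho> j) \<nu> \<sigma> G) \<noteq>
              (\<exists>\<nu> \<sigma> G. noise_on_second M (\<lambda>\<omega>. Z2 \<omega> $ j) (lam j) (\<lambda>\<omega>. Z1 \<omega> $ \<rho> j) \<nu> \<sigma> G)) \<and>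
            (c = 0 \<longrightarrow> (\<forall>\<nu> \<sigma> G.
              (noise_on_first M (\<lambda>\<omega>. Z2 \<omega> $ j) (lam j) (\<lambda>\<omega>. Z1 \<omega> $ \<rho> j) \<nu> \<sigma> G \<longleftrightarrow>
               noise_on_second M (\<lambda>\<omega>. Z2 \<omega> $ j) (lam j) (\<lambda>\<omega>. Z1 \<omega> $ \<rho> j) \<nu> \<sigma> G) \<and>
              (noise_on_first M (\<lambda>\<omega>. Z2 \<omega> $ j) (lam j) (\<lambda>\<omega>. Z1 \<omega> $ \<rho> j) \<nu> \<sigma> G \<longrightarrow>
                (AE \<omega> in M. G \<omega> = 0))))))))"
proof -
  interpret prob_space M by fact
  note X = assms(2) and rep1 = assms(3) and rep2 = assms(4)
  have "\<exists>f l g. \<forall>j<k2. f j < k1 \<and> l j \<noteq> 0 \<and> col A2 j = l j \<cdot>\<^sub>v col A1 (f j) \<and>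
      char_related M (\<lambda>\<omega>. Z2 \<omega> $ j) (l j) (\<lambda>\<omega>. Z1 \<omega> $ f j) (g j)"
    using representation_column_matched[OF X rep1 rep2] by metis
  then obtain f lam and g :: "nat \<Rightarrow> complex poly" where
    f: "\<And>j. j < k2 \<Longrightarrow> f j < k1" and lam: "\<And>j. j < k2 \<Longrightarrow> lam j \<noteq> 0"
    and cols: "\<And>j. j < k2 \<Longrightarrow> col A2 j = lam j \<cdot>\<^sub>v col A1 (f j)"
    and g: "\<And>j. j < k2 \<Longrightarrow> char_related M (\<lambda>\<omega>. Z2 \<omega> $ j) (lam j) (\<lambda>\<omega>. Z1 \<omega> $ f j) (g j)"
    by blast
  have inj: "inj_on f {..<k2}"
    by (rule matching_inj[OF rep2, of lam "col A1"]) (use lam cols in auto)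
  have "\<exists>f l. \<forall>j<k1. f j < k2 \<and> l j \<noteq> 0 \<and> col A1 j = l j \<cdot>\<^sub>v col A2 (f j)"
    using representation_column_matched[OF X rep2 rep1] by metis
  then obtain f' lam' where f': "\<And>j. j < k1 \<Longrightarrow> f' j < k2"
    and cols': "\<And>j. j < k1 \<Longrightarrow> lam' j \<noteq> 0 \<and> col A1 j = lam' j \<cdot>\<^sub>v col A2 (f' j)" by blast
  have inj': "inj_on f' {..<k1}" 
    by (rule matching_inj[OF rep1, of lam' "col A2"]) (use cols' in auto)
  have "k2 \<le> k1" using card_inj_on_le[OF inj, of "{..<k1}"] f by auto
  moreover have "k1 \<le> k2" using card_inj_on_le[OF inj', of "{..<k2}"] f' by auto
  ultimately have k: "k2 = k1" by simp
  note f = f[unfolded k] and lam = lam[unfolded k] and cols = cols[unfolded k] and g = g[unfolded k]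
    and inj = inj[unfolded k] and f' = f'[unfolded k] and rep2 = rep2[unfolded k]
  \<comment> \<open>extended by the identity, because a permutation of a set must fix everything outside of it\<close>
  define \<rho> where "\<rho> = (\<lambda>j. if j < k1 then f j else j)"
  have \<rho>f: "\<rho> j = f j" if "j < k1" for j using that by (simp add: \<rho>_def)
  have "f ` {..<k1} = {..<k1}" using inj f by (intro endo_inj_surj) auto
  then have "bij_betw f {..<k1} {..<k1}" using inj by (simp add: bij_betw_def)
  then have "bij_betw \<rho> {..<k1} {..<k1}" by (rule bij_betw_cong[THEN iffD2, rotated]) (simp add: \<rho>_def)
  then have \<rho>: "\<rho> permutes {..<k1}" by (rule bij_imp_permutes) (simp add: \<rho>_def)
  have A1: "A1 \<in> carrier_mat p k1" and A2: "A2 \<in> carrier_mat p k1"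
    and Z1: "\<And>i. i < k1 \<Longrightarrow> (\<lambda>\<omega>. Z1 \<omega> $ i) \<in> borel_measurable M" and Z2: "\<And>i. i < k1 \<Longrightarrow> (\<lambda>\<omega>. Z2 \<omega> $ i) \<in> borel_measurable M"
    using rep1 rep2 unfolding linear_gaussian_representation_def measurable_borel_vec_iff by auto
  have colsr: "\<And>j. j < k1 \<Longrightarrow> col A2 j = lam j \<cdot>\<^sub>v col A1 (\<rho> j)" using cols by (simp add: \<rho>f)
  have gr: "\<And>j. j < k1 \<Longrightarrow> char_related M (\<lambda>\<omega>. Z2 \<omega> $ j) (lam j) (\<lambda>\<omega>. Z1 \<omega> $ \<rho> j) (g j)" using g by (simp add: \<rho>f)
  have \<rho>k: "\<rho> j < k1" if "j < k1" for j using f that by (simp add: \<rho>f)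
  have rank: "vec_space.rank p A2 = vec_space.rank p A1"
    by (rule rank_eq_if_cols_multiples[OF A2 A1]) (use cols f cols' f' in blast)+
  have inv1: "has_left_inverse A1 \<longleftrightarrow> vec_space.rank p A1 = k1"
    by (rule has_left_inverse_iff_full_rank[OF A1 distinct_cols_representation[OF rep1]])
  have inv2: "has_left_inverse A2 \<longleftrightarrow> vec_space.rank p A2 = k1"
    by (rule has_left_inverse_iff_full_rank[OF A2 distinct_cols_representation[OF rep2]])
  have uniq: "char_related M (\<lambda>\<omega>. Z2 \<omega> $ j) (lam j) (\<lambda>\<omega>. Z1 \<omega> $ \<rho> j) h \<longleftrightarrow>
      (\<exists>n::int. h = g j + [: 2 * of_real pi * \<i> * of_int n :])" if "j < k1" for j h
    by (rule char_related_unique[OF Z2[OF that] Z1[OF \<rho>k[OF that]] gr[OF that]])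
  have split: "degree (g j) \<le> 2 \<and>
      (\<exists>c::real. pderiv (pderiv (g j)) = [: of_real c :] \<and>
        (\<exists>\<nu> \<sigma> G.
          (c \<le> 0 \<longrightarrow> noise_on_first M (\<lambda>\<omega>. Z2 \<omega> $ j) (lam j) (\<lambda>\<omega>. Z1 \<omega> $ \<rho> j) \<nu> \<sigma> G) \<and>
          (c \<ge> 0 \<longrightarrow> noise_on_second M (\<lambda>\<omega>. Z2 \<omega> $ j) (lam j) (\<lambda>\<omega>. Z1 \<omega> $ \<rho> j) \<nu> \<sigma> G)) \<and>
        (c \<noteq> 0 \<longrightarrow>
          (\<exists>\<nu> \<sigma> G. noise_on_first M (\<lambda>\<omega>. Z2 \<omega> $ j) (lam j) (\<lambda>\<omega>. Z1 \<omega> $ \<rho> j) \<nu> \<sigma> G) \<noteq>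
          (\<exists>\<nu> \<sigma> G. noise_on_second M (\<lambda>\<omega>. Z2 \<omega> $ j) (lam j) (\<lambda>\<omega>. Z1 \<omega> $ \<rho> j) \<nu> \<sigma> G)) \<and>
        (c = 0 \<longrightarrow> (\<forall>\<nu> \<sigma> G.
          (noise_on_first M (\<lambda>\<omega>. Z2 \<omega> $ j) (lam j) (\<lambda>\<omega>. Z1 \<omega> $ \<rho> j) \<nu> \<sigma> G \<longleftrightarrow>
           noise_on_second M (\<lambda>\<omega>. Z2 \<omega> $ j) (lam j) (\<lambda>\<omega>. Z1 \<omega> $ \<rho> j) \<nu> \<sigma> G) \<and>
          (noise_on_first M (\<lambda>\<omega>. Z2 \<omega> $ j) (lam j) (\<lambda>\<omega>. Z1 \<omega> $ \<rho> j) \<nu> \<sigma> G \<longrightarrow>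
            (AE \<omega> in M. G \<omega> = 0)))))"
    if inv: "has_left_inverse A1" and j: "j < k1" for j
  proof -
    obtain B where B: "B \<in> carrier_mat k1 p" "B * A1 = 1\<^sub>m k1"
      using inv A1 by (auto simp: has_left_inverse_def)
    \<comment> \<open>a row of the left inverse is dual to the columns of \<open>A1\<close>\<close>
    define t where "t = row B (\<rho> j)"
    have t: "t \<in> carrier_vec p" using B by (auto simp: t_def)
    have dual: "col A1 i \<bullet> t = (if i = \<rho> j then 1 else 0)" if i: "i < k1" for i
    proof -
      have "col A1 i \<bullet> t = t \<bullet> col A1 i" using t A1 by (intro comm_scalar_prod[of _ p]) auto
      also have "\<dots> = (B * A1) $$ (\<rho> j, i)" using B(1) A1 i \<rho>k[OF j] by (simp add: t_def)
      finally show ?thesis using i \<rho>k[OF j] by (simp add: B(2))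
    qed
    define v1 where "v1 = t \<bullet> (S1 *\<^sub>v t)"
    define v2 where "v2 = t \<bullet> (S2 *\<^sub>v t)"
    have v: "v1 \<ge> 0" "v2 \<ge> 0"
      using rep1 rep2 t by (auto simp: v1_def v2_def linear_gaussian_representation_def gaussian_vec_def pos_semidef_def)
    define c where "c = v2 - v1"
    define d where "d = t \<bullet> m1 - t \<bullet> m2"
    have rel: "char_rv M (\<lambda>\<omega>. Z2 \<omega> $ j) (lam j * s) = char_rv M (\<lambda>\<omega>. Z1 \<omega> $ \<rho> j) s *
        exp (\<i> * of_real (d * s) + of_real (c * s\<^sup>2 / 2))" for s
      unfolding c_def d_def v1_def v2_def
      by (rule source_relation_if_left_inverse[OF X rep1 rep2 \<rho> colsr t dual j])
    define q where "q = [: 0, \<i> * of_real d, of_real (c / 2) :]"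
    have "char_related M (\<lambda>\<omega>. Z2 \<omega> $ j) (lam j) (\<lambda>\<omega>. Z1 \<omega> $ \<rho> j) q"
      unfolding char_related_def rel by (simp add: q_def power2_eq_square algebra_simps)
    then obtain n :: int where n: "q = g j + [: 2 * of_real pi * \<i> * of_int n :]"
      using uniq[OF j] by blast
    have deg: "degree (g j) \<le> 2"
    proof -
      have "degree q = degree (g j)" unfolding n by (rule degree_add_const)
      moreover have "degree q \<le> 2"
        by (rule degree_le) (auto simp: q_def coeff_pCons split: nat.split)
      ultimately show ?thesis by simp
    qed
    have pd: "pderiv (pderiv (g j)) = [: of_real c :]"
    proof -
      have "pderiv (pderiv q) = pderiv (pderiv (g j))" unfolding n by (rule pderiv2_add_const)
      then show ?thesis by (simp add: q_def pderiv_pCons)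
    qed
    have G1: "\<exists>G. gaussian_rv M G 0 ((sqrt (- c))\<^sup>2) \<and> indep_var borel G borel (\<lambda>\<omega>. Z1 \<omega> $ \<rho> j)" if "c < 0"
      using noise_from_representation[OF rep1 t \<rho>k[OF j], of "- c"] that v by (auto simp: c_def v1_def)
    have G2: "\<exists>G. gaussian_rv M G 0 ((sqrt c)\<^sup>2) \<and> indep_var borel G borel (\<lambda>\<omega>. Z2 \<omega> $ j)" if "c > 0"
      using noise_from_representation[OF rep2 t j, of c] that v by (auto simp: c_def v2_def)
    show ?thesis
      using deg pd noise_dichotomy[OF Z2[OF j] Z1[OF \<rho>k[OF j]] rel G1 G2] by blast
  qed
  show ?thesis
  proof (intro conjI exI[of _ \<rho>] exI[of _ "permutation_matrix k1 \<rho>"] exI[of _ lam] exI[of _ g])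
    show "k1 = k2" using k by simp
    show "\<rho> permutes {..<k1}" by fact
    show "permutation_matrix k1 \<rho> \<in> carrier_mat k1 k1" by (simp add: permutation_matrix_def)
    show "\<forall>j<k1. permutation_matrix k1 \<rho> *\<^sub>v unit_vec k1 j = unit_vec k1 (\<rho> j)"
      by (simp add: permutation_matrix_unit_vec)
    show "invertible_mat (mat_diag k1 lam)" using lam by (rule invertible_mat_diag)
    show "A2 = A1 * permutation_matrix k1 \<rho> * mat_diag k1 lam"
      by (rule mult_permutation_diag[OF A1 A2 \<rho>k colsr])
    show "\<forall>j<k1. \<forall>h.
        (char_related M (\<lambda>\<omega>. Z2 \<omega> $ j) (lam j) (\<lambda>\<omega>. Z1 \<omega> $ \<rho> j) h \<longleftrightarrow>
          (\<exists>n::int. h = g j + [: 2 * of_real pi * \<i> * of_int n :])) \<and>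
        (char_related M (\<lambda>\<omega>. Z2 \<omega> $ j) (lam j) (\<lambda>\<omega>. Z1 \<omega> $ \<rho> j) h \<longrightarrow>
          degree h = degree (g j) \<and> pderiv (pderiv h) = pderiv (pderiv (g j)))"
      using uniq by (auto simp: degree_add_const pderiv2_add_const simp del: pCons_0_0)
    show "has_left_inverse A2 \<longleftrightarrow> has_left_inverse A1" using inv1 inv2 rank by simp
    show "has_left_inverse A1 \<longrightarrow> (\<forall>j<k1. degree (g j) \<le> 2 \<and>
          (\<exists>c::real. pderiv (pderiv (g j)) = [: of_real c :] \<and>
            (\<exists>\<nu> \<sigma> G.
              (c \<le> 0 \<longrightarrow> noise_on_first M (\<lambda>\<omega>. Z2 \<omega> $ j) (lam j) (\<lambda>\<omega>. Z1 \<omega> $ \<rho> j) \<nu> \<sigma> G) \<and>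
              (c \<ge> 0 \<longrightarrow> noise_on_second M (\<lambda>\<omega>. Z2 \<omega> $ j) (lam j) (\<lambda>\<omega>. Z1 \<omega> $ \<rho> j) \<nu> \<sigma> G)) \<and>
            (c \<noteq> 0 \<longrightarrow>
              (\<exists>\<nu> \<sigma> G. noise_on_first M (\<lambda>\<omega>. Z2 \<omega> $ j) (lam j) (\<lambda>\<omega>. Z1 \<omega> $ \<rho> j) \<nu> \<sigma> G) \<noteq>
              (\<exists>\<nu> \<sigma> G. noise_on_second M (\<lambda>\<omega>. Z2 \<omega> $ j) (lam j) (\<lambda>\<omega>. Z1 \<omega> $ \<rho> j) \<nu> \<sigma> G)) \<and>
            (c = 0 \<longrightarrow> (\<forall>\<nu> \<sigma> G.
              (noise_on_first M (\<lambda>\<omega>. Z2 \<omega> $ j) (lam j) (\<lambda>\<omega>. Z1 \<omega> $ \<rho> j) \<nu> \<sigma> G \<longleftrightarrow>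
               noise_on_second M (\<lambda>\<omega>. Z2 \<omega> $ j) (lam j) (\<lambda>\<omega>. Z1 \<omega> $ \<rho> j) \<nu> \<sigma> G) \<and>
              (noise_on_first M (\<lambda>\<omega>. Z2 \<omega> $ j) (lam j) (\<lambda>\<omega>. Z1 \<omega> $ \<rho> j) \<nu> \<sigma> G \<longrightarrow>
                (AE \<omega> in M. G \<omega> = 0))))))"
      using split by blast
  qed (use rank inv1 inv2 gr in auto)
qed

end
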